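(* Let $\mathbb{K}^{\infty}_{BM}$ be the set of all functions $f:[0,1]\to\mathbb{R}$ with Lipschitz constant at most $1$ and $f(0)=0$, and let $\mathbb{K}^{\infty}_{BB}$ be the set of all functions $f:[0,1]\to\mathbb{R}$ with Lipschitz constant at most $1$ and $\int_0^1 f(s)\,ds=0$. Let $\mathbb{L}^{\infty}_{BM}$ and $\mathbb{L}^{\infty}_{BB}$ be the subsets of all non-decreasing functions in $\mathbb{K}^{\infty}_{BM}$ and $\mathbb{K}^{\infty}_{BB}$, respectively. Regard all these sets as convex subsets of $L^2[0,1]$. Then for every $k\in\mathbb{N}=\{1,2,\ldots\}$, $$V_k(\mathbb{K}_{BM}^{\infty}) = \frac{\pi^{k/2}}{\Gamma\left(\frac 32 k +1 \right)},\qquad V_k(\mathbb{K}_{BB}^{\infty}) = \frac{\pi^{(k+1)/2}}{2\,\Gamma\left(\frac 32 k +\frac 32\right)},$$ and moreover $V_k(\mathbb{L}_{BM}^{\infty}) = 2^{-k} V_k(\mathbb{K}_{BM}^{\infty})$ and $V_k(\mathbb{L}_{BB}^{\infty}) = 2^{-k} V_k(\mathbb{K}_{BB}^{\infty})$.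
   Context: Intrinsic volumes. For a bounded convex set $T\subset\mathbb{R}^n$ the intrinsic volumes $V_0(T),\ldots,V_n(T)$ are defined by the Steiner formula $\mathrm{Vol}_n(T+rB_n)=\sum_{k=0}^n \kappa_{n-k}V_k(T)r^{n-k}$, $r\ge 0$, where $B_n$ is the unit ball in $\mathbb{R}^n$ and $\kappa_k=\pi^{k/2}/\Gamma(\frac k2+1)$ is the volume of $B_k$. With this normalization $V_k(T)$ depends only on $T$ and not on the dimension of the surrounding space (and $V_k(T)=0$ if $k>\dim T$), so it is defined for bounded finite-dimensional convex subsets of a separable Hilbert space $H$. For an arbitrary convex set $T\subset H$ one puts $V_k(T)=\sup_{T'}V_k(T')\in[0,\infty]$, the supremum being over all finite-dimensional (i.e. contained in a finite-dimensional affine subspace) convex subsets $T'$ of $T$. *)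

theory Defs
  imports "HOL-Analysis.Analysis"
begin

abbreviation leb01 :: "real measure" where
  "leb01 \<equiv> lebesgue_on {0..1}"

definition square_integrable :: "(real \<Rightarrow> real) \<Rightarrow> bool" where
  "square_integrable f \<longleftrightarrow>
     f \<in> borel_measurable leb01 \<and> integrable leb01 (\<lambda>x. (f x)\<^sup>2)"

definition L2_rel :: "(real \<Rightarrow> real) \<Rightarrow> (real \<Rightarrow> real) \<Rightarrow> bool" where
  "L2_rel f g \<longleftrightarrow>
     square_integrable f \<and> square_integrable g \<and> (AE x in leb01. f x = g x)"

lemma square_integrable_mult:
  assumes "square_integrable f" "square_integrable g"
  shows "integrable leb01 (\<lambda>x. f x * g x)"
proof (rule Bochner_Integration.integrable_bound)
  show "integrable leb01 (\<lambda>x. (f x)\<^sup>2 + (g x)\<^sup>2)"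
    using assms by (simp add: square_integrable_def)
  show "(\<lambda>x. f x * g x) \<in> borel_measurable leb01"
    using assms by (auto simp: square_integrable_def intro: borel_measurable_times)
  have "\<bar>a * b\<bar> \<le> a\<^sup>2 + b\<^sup>2" for a b :: real
  proof -
    have "2 * (\<bar>a\<bar> * \<bar>b\<bar>) \<le> a\<^sup>2 + b\<^sup>2"
      using sum_squares_bound[of "\<bar>a\<bar>" "\<bar>b\<bar>"] by simp
    moreover have "0 \<le> \<bar>a\<bar> * \<bar>b\<bar>"
      by simp
    ultimately show ?thesis
      unfolding abs_mult by linarith
  qed
  then show "AE x in leb01. norm (f x * g x) \<le> norm ((f x)\<^sup>2 + (g x)\<^sup>2)"
    by (intro AE_I2) simp
qed

lemma square_integrable_zero: "square_integrable (\<lambda>x. 0)"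
  by (simp add: square_integrable_def)

lemma square_integrable_scale:
  assumes "square_integrable f"
  shows "square_integrable (\<lambda>x. c * f x)"
  using assms
  by (auto simp: square_integrable_def power_mult_distrib intro: borel_measurable_times)

lemma square_integrable_add:
  assumes "square_integrable f" "square_integrable g"
  shows "square_integrable (\<lambda>x. f x + g x)"
  using assms square_integrable_mult[OF assms]
  by (auto simp: square_integrable_def power2_sum mult.assoc intro: borel_measurable_add)

lemma part_equivp_L2_rel: "part_equivp L2_rel"
proof (rule part_equivpI)
  show "\<exists>f. L2_rel f f"
    using square_integrable_zero by (auto simp: L2_rel_def)
  show "symp L2_rel"
    by (auto simp: symp_def L2_rel_def eq_commute)
  show "transp L2_rel"
    unfolding transp_def L2_rel_def by (auto elim: AE_mp)
qed

text \<open>The real Hilbert space \<open>L\<^sup>2[0,1]\<close>: square-integrable functions modulo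
  almost-everywhere equality on \<open>[0,1]\<close>; values outside \<open>[0,1]\<close> are ignored.\<close>

quotient_type L2 = "real \<Rightarrow> real" / partial: L2_rel
  by (rule part_equivp_L2_rel)

instantiation L2 :: real_inner
begin

lift_definition zero_L2 :: L2 is "\<lambda>x. 0"
  by (simp add: L2_rel_def square_integrable_zero)

lift_definition plus_L2 :: "L2 \<Rightarrow> L2 \<Rightarrow> L2" is "\<lambda>f g x. f x + g x"
  unfolding L2_rel_def by (auto intro: square_integrable_add elim: AE_mp)

lift_definition scaleR_L2 :: "real \<Rightarrow> L2 \<Rightarrow> L2" is "\<lambda>c f x. c * f x"
  unfolding L2_rel_def by (auto intro: square_integrable_scale elim: AE_mp)

definition uminus_L2 :: "L2 \<Rightarrow> L2" where
  "uminus_L2 f = (- 1) *\<^sub>R f"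

definition minus_L2 :: "L2 \<Rightarrow> L2 \<Rightarrow> L2" where
  "minus_L2 f g = f + - g"

lift_definition inner_L2 :: "L2 \<Rightarrow> L2 \<Rightarrow> real"
  is "\<lambda>f g. \<integral>x. f x * g x \<partial>leb01"
  unfolding L2_rel_def square_integrable_def
  by (intro integral_cong_AE) (auto elim: AE_mp)

definition norm_L2 :: "L2 \<Rightarrow> real" where
  "norm_L2 f = sqrt (f \<bullet> f)"

definition sgn_L2 :: "L2 \<Rightarrow> L2" where
  "sgn_L2 f = inverse (norm f) *\<^sub>R f"

definition dist_L2 :: "L2 \<Rightarrow> L2 \<Rightarrow> real" where
  "dist_L2 f g = norm (f - g)"

definition uniformity_L2 :: "(L2 \<times> L2) filter" where
  "uniformity_L2 = (INF e\<in>{0<..}. principal {(x, y). dist x y < e})"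

definition open_L2 :: "L2 set \<Rightarrow> bool" where
  "open_L2 U \<longleftrightarrow> (\<forall>x\<in>U. eventually (\<lambda>(x', y). x' = x \<longrightarrow> y \<in> U) uniformity)"

instance
proof
  fix f g h :: L2 and a b :: real
  show "f + g + h = f + (g + h)"
    by transfer (auto simp: L2_rel_def add.assoc intro: square_integrable_add)
  show "f + g = g + f"
    by transfer (auto simp: L2_rel_def add.commute intro: square_integrable_add)
  show "0 + f = f"
    by transfer (auto simp: L2_rel_def)
  show "- f + f = 0"
    unfolding uminus_L2_def
    by transfer (auto simp: L2_rel_def square_integrable_zero)
  show "f - g = f + - g"
    by (simp add: minus_L2_def)
  show "a *\<^sub>R (f + g) = a *\<^sub>R f + a *\<^sub>R g"
    by transfer
      (auto simp: L2_rel_def distrib_left intro!: square_integrable_add square_integrable_scale)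
  show "(a + b) *\<^sub>R f = a *\<^sub>R f + b *\<^sub>R f"
    by transfer
      (auto simp: L2_rel_def distrib_right intro!: square_integrable_add square_integrable_scale)
  show "a *\<^sub>R b *\<^sub>R f = (a * b) *\<^sub>R f"
    by transfer (auto simp: L2_rel_def mult.assoc intro!: square_integrable_scale)
  show "1 *\<^sub>R f = f"
    by transfer (auto simp: L2_rel_def)
  show "f \<bullet> g = g \<bullet> f"
    by transfer (simp add: mult.commute)
  show "(f + g) \<bullet> h = f \<bullet> h + g \<bullet> h"
    by transfer (auto simp: L2_rel_def distrib_right square_integrable_mult)
  show "(a *\<^sub>R f) \<bullet> g = a * (f \<bullet> g)"
    by transfer (simp add: mult.assoc)
  show "0 \<le> f \<bullet> f"
    by transfer simp
  show "f \<bullet> f = 0 \<longleftrightarrow> f = 0"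
  proof transfer
    fix f assume "L2_rel f f"
    then have f: "square_integrable f"
      by (simp add: L2_rel_def)
    have "(\<integral>x. f x * f x \<partial>leb01) = 0 \<longleftrightarrow> (AE x in leb01. f x * f x = 0)"
      using square_integrable_mult[OF f f] by (intro integral_nonneg_eq_0_iff_AE) auto
    then show "(\<integral>x. f x * f x \<partial>leb01) = 0 \<longleftrightarrow> L2_rel f (\<lambda>x. 0)"
      by (simp add: L2_rel_def f square_integrable_zero)
  qed
  show "norm f = sqrt (f \<bullet> f)"
    by (fact norm_L2_def)
  show "sgn f = inverse (norm f) *\<^sub>R f"
    by (fact sgn_L2_def)
  show "dist f g = norm (f - g)"
    by (fact dist_L2_def)
  show "(uniformity :: (L2 \<times> L2) filter) = (INF e\<in>{0<..}. principal {(x, y). dist x y < e})"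
    by (fact uniformity_L2_def)
  show "open U \<longleftrightarrow> (\<forall>x\<in>U. eventually (\<lambda>(x', y). x' = x \<longrightarrow> y \<in> U) uniformity)"
    for U :: "L2 set"
    by (fact open_L2_def)
qed

end

text \<open>The quotient is partial: the class map \<^const>\<open>abs_L2\<close> is meaningful only on
  square-integrable functions.  Continuous functions on \<open>[0,1]\<close> are of this kind, whatever
  their values outside \<open>[0,1]\<close>.\<close>

lemma square_integrable_continuous_on:
  assumes "continuous_on {0..1} f"
  shows "square_integrable f"
proof -
  have "f \<in> borel_measurable leb01"
    using assms by (intro continuous_imp_measurable_on_sets_lebesgue) auto
  moreover have "integrable leb01 (\<lambda>x. (f x)\<^sup>2)"
  proof -
    have "continuous_on {0..1} (\<lambda>x. (f x)\<^sup>2)"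
      using assms by (intro continuous_intros)
    then have "(\<lambda>x. (f x)\<^sup>2) absolutely_integrable_on {0..1}"
      by (intro absolutely_integrable_continuous_real)
    then show ?thesis
      by (simp add: integrable_restrict_space set_integrable_def)
  qed
  ultimately show ?thesis
    by (simp add: square_integrable_def)
qed

text \<open>\<open>\<real>\<^sup>n\<close> is the space of functions \<open>{..<n} \<rightarrow>\<^sub>E UNIV\<close> with
  \<open>n\<close>-dimensional Lebesgue measure.  The completion is essential: a convex set is always Lebesgue
  measurable, but not always Borel measurable.\<close>

definition lebesgue_space :: "nat \<Rightarrow> (nat \<Rightarrow> real) measure" where
  "lebesgue_space n = completion (\<Pi>\<^sub>M i\<in>{..<n}. lborel)"

definition orthonormal_family :: "nat \<Rightarrow> (nat \<Rightarrow> 'a::real_inner) \<Rightarrow> bool" where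
  "orthonormal_family n e \<longleftrightarrow> (\<forall>i<n. \<forall>j<n. e i \<bullet> e j = (if i = j then 1 else 0))"

definition affine_chart :: "nat \<Rightarrow> 'a::real_inner \<Rightarrow> (nat \<Rightarrow> 'a) \<Rightarrow> (nat \<Rightarrow> real) \<Rightarrow> 'a" where
  "affine_chart n p e x = p + (\<Sum>i<n. x i *\<^sub>R e i)"

text \<open>For orthonormal \<open>e\<close> the chart is an isometry from \<open>\<real>\<^sup>n\<close> onto the
  \<open>n\<close>-dimensional affine subspace through \<open>p\<close> with direction \<open>span (e ` {..<n})\<close>;
  the volume on that subspace is transported along it.\<close>

definition vol :: "nat \<Rightarrow> 'a::real_inner \<Rightarrow> (nat \<Rightarrow> 'a) \<Rightarrow> 'a set \<Rightarrow> real" where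
  "vol n p e A =
     measure (lebesgue_space n) {x \<in> {..<n} \<rightarrow>\<^sub>E UNIV. affine_chart n p e x \<in> A}"

definition parallel_body :: "nat \<Rightarrow> (nat \<Rightarrow> 'a::real_inner) \<Rightarrow> 'a set \<Rightarrow> real \<Rightarrow> 'a set" where
  "parallel_body n e T r = {t + r *\<^sub>R b | t b. t \<in> T \<and> b \<in> span (e ` {..<n}) \<and> norm b \<le> 1}"

text \<open>Steiner's formula in some finite-dimensional affine subspace containing \<open>T\<close>.  The
  resulting sequence depends neither on the subspace nor on its dimension, which is why a single
  sequence, extended by zero, is attached to \<open>T\<close>.\<close>

definition has_intrinsic_volumes :: "'a::real_inner set \<Rightarrow> (nat \<Rightarrow> real) \<Rightarrow> bool" where
  "has_intrinsic_volumes T V \<longleftrightarrow>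
     (\<exists>n p e. orthonormal_family n e \<and> T \<subseteq> range (affine_chart n p e) \<and>
        (\<forall>r\<ge>0. vol n p e (parallel_body n e T r) =
                  (\<Sum>k\<le>n. unit_ball_vol (real (n - k)) * V k * r ^ (n - k))) \<and>
        (\<forall>k>n. V k = 0))"

text \<open>Only meant for bounded finite-dimensional convex sets.\<close>

definition intrinsic_volume_fin :: "nat \<Rightarrow> 'a::real_inner set \<Rightarrow> real" where
  "intrinsic_volume_fin k T = (THE V. has_intrinsic_volumes T V) k"

definition fin_dim :: "'a::real_vector set \<Rightarrow> bool" where
  "fin_dim T \<longleftrightarrow> (\<exists>B. finite B \<and> T \<subseteq> affine hull B)"

definition intrinsic_volume :: "nat \<Rightarrow> 'a::real_inner set \<Rightarrow> ennreal" where
  "intrinsic_volume k T =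
     (SUP T' \<in> {T'. T' \<subseteq> T \<and> convex T' \<and> bounded T' \<and> fin_dim T'}.
        ennreal (intrinsic_volume_fin k T'))"

definition K_BM :: "L2 set" where
  "K_BM = abs_L2 ` {f. 1-lipschitz_on {0..1} f \<and> f 0 = 0}"

definition K_BB :: "L2 set" where
  "K_BB = abs_L2 ` {f. 1-lipschitz_on {0..1} f \<and> integral {0..1} f = 0}"

definition L_BM :: "L2 set" where
  "L_BM = abs_L2 ` {f. 1-lipschitz_on {0..1} f \<and> f 0 = 0 \<and> mono_on {0..1} f}"

definition L_BB :: "L2 set" where
  "L_BB = abs_L2 ` {f. 1-lipschitz_on {0..1} f \<and> integral {0..1} f = 0 \<and> mono_on {0..1} f}"

end

theory Submission
  imports Defs
begin

text \<open>
The set \<open>K_BM\<close> consists of the integrals \<open>\<integral> g(s) 1_{(s,1]} ds\<close> with \<open>\<bar>g\<bar> \<le> 1\<close>. It is the zonoid generated by the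
curve of the indicators \<open>1_{(s,1]}\<close>, that is, a limit of zonotopes with generators \<open>(1/m) 1_{(i/m,1]}\<close>. The
set \<open>K_BB\<close> is its orthogonal projection along the constant functions, and since \<open>f\<close> is monotone and
1-Lipschitz iff \<open>2 f - id\<close> is 1-Lipschitz, \<open>L_BM\<close> and \<open>L_BB\<close> are translates of the halved sets.

For a zonotope with generators \<open>z\<^sub>i\<close>, i.e. the sum of the segments \<open>[-z\<^sub>i, z\<^sub>i]\<close>, the \<open>k\<close>-th intrinsic volume
is \<open>2\<^sup>k\<close> times the sum of the \<open>k\<close>-dimensional volumes of the parallelotopes spanned by \<open>k\<close> of the generators.
For indicators \<open>1_{(s,1]}\<close> these volumes are elementary: the component of \<open>1_{(a,c]}\<close> orthogonal to
\<open>1_{(b,c]}\<close> is \<open>1_{(a,b]}\<close>, so the volume is the square root of the product of the gaps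
\<open>1 - s\<^sub>k\<close>, \<open>s\<^sub>k - s\<^sub>k\<^sub>-\<^sub>1\<close>, \<dots>, \<open>s\<^sub>2 - s\<^sub>1\<close>; after projection along the constants the factor \<open>s\<^sub>1\<close> joins the product.
The intrinsic volumes are therefore limits of Riemann sums of Dirichlet integrals, which are evaluated
as iterated Beta integrals (lemmas \<open>zono_vol_steps\<close>, \<open>zono_vol_bridge_steps\<close>, \<open>iterated_sum_tendsto\<close> and
\<open>iterated_beta_closed_form\<close>).

The theory of intrinsic volumes used here rests on one identity, \<open>vol_add_segment\<close>: adding the segment
\<open>[-z, z]\<close> to a compact convex set \<open>A\<close> increases its volume by \<open>2 \<bar>z\<bar>\<close> times the volume of the projection of
\<open>A\<close> along \<open>z\<close>. Iterated, it shows that the volume of \<open>T + r Z\<close> is a polynomial in \<open>r\<close> for every zonotope \<open>Z\<close>,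
with coefficients that increase with \<open>T\<close>. The ball is a limit of zonotopes, because by rotation
invariance the average of the segments \<open>[-x, x]\<close> over all \<open>x\<close> in a ball is again a ball. Hence Steiner's
formula holds for all bounded convex sets of finite dimension, and intrinsic volumes are monotone
(\<open>steiner_exists_mono\<close>). Slicing by parallel hyperplanes shows that they do not depend on the dimension of
the surrounding space (\<open>steiner_unique\<close>). Applied to parallel bodies of a zonotope, the same identity gives
the recursion behind the sum over parallelotopes (\<open>steiner_zono\<close>).

To pass from zonotopes to the function classes, let \<open>J\<close> be the projection onto the functions that are
constant on the cells of a partition into \<open>m\<close> intervals. It maps \<open>K_BM\<close> into a zonotope and moves its
points by at most \<open>1/m\<close>. If \<open>T\<close> is a convex subset of finite dimension, the errors \<open>x - J x\<close> span a space whose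
dimension is bounded independently of \<open>m\<close>; so \<open>T\<close> lies in the zonotope enlarged by boundedly many short
segments, and monotonicity bounds its intrinsic volumes. Conversely, replacing the jumps by ramps moves
the generators by a total of at most \<open>sqrt (1/m)\<close> and gives zonotopes inside \<open>K_BM\<close>
(\<open>intrinsic_volume_of_approximable\<close>, \<open>intrinsic_volume_linear_image_K_BM\<close>).
\<close>

section \<open>Lebesgue integration over the image of a chart\<close>

abbreviation coords :: "nat \<Rightarrow> (nat \<Rightarrow> real) measure" where
  "coords n \<equiv> \<Pi>\<^sub>M i\<in>{..<n}. lborel"

text \<open>The integral of \<open>g\<close> over the image of the chart, against Lebesgue measure transported from the
coordinates. Working with the functional \<open>g \<mapsto> chart_integral n p e g\<close> for arbitrary directions
\<open>e\<close>, and not with a measure on the subspace, keeps Fubini arguments on the coordinate side: the Borel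
sets of a product of two copies of \<open>'a\<close> may be larger than the product of the Borel sets.\<close>

definition chart_integral ::
    "nat \<Rightarrow> 'a::real_inner \<Rightarrow> (nat \<Rightarrow> 'a) \<Rightarrow> ('a \<Rightarrow> ennreal) \<Rightarrow> ennreal" where
  "chart_integral n p e g = (\<integral>\<^sup>+ x. g (affine_chart n p e x) \<partial>coords n)"

interpretation lebesgue_product: product_sigma_finite "\<lambda>_::nat. lborel :: real measure"
  by standard

lemma sigma_finite_coords: "sigma_finite_measure (coords n)"
  by (rule lebesgue_product.sigma_finite) simp

text \<open>Addition on \<open>'a\<close> need not be jointly Borel measurable, because \<open>'a\<close> need not be second countable. The
sums that occur depend continuously on finitely many real coordinates, so measurability can be
transferred from the second countable space \<open>nat \<Rightarrow> real\<close>.\<close>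

lemma borel_measurable_sum_charts:
  fixes e f :: "nat \<Rightarrow> 'a::real_inner"
  assumes c: "\<And>i. i < n \<Longrightarrow> c i \<in> borel_measurable M"
    and d: "\<And>i. i < m \<Longrightarrow> d i \<in> borel_measurable M"
  shows "(\<lambda>\<omega>. p + (\<Sum>i<n. c i \<omega> *\<^sub>R e i) + (\<Sum>i<m. d i \<omega> *\<^sub>R f i)) \<in> borel_measurable M"
proof -
  define a where "a = (\<lambda>\<omega> i. if i < n then c i \<omega> else 0)"
  define b where "b = (\<lambda>\<omega> i. if i < m then d i \<omega> else 0)"
  define h where
    "h = (\<lambda>z::(nat \<Rightarrow> real) \<times> (nat \<Rightarrow> real). p + (\<Sum>i<n. fst z i *\<^sub>R e i) + (\<Sum>i<m. snd z i *\<^sub>R f i))"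
  have a: "a \<in> borel_measurable M"
  proof (rule measurable_coordinatewise_then_product)
    fix i show "(\<lambda>\<omega>. a \<omega> i) \<in> borel_measurable M"
      using c by (cases "i < n") (auto simp: a_def)
  qed
  have b: "b \<in> borel_measurable M"
  proof (rule measurable_coordinatewise_then_product)
    fix i show "(\<lambda>\<omega>. b \<omega> i) \<in> borel_measurable M"
      using d by (cases "i < m") (auto simp: b_def)
  qed
  have "(\<lambda>\<omega>. (a \<omega>, b \<omega>)) \<in> measurable M (borel \<Otimes>\<^sub>M borel)"
    using a b by simp
  then have ab: "(\<lambda>\<omega>. (a \<omega>, b \<omega>)) \<in> borel_measurable M"
    by (simp add: borel_prod)
  have c1: "continuous_on UNIV (\<lambda>z::(nat \<Rightarrow> real) \<times> (nat \<Rightarrow> real). fst z i)" for i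
    by (rule continuous_on_product_then_coordinatewise[OF continuous_on_fst[OF continuous_on_id]])
  have c2: "continuous_on UNIV (\<lambda>z::(nat \<Rightarrow> real) \<times> (nat \<Rightarrow> real). snd z i)" for i
    by (rule continuous_on_product_then_coordinatewise[OF continuous_on_snd[OF continuous_on_id]])
  have "continuous_on UNIV h"
    unfolding h_def by (intro continuous_intros c1 c2)
  then have "h \<in> borel_measurable borel"
    by (rule borel_measurable_continuous_onI)
  from measurable_compose[OF ab this] have "(\<lambda>\<omega>. h (a \<omega>, b \<omega>)) \<in> borel_measurable M" .
  also have "(\<lambda>\<omega>. h (a \<omega>, b \<omega>)) = (\<lambda>\<omega>. p + (\<Sum>i<n. c i \<omega> *\<^sub>R e i) + (\<Sum>i<m. d i \<omega> *\<^sub>R f i))"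
    by (auto simp: h_def a_def b_def fun_eq_iff)
  finally show ?thesis .
qed

lemma measurable_affine_chart [measurable]:
  "affine_chart n p e \<in> borel_measurable (coords n)"
proof -
  have "(\<lambda>x. p + (\<Sum>i<n. x i *\<^sub>R e i) + (\<Sum>i<0. (0::real) *\<^sub>R e i)) \<in> borel_measurable (coords n)"
    by (rule borel_measurable_sum_charts) auto
  then show ?thesis
    by (simp add: affine_chart_def[abs_def])
qed

lemma measurable_affine_chart_line:
  "(\<lambda>(t, x). affine_chart n (p + t *\<^sub>R v) e x) \<in> borel_measurable (lborel \<Otimes>\<^sub>M coords n)"
proof -
  have "(\<lambda>z. p + (\<Sum>i<n. snd z i *\<^sub>R e i) + (\<Sum>i<Suc 0. fst z *\<^sub>R v))
      \<in> borel_measurable (lborel \<Otimes>\<^sub>M coords n)"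
    by (rule borel_measurable_sum_charts) measurable
  then show ?thesis
    by (simp add: affine_chart_def[abs_def] case_prod_unfold algebra_simps)
qed

lemma affine_chart_Suc:
  "affine_chart (Suc n) p e (x(n := t)) = affine_chart n (p + t *\<^sub>R e n) e x"
  by (simp add: affine_chart_def algebra_simps)

lemma affine_chart_base: "affine_chart n (p + w) e x = w + affine_chart n p e x"
  by (simp add: affine_chart_def algebra_simps)

lemma chart_integral_line_measurable:
  assumes [measurable]: "g \<in> borel_measurable borel"
  shows "(\<lambda>t. chart_integral n (p + t *\<^sub>R v) e g) \<in> borel_measurable borel"
proof -
  interpret sigma_finite_measure "coords n" by (rule sigma_finite_coords)
  have "(\<lambda>(t, x). g (affine_chart n (p + t *\<^sub>R v) e x)) \<in> borel_measurable (lborel \<Otimes>\<^sub>M coords n)"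
    using measurable_compose[OF measurable_affine_chart_line[of n p v e] assms]
    by (simp add: case_prod_unfold)
  then have "(\<lambda>t. chart_integral n (p + t *\<^sub>R v) e g) \<in> borel_measurable lborel"
    unfolding chart_integral_def by (rule borel_measurable_nn_integral)
  then show ?thesis by simp
qed

lemma chart_integral_Suc:
  assumes [measurable]: "g \<in> borel_measurable borel"
  shows "chart_integral (Suc n) p e g = (\<integral>\<^sup>+ t. chart_integral n (p + t *\<^sub>R e n) e g \<partial>lborel)"
proof -
  have m: "(\<lambda>x. g (affine_chart (Suc n) p e x)) \<in> borel_measurable (\<Pi>\<^sub>M i\<in>insert n {..<n}. lborel)"
    using measurable_compose[OF measurable_affine_chart assms, of "Suc n" p e]
    by (simp add: lessThan_Suc)
  show ?thesis
    unfolding chart_integral_def lessThan_Suc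
    by (subst lebesgue_product.product_nn_integral_insert_rev[OF _ _ m]) (auto simp: affine_chart_Suc)
qed

text \<open>Fubini with the new coordinate integrated first: the inner integral runs over a line in the direction
\<open>e n\<close>.\<close>

lemma chart_integral_Suc_slice:
  assumes [measurable]: "g \<in> borel_measurable borel"
  shows "chart_integral (Suc n) p e g =
    (\<integral>\<^sup>+ x. (\<integral>\<^sup>+ t. g (affine_chart n p e x + t *\<^sub>R e n) \<partial>lborel) \<partial>coords n)"
proof -
  have m: "(\<lambda>x. g (affine_chart (Suc n) p e x)) \<in> borel_measurable (\<Pi>\<^sub>M i\<in>insert n {..<n}. lborel)"
    using measurable_compose[OF measurable_affine_chart assms, of "Suc n" p e]
    by (simp add: lessThan_Suc)
  show ?thesis
    unfolding chart_integral_def lessThan_Suc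
    by (subst lebesgue_product.product_nn_integral_insert[OF _ _ m])
      (auto simp: affine_chart_Suc affine_chart_base add.commute)
qed

text \<open>Translation invariance of Lebesgue measure, by induction on the dimension: the component of \<open>w\<close> along
the last direction is absorbed by the outer one-dimensional integral.\<close>

lemma chart_integral_shift:
  assumes [measurable]: "g \<in> borel_measurable borel" and "w \<in> span (e ` {..<n})"
  shows "chart_integral n (p + w) e g = chart_integral n p e g"
  using assms(2)
proof (induction n arbitrary: p w)
  case 0
  then show ?case by simp
next
  case (Suc n)
  from Suc.prems obtain k where k: "w - k *\<^sub>R e n \<in> span (e ` {..<n})"
    by (auto simp: lessThan_Suc span_breakdown_eq)
  have "chart_integral (Suc n) (p + w) e g
      = (\<integral>\<^sup>+ t. chart_integral n ((p + (k + 1 * t) *\<^sub>R e n) + (w - k *\<^sub>R e n)) e g \<partial>lborel)"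
    by (simp add: chart_integral_Suc algebra_simps)
  also have "\<dots> = (\<integral>\<^sup>+ t. chart_integral n (p + (k + 1 * t) *\<^sub>R e n) e g \<partial>lborel)"
    by (simp only: Suc.IH[OF k])
  also have "\<dots> = (\<integral>\<^sup>+ t. chart_integral n (p + t *\<^sub>R e n) e g \<partial>lborel)"
    using nn_integral_real_affine[OF chart_integral_line_measurable[OF assms(1)], of 1 n p "e n" e k]
    by simp
  finally show ?case
    by (simp add: chart_integral_Suc)
qed

lemma chart_integral_reflect:
  assumes [measurable]: "g \<in> borel_measurable borel"
  shows "chart_integral n p (\<lambda>i. - e i) g = chart_integral n p e g"
proof (induction n arbitrary: p)
  case 0
  then show ?case by (simp add: chart_integral_def affine_chart_def)
next
  case (Suc n)
  have "chart_integral (Suc n) p (\<lambda>i. - e i) g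
      = (\<integral>\<^sup>+ t. chart_integral n (p + (0 + (- 1) * t) *\<^sub>R e n) e g \<partial>lborel)"
    by (simp add: chart_integral_Suc Suc.IH)
  also have "\<dots> = (\<integral>\<^sup>+ t. chart_integral n (p + t *\<^sub>R e n) e g \<partial>lborel)"
    using nn_integral_real_affine[OF chart_integral_line_measurable[OF assms(1)], of "-1" n p "e n" e 0]
    by simp
  finally show ?case
    by (simp add: chart_integral_Suc)
qed

lemma affine_chart_in_span: "affine_chart n 0 e x \<in> span (e ` {..<n})"
  unfolding affine_chart_def by (auto intro!: span_add[OF span_zero] span_sum intro: span_scale span_base)

lemma borel_measurable_translate:
  fixes g :: "'a::real_inner \<Rightarrow> ennreal"
  assumes "g \<in> borel_measurable borel"
  shows "(\<lambda>v. g (v + w)) \<in> borel_measurable borel"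
proof -
  have "(\<lambda>v. v + w) \<in> borel_measurable (borel :: 'a measure)"
    by (intro borel_measurable_continuous_onI continuous_intros)
  from measurable_compose[OF this assms] show ?thesis .
qed

lemma chart_integral_translate:
  "chart_integral n p e g = chart_integral n 0 e (\<lambda>v. g (v + p))"
  unfolding chart_integral_def affine_chart_def by (simp add: add.commute)

text \<open>This is the proof of the uniqueness of Haar measure, applied to the two translation invariant
functionals that belong to two systems of directions of the same subspace. The double integral of
\<open>g(E x) h(F y)\<close> is transformed, by translating \<open>y\<close>, exchanging the order, translating \<open>x\<close>, exchanging
again and reflecting, into that of \<open>h(E x) g(F y)\<close>. With the indicator of a ball for \<open>h\<close> it yields both
the invariance of volume under orthogonal changes of coordinates and its behaviour under
homotheties.\<close>

lemma chart_integral_exchange: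
  assumes [measurable]: "g \<in> borel_measurable borel" "h \<in> borel_measurable borel"
    and span: "span (e ` {..<n}) = span (f ` {..<m})"
  shows "chart_integral n 0 e g * chart_integral m 0 f h
       = chart_integral n 0 e h * chart_integral m 0 f g"
proof -
  interpret N: sigma_finite_measure "coords n" by (rule sigma_finite_coords)
  interpret M: sigma_finite_measure "coords m" by (rule sigma_finite_coords)
  interpret P: pair_sigma_finite "coords n" "coords m" ..
  let ?E = "affine_chart n 0 e" and ?F = "affine_chart m 0 f"
  have plus: "(\<lambda>z. ?F (snd z) + ?E (fst z)) \<in> borel_measurable (coords n \<Otimes>\<^sub>M coords m)"
  proof -
    have "(\<lambda>z. 0 + (\<Sum>i<m. snd z i *\<^sub>R f i) + (\<Sum>i<n. fst z i *\<^sub>R e i))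
        \<in> borel_measurable (coords n \<Otimes>\<^sub>M coords m)"
      by (rule borel_measurable_sum_charts) measurable
    then show ?thesis by (simp add: affine_chart_def)
  qed
  have minus: "(\<lambda>z. ?E (fst z) - ?F (snd z)) \<in> borel_measurable (coords n \<Otimes>\<^sub>M coords m)"
  proof -
    have "(\<lambda>z. 0 + (\<Sum>i<m. snd z i *\<^sub>R (- f i)) + (\<Sum>i<n. fst z i *\<^sub>R e i))
        \<in> borel_measurable (coords n \<Otimes>\<^sub>M coords m)"
      by (rule borel_measurable_sum_charts) measurable
    then show ?thesis by (simp add: affine_chart_def sum_negf)
  qed
  have E: "(\<lambda>z. ?E (fst z)) \<in> borel_measurable (coords n \<Otimes>\<^sub>M coords m)"
    by measurable
  have m1: "(\<lambda>(x, y). g (?E x) * h (?F y + ?E x)) \<in> borel_measurable (coords n \<Otimes>\<^sub>M coords m)"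
    using measurable_compose[OF plus assms(2)] measurable_compose[OF E assms(1)]
    by (simp add: case_prod_unfold)
  have m2: "(\<lambda>(x, y). g (?E x - ?F y) * h (?E x)) \<in> borel_measurable (coords n \<Otimes>\<^sub>M coords m)"
    using measurable_compose[OF minus assms(1)] measurable_compose[OF E assms(2)]
    by (simp add: case_prod_unfold)
  have "chart_integral n 0 e g * chart_integral m 0 f h
      = (\<integral>\<^sup>+ x. g (?E x) * chart_integral m 0 f h \<partial>coords n)"
    unfolding chart_integral_def[of n] by (simp add: nn_integral_multc)
  also have "\<dots> = (\<integral>\<^sup>+ x. (\<integral>\<^sup>+ y. g (?E x) * h (?F y + ?E x) \<partial>coords m) \<partial>coords n)"
  proof (rule nn_integral_cong)
    fix x
    \<comment> \<open>Translate \<open>y\<close> by \<open>E x\<close>, which lies in the span of \<open>f\<close>.\<close>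
    have "chart_integral m 0 f h = chart_integral m (0 + ?E x) f h"
      by (rule chart_integral_shift[symmetric]) (use affine_chart_in_span[of n e x] span in auto)
    also have "\<dots> = (\<integral>\<^sup>+ y. h (?F y + ?E x) \<partial>coords m)"
      unfolding chart_integral_def by (simp add: affine_chart_def add.commute)
    finally show "g (?E x) * chart_integral m 0 f h
        = (\<integral>\<^sup>+ y. g (?E x) * h (?F y + ?E x) \<partial>coords m)"
      using borel_measurable_translate[OF assms(2)] by (simp add: nn_integral_cmult)
  qed
  also have "\<dots> = (\<integral>\<^sup>+ y. (\<integral>\<^sup>+ x. g (?E x) * h (?F y + ?E x) \<partial>coords n) \<partial>coords m)"
    using P.Fubini'[OF m1] by simp
  also have "\<dots> = (\<integral>\<^sup>+ y. (\<integral>\<^sup>+ x. g (?E x - ?F y) * h (?E x) \<partial>coords n) \<partial>coords m)"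
  proof (rule nn_integral_cong)
    fix y
    define G where "G v = g v * h (v + ?F y)" for v
    \<comment> \<open>Translate \<open>x\<close> by \<open>- F y\<close>.\<close>
    have "chart_integral n 0 e G = chart_integral n (0 + - ?F y) e G"
    proof (rule chart_integral_shift[symmetric])
      show "G \<in> borel_measurable borel"
        unfolding G_def using borel_measurable_translate[OF assms(2)] by measurable
      show "- ?F y \<in> span (e ` {..<n})"
        unfolding span by (rule span_neg[OF affine_chart_in_span])
    qed
    then show "(\<integral>\<^sup>+ x. g (?E x) * h (?F y + ?E x) \<partial>coords n)
        = (\<integral>\<^sup>+ x. g (?E x - ?F y) * h (?E x) \<partial>coords n)"
      unfolding chart_integral_def G_def by (simp add: affine_chart_def algebra_simps)
  qed
  also have "\<dots> = (\<integral>\<^sup>+ x. (\<integral>\<^sup>+ y. g (?E x - ?F y) * h (?E x) \<partial>coords m) \<partial>coords n)"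
    using P.Fubini'[OF m2] by simp
  also have "\<dots> = (\<integral>\<^sup>+ x. h (?E x) * chart_integral m 0 f g \<partial>coords n)"
  proof (rule nn_integral_cong)
    fix x
    \<comment> \<open>Translate \<open>y\<close> by \<open>E x\<close> and reflect.\<close>
    have "chart_integral m 0 f g = chart_integral m (0 + ?E x) f g"
      by (rule chart_integral_shift[symmetric]) (use affine_chart_in_span[of n e x] span in auto)
    also have "\<dots> = chart_integral m (0 + ?E x) (\<lambda>i. - f i) g"
      by (simp add: chart_integral_reflect)
    also have "\<dots> = (\<integral>\<^sup>+ y. g (?E x - ?F y) \<partial>coords m)"
      unfolding chart_integral_def by (simp add: affine_chart_def sum_negf)
    finally have *: "chart_integral m 0 f g = (\<integral>\<^sup>+ y. g (?E x - ?F y) \<partial>coords m)" .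
    have "(\<lambda>y. ?E x - ?F y) \<in> borel_measurable (coords m)"
      using measurable_affine_chart[of m "?E x" "\<lambda>i. - f i"]
      by (simp add: affine_chart_def[abs_def] sum_negf)
    from measurable_compose[OF this assms(1)]
    show "(\<integral>\<^sup>+ y. g (?E x - ?F y) * h (?E x) \<partial>coords m) = h (?E x) * chart_integral m 0 f g"
      unfolding * by (subst nn_integral_multc) (auto simp: mult.commute)
  qed
  also have "\<dots> = chart_integral n 0 e h * chart_integral m 0 f g"
    unfolding chart_integral_def[of n] by (simp add: nn_integral_multc)
  finally show ?thesis .
qed

lemma norm_sum_orthonormal:
  assumes "orthonormal_family n e"
  shows "norm (\<Sum>i<n. x i *\<^sub>R e i) = sqrt (\<Sum>i<n. (x i)\<^sup>2)"
proof -
  have "(\<Sum>i<n. x i *\<^sub>R e i) \<bullet> (\<Sum>i<n. x i *\<^sub>R e i)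
      = (\<Sum>i<n. \<Sum>j<n. x i * (x j * (e i \<bullet> e j)))"
    unfolding inner_sum_left inner_sum_right inner_scaleR_left inner_scaleR_right sum_distrib_left
    by (intro sum.cong refl) (simp add: inner_commute mult.left_commute)
  also have "\<dots> = (\<Sum>i<n. \<Sum>j<n. if j = i then (x i)\<^sup>2 else 0)"
    using assms by (intro sum.cong) (auto simp: orthonormal_family_def power2_eq_square)
  finally show ?thesis
    by (simp add: norm_eq_sqrt_inner)
qed

lemma chart_integral_cball:
  assumes "orthonormal_family n e" "r > 0"
  shows "chart_integral n p e (indicator (cball p r)) = ennreal (unit_ball_vol (real n) * r ^ n)"
proof -
  let ?B = "{x. sqrt (\<Sum>i<n. (x i)\<^sup>2) \<le> r} \<inter> space (coords n)"
  have "chart_integral n p e (indicator (cball p r)) = (\<integral>\<^sup>+ x. indicator ?B x \<partial>coords n)"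
    unfolding chart_integral_def
    by (intro nn_integral_cong)
      (auto simp: indicator_def affine_chart_def dist_norm norm_sum_orthonormal[OF assms(1)])
  also have "\<dots> = emeasure (coords n) ?B"
    by (rule nn_integral_indicator) measurable
  also have "\<dots> = ennreal (unit_ball_vol (real n) * r ^ n)"
    using emeasure_cball_aux[of "{..<n}" r] assms(2) by simp
  finally show ?thesis .
qed

lemma orthonormal_family_inj:
  assumes "orthonormal_family n e" shows "inj_on e {..<n}"
proof (rule inj_onI)
  fix i j assume ij: "i \<in> {..<n}" "j \<in> {..<n}" "e i = e j"
  then have "e i \<bullet> e j = 1"
    using assms unfolding orthonormal_family_def by (metis lessThan_iff)
  then show "i = j"
    using ij assms unfolding orthonormal_family_def by (metis lessThan_iff zero_neq_one)
qed

lemma orthonormal_family_independent: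
  assumes "orthonormal_family n e" shows "independent (e ` {..<n})"
proof (rule pairwise_orthogonal_independent)
  show "pairwise orthogonal (e ` {..<n})"
    using assms by (auto simp: pairwise_def orthogonal_def orthonormal_family_def)
  show "0 \<notin> e ` {..<n}"
    using assms by (force simp: orthonormal_family_def)
qed

lemma orthonormal_family_dim:
  assumes "orthonormal_family n e" shows "dim (span (e ` {..<n})) = n"
  using dim_span_eq_card_independent[OF orthonormal_family_independent[OF assms]]
    card_image[OF orthonormal_family_inj[OF assms]] by simp

text \<open>The exchange formula with the unit ball for \<open>h\<close>, whose integral is the same positive number in every
orthonormal chart.\<close>

lemma chart_integral_eq_of_span_eq:
  assumes g [measurable]: "g \<in> borel_measurable borel"
    and e: "orthonormal_family n e" and f: "orthonormal_family m f"
    and span: "span (e ` {..<n}) = span (f ` {..<m})"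
    and pq: "q - p \<in> span (e ` {..<n})"
  shows "chart_integral n p e g = chart_integral m q f g"
proof -
  have nm: "n = m"
    using orthonormal_family_dim[OF e] orthonormal_family_dim[OF f] span by simp
  define h :: "'a \<Rightarrow> ennreal" where "h = indicator (cball 0 1)"
  define g' where "g' v = g (v + p)" for v
  have [measurable]: "h \<in> borel_measurable borel"
    unfolding h_def by (intro borel_measurable_indicator borel_closed closed_cball)
  have [measurable]: "g' \<in> borel_measurable borel"
    unfolding g'_def using g by (rule borel_measurable_translate)
  have h: "chart_integral n 0 e h = ennreal (unit_ball_vol (real n))"
     "chart_integral m 0 f h = ennreal (unit_ball_vol (real n))"
    using chart_integral_cball[OF e, of 1 0] chart_integral_cball[OF f, of 1 0]
    by (simp_all add: h_def nm)
  have pos: "unit_ball_vol (real n) > 0" by simp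
  have "chart_integral n 0 e g' * ennreal (unit_ball_vol (real n))
      = ennreal (unit_ball_vol (real n)) * chart_integral m 0 f g'"
    using chart_integral_exchange[of g' h e n f m] span h by simp
  then have "chart_integral n 0 e g' = chart_integral m 0 f g'"
    using pos by (simp add: mult.commute ennreal_mult_cancel_left)
  then have "chart_integral n p e g = chart_integral m p f g"
    unfolding g'_def by (simp flip: chart_integral_translate)
  also have "\<dots> = chart_integral m (p + (q - p)) f g"
    by (rule chart_integral_shift[symmetric]) (use pq span in auto)
  finally show ?thesis by simp
qed

lemma chart_integral_scale:
  assumes g [measurable]: "g \<in> borel_measurable borel"
    and e: "orthonormal_family n e" and s: "s > 0"
  shows "ennreal (s ^ n) * chart_integral n 0 e (\<lambda>v. g (s *\<^sub>R v)) = chart_integral n 0 e g"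
proof -
  define h :: "'a \<Rightarrow> ennreal" where "h = indicator (cball 0 s)"
  have [measurable]: "h \<in> borel_measurable borel"
    unfolding h_def by (intro borel_measurable_indicator borel_closed closed_cball)
  define f where "f i = s *\<^sub>R e i" for i
  have chart: "affine_chart n 0 f x = s *\<^sub>R affine_chart n 0 e x" for x
    by (simp add: affine_chart_def f_def scaleR_sum_right mult.commute)
  have f: "chart_integral n 0 f k = chart_integral n 0 e (\<lambda>v. k (s *\<^sub>R v))" for k
    by (simp add: chart_integral_def chart)
  have "span (f ` {..<n}) = span (e ` {..<n})"
  proof (rule span_eq[THEN iffD2], intro conjI subsetI)
    fix x assume "x \<in> f ` {..<n}"
    then show "x \<in> span (e ` {..<n})"
      by (auto simp: f_def intro: span_scale span_base)
  next
    fix x assume "x \<in> e ` {..<n}"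
    then obtain i where i: "i < n" "x = e i" by auto
    have "inverse s *\<^sub>R f i \<in> span (f ` {..<n})"
      using i by (intro span_scale span_base) auto
    then show "x \<in> span (f ` {..<n})"
      using s i by (simp add: f_def)
  qed
  then have ex: "chart_integral n 0 e g * chart_integral n 0 f h = chart_integral n 0 e h * chart_integral n 0 f g"
    by (intro chart_integral_exchange) auto
  have "chart_integral n 0 f h = chart_integral n 0 e (indicator (cball 0 1))"
    unfolding f h_def using s
    by (intro arg_cong[where f = "chart_integral n 0 e"]) (auto simp: fun_eq_iff indicator_def)
  also have "\<dots> = ennreal (unit_ball_vol (real n))"
    using chart_integral_cball[OF e, of 1 0] by simp
  finally have 1: "chart_integral n 0 f h = ennreal (unit_ball_vol (real n))" .
  have 2: "chart_integral n 0 e h = ennreal (unit_ball_vol (real n)) * ennreal (s ^ n)"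
    using chart_integral_cball[OF e s, of 0] s by (simp add: h_def ennreal_mult)
  have pos: "unit_ball_vol (real n) > 0" by simp
  have "ennreal (unit_ball_vol (real n)) * chart_integral n 0 e g
     = ennreal (unit_ball_vol (real n)) * (ennreal (s ^ n) * chart_integral n 0 f g)"
    using ex unfolding 1 2 by (simp add: ac_simps)
  then have "chart_integral n 0 e g = ennreal (s ^ n) * chart_integral n 0 f g"
    using pos by (simp add: ennreal_mult_cancel_left)
  then show ?thesis by (simp add: f)
qed

section \<open>Orthonormal families\<close>

lemma span_image_lessThan:
  assumes "x \<in> span (e ` {..<n::nat})"
  obtains c :: "nat \<Rightarrow> real" where "x = (\<Sum>i<n. c i *\<^sub>R e i)"
proof -
  have "\<exists>c :: nat \<Rightarrow> real. x = (\<Sum>i<n. c i *\<^sub>R e i)"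
    using assms
  proof (induction n arbitrary: x)
    case 0
    then show ?case by simp
  next
    case (Suc n)
    then obtain k where k: "x - k *\<^sub>R e n \<in> span (e ` {..<n})"
      by (auto simp: lessThan_Suc span_breakdown_eq)
    from Suc.IH[OF k] obtain c :: "nat \<Rightarrow> real" where c: "x - k *\<^sub>R e n = (\<Sum>i<n. c i *\<^sub>R e i)" ..
    have "x = (\<Sum>i<Suc n. (c(n := k)) i *\<^sub>R e i)"
      using c by (simp add: algebra_simps)
    then show ?case by blast
  qed
  then show thesis using that by blast
qed

lemma range_affine_chart: "range (affine_chart n p e) = (+) p ` span (e ` {..<n})"
proof
  show "range (affine_chart n p e) \<subseteq> (+) p ` span (e ` {..<n})"
    unfolding affine_chart_def by (auto intro!: imageI span_sum intro: span_scale span_base)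
next
  show "(+) p ` span (e ` {..<n}) \<subseteq> range (affine_chart n p e)"
  proof clarify
    fix x assume "x \<in> span (e ` {..<n})"
    then obtain c where "x = (\<Sum>i<n. c i *\<^sub>R e i)"
      by (rule span_image_lessThan)
    then show "p + x \<in> range (affine_chart n p e)"
      by (auto simp: affine_chart_def)
  qed
qed

lemma orthonormal_inner_sum:
  assumes "orthonormal_family n e" "j < n"
  shows "(\<Sum>i<n. c i *\<^sub>R e i) \<bullet> e j = c j"
proof -
  have "(\<Sum>i<n. c i *\<^sub>R e i) \<bullet> e j = (\<Sum>i<n. if i = j then c j else 0)"
    unfolding inner_sum_left using assms
    by (intro sum.cong) (auto simp: orthonormal_family_def)
  then show ?thesis using assms by simp
qed

lemma orthonormal_expansion:
  assumes "orthonormal_family n e" "x \<in> span (e ` {..<n})"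
  shows "x = (\<Sum>i<n. (x \<bullet> e i) *\<^sub>R e i)"
proof -
  obtain c where c: "x = (\<Sum>i<n. c i *\<^sub>R e i)"
    using assms(2) by (rule span_image_lessThan)
  have "(\<Sum>i<n. (x \<bullet> e i) *\<^sub>R e i) = (\<Sum>i<n. c i *\<^sub>R e i)"
    using orthonormal_inner_sum[OF assms(1)] c by (intro sum.cong) auto
  then show ?thesis using c by simp
qed

text \<open>One step of Gram--Schmidt for each element of \<open>B\<close>; the given family is not changed.\<close>

lemma orthonormal_family_extend:
  assumes "orthonormal_family m f" "finite B"
  obtains N g where "m \<le> N" "orthonormal_family N g" "\<And>i. i < m \<Longrightarrow> g i = f i"
    "span (g ` {..<N}) = span (f ` {..<m} \<union> B)"
proof -
  have "\<exists>N g. m \<le> N \<and> orthonormal_family N g \<and> (\<forall>i<m. g i = f i) \<and>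
      span (g ` {..<N}) = span (f ` {..<m} \<union> B)"
    using assms(2)
  proof induction
    case empty
    then show ?case using assms(1) by (intro exI[of _ m] exI[of _ f]) simp
  next
    case (insert b B)
    then obtain N g where g: "m \<le> N" "orthonormal_family N g" "\<forall>i<m. g i = f i"
      "span (g ` {..<N}) = span (f ` {..<m} \<union> B)" by blast
    have sp: "span (insert b (g ` {..<N})) = span (f ` {..<m} \<union> insert b B)"
      using g(4) by (simp add: span_insert)
    define r where "r = b - (\<Sum>i<N. (b \<bullet> g i) *\<^sub>R g i)"
    have s: "(\<Sum>i<N. (b \<bullet> g i) *\<^sub>R g i) \<in> span (g ` {..<N})"
      by (auto intro!: span_sum intro: span_scale span_base)
    have orth: "r \<bullet> g j = 0" if "j < N" for j
      unfolding r_def inner_diff_left using orthonormal_inner_sum[OF g(2) that] by simp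
    have b: "b = r + (\<Sum>i<N. (b \<bullet> g i) *\<^sub>R g i)"
      by (simp add: r_def)
    show ?case
    proof (cases "r = 0")
      case True
      then have "b \<in> span (g ` {..<N})"
        using b s by simp
      then have "span (g ` {..<N}) = span (f ` {..<m} \<union> insert b B)"
        using sp by (simp add: span_redundant)
      then show ?thesis using g by blast
    next
      case False
      define h where "h = g(N := r /\<^sub>R norm r)"
      have im: "h ` {..<Suc N} = insert (r /\<^sub>R norm r) (g ` {..<N})"
        by (auto simp: h_def lessThan_Suc)
      have "orthonormal_family (Suc N) h"
        using g(2) orth False
        by (auto simp: orthonormal_family_def h_def less_Suc_eq inner_commute field_simps
            simp flip: power2_norm_eq_inner power2_eq_square)
      moreover have "span (h ` {..<Suc N}) = span (insert b (g ` {..<N}))"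
      proof (rule span_eq[THEN iffD2], intro conjI)
        have "r \<in> span (insert b (g ` {..<N}))"
          unfolding r_def
          by (intro span_diff span_base[of b] set_mp[OF span_mono s]) auto
        then show "h ` {..<Suc N} \<subseteq> span (insert b (g ` {..<N}))"
          unfolding im by (auto intro: span_scale span_base)
        have "r = norm r *\<^sub>R (r /\<^sub>R norm r)" using False by simp
        moreover have "norm r *\<^sub>R (r /\<^sub>R norm r) \<in> span (h ` {..<Suc N})"
          unfolding im by (intro span_scale span_base) simp
        ultimately have "r \<in> span (h ` {..<Suc N})" by simp
        moreover have "(\<Sum>i<N. (b \<bullet> g i) *\<^sub>R g i) \<in> span (h ` {..<Suc N})"
          using s unfolding im by (meson span_mono subset_insertI subsetD)
        ultimately have "b \<in> span (h ` {..<Suc N})"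
          by (subst b) (rule span_add)
        then show "insert b (g ` {..<N}) \<subseteq> span (h ` {..<Suc N})"
          unfolding im by (auto intro: span_base)
      qed
      moreover have "\<forall>i<m. h i = f i" "m \<le> Suc N"
        using g by (auto simp: h_def)
      ultimately show ?thesis using sp by metis
    qed
  qed
  then show thesis using that by blast
qed

lemma orthonormal_family_complete:
  assumes e: "orthonormal_family n e" and f: "orthonormal_family m f"
    and sub: "f ` {..<m} \<subseteq> span (e ` {..<n})"
  obtains g where "m \<le> n" "orthonormal_family n g" "\<And>i. i < m \<Longrightarrow> g i = f i"
    "span (g ` {..<n}) = span (e ` {..<n})"
proof -
  obtain N g where g: "m \<le> N" "orthonormal_family N g" "\<And>i. i < m \<Longrightarrow> g i = f i"
    "span (g ` {..<N}) = span (f ` {..<m} \<union> e ` {..<n})"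
    using orthonormal_family_extend[OF f, of "e ` {..<n}"] by auto
  have sp: "span (f ` {..<m} \<union> e ` {..<n}) = span (e ` {..<n})"
    using sub by (intro span_eq[THEN iffD2]) (auto intro: span_base)
  have "N = n"
    using orthonormal_family_dim[OF g(2)] orthonormal_family_dim[OF e] g(4) sp by simp
  then show thesis using that g sp by simp
qed

text \<open>A prescribed unit vector is put in the last place, because the last coordinate is the one that the
Fubini formulas split off.\<close>

lemma orthonormal_family_last:
  assumes e: "orthonormal_family n e" and u: "u \<in> span (e ` {..<n})" "norm u = 1"
  obtains m f where "n = Suc m" "orthonormal_family (Suc m) f" "f m = u"
    "span (f ` {..<Suc m}) = span (e ` {..<n})"
proof -
  have "orthonormal_family 1 (\<lambda>_. u)"
    using u by (simp add: orthonormal_family_def norm_eq_1)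
  then obtain g where g: "1 \<le> n" "orthonormal_family n g" "\<And>i. i < 1 \<Longrightarrow> g i = u"
    "span (g ` {..<n}) = span (e ` {..<n})"
    using orthonormal_family_complete[OF e, of 1 "\<lambda>_. u"] u by auto
  obtain m where m: "n = Suc m" using g(1) by (cases n) auto
  define f where "f i = g (m - i)" for i
  have im: "f ` {..<Suc m} = g ` {..<Suc m}"
  proof -
    have "(\<lambda>i. m - i) ` {..<Suc m} = {..<Suc m}"
    proof (intro equalityI subsetI)
      fix i assume "i \<in> {..<Suc m}"
      then have "i = m - (m - i)" "m - i \<in> {..<Suc m}" by auto
      then show "i \<in> (\<lambda>i. m - i) ` {..<Suc m}" by (rule image_eqI)
    qed auto
    then show ?thesis unfolding f_def by (simp flip: image_image)
  qed
  have "orthonormal_family (Suc m) f"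
    using g(2) unfolding m orthonormal_family_def f_def by (auto simp: eq_diff_iff)
  moreover have "f m = u" using g(3)[of 0] by (simp add: f_def)
  ultimately show thesis using that m im g(4) by simp
qed

lemma orthonormal_family_of_finite:
  assumes "finite B"
  obtains n e where "orthonormal_family n e" "span (e ` {..<n}) = span B"
proof -
  have "orthonormal_family 0 (\<lambda>_. 0::'a)" by (simp add: orthonormal_family_def)
  from orthonormal_family_extend[OF this assms] that show thesis by auto
qed

lemma orthonormal_family_of_subspace:
  assumes W: "subspace W" "W \<subseteq> span (e ` {..<n::nat})"
  obtains k f where "orthonormal_family k f" "span (f ` {..<k}) = W"
proof -
  obtain B where B: "B \<subseteq> W" "independent B" "W \<subseteq> span B"
    by (rule maximal_independent_subset)
  have "finite B"
    using independent_span_bound[of "e ` {..<n}" B] B W(2) by auto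
  moreover have "span B = W"
    using B W(1) by (metis span_minimal subset_antisym)
  ultimately show thesis
    using orthonormal_family_of_finite that by metis
qed

section \<open>Compactness in finite-dimensional subspaces\<close>

lemma compact_set_plus:
  fixes S T :: "'a::real_normed_vector set"
  assumes "compact S" "compact T" shows "compact (S + T)"
proof -
  have "S + T = {x + y | x y. x \<in> S \<and> y \<in> T}"
    by (auto simp: set_plus_def)
  then show ?thesis using compact_sums[OF assms] by simp
qed

lemma compact_coordinate_cube:
  fixes e :: "nat \<Rightarrow> 'a::real_normed_vector"
  shows "compact {(\<Sum>i<n. c i *\<^sub>R e i) | c. \<forall>i<n. \<bar>c i\<bar> \<le> (r::real)}"
proof (induction n)
  case 0
  have "{(\<Sum>i<0. c i *\<^sub>R e i) | c. \<forall>i<0. \<bar>c i\<bar> \<le> r} = {0}" by auto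
  then show ?case by simp
next
  case (Suc n)
  have "{(\<Sum>i<Suc n. c i *\<^sub>R e i) | c. \<forall>i<Suc n. \<bar>c i\<bar> \<le> r}
      = {(\<Sum>i<n. c i *\<^sub>R e i) | c. \<forall>i<n. \<bar>c i\<bar> \<le> r} + (\<lambda>t. t *\<^sub>R e n) ` {-r..r}" (is "?L = ?R")
  proof (intro equalityI subsetI)
    fix x assume "x \<in> ?L"
    then obtain c where c: "x = (\<Sum>i<Suc n. c i *\<^sub>R e i)" "\<forall>i<Suc n. \<bar>c i\<bar> \<le> r" by blast
    have "(\<Sum>i<n. c i *\<^sub>R e i) \<in> {(\<Sum>i<n. c i *\<^sub>R e i) | c. \<forall>i<n. \<bar>c i\<bar> \<le> r}"
      using c(2) by auto
    moreover have "c n *\<^sub>R e n \<in> (\<lambda>t. t *\<^sub>R e n) ` {-r..r}"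
      using c(2) by (intro imageI) (auto simp: abs_le_iff minus_le_iff)
    ultimately show "x \<in> ?R"
      unfolding c(1) sum.lessThan_Suc by (rule set_plus_intro)
  next
    fix x assume "x \<in> ?R"
    then obtain c t where c: "\<forall>i<n. \<bar>c i\<bar> \<le> r" "x = (\<Sum>i<n. c i *\<^sub>R e i) + t *\<^sub>R e n" "-r \<le> t" "t \<le> r"
      unfolding set_plus_def by auto (metis (no_types, lifting))
    then have "x = (\<Sum>i<Suc n. (c(n := t)) i *\<^sub>R e i) \<and> (\<forall>i<Suc n. \<bar>(c(n := t)) i\<bar> \<le> r)"
      by (auto simp: less_Suc_eq)
    then show "x \<in> ?L" by blast
  qed
  moreover have "compact ((\<lambda>t. t *\<^sub>R e n) ` {-r..r})"
    by (intro compact_continuous_image continuous_intros) simp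
  ultimately show ?case using compact_set_plus[OF Suc.IH] by simp
qed

lemma compact_span_cball:
  assumes "orthonormal_family n e"
  shows "compact {b \<in> span (e ` {..<n}). norm b \<le> r}"
proof -
  let ?Q = "{(\<Sum>i<n. c i *\<^sub>R e i) | c. \<forall>i<n. \<bar>c i\<bar> \<le> r}"
  have "{b \<in> span (e ` {..<n}). norm b \<le> r} = ?Q \<inter> cball 0 r"
  proof (intro equalityI subsetI)
    fix b assume b: "b \<in> {b \<in> span (e ` {..<n}). norm b \<le> r}"
    then have "b = (\<Sum>i<n. (b \<bullet> e i) *\<^sub>R e i)"
      using orthonormal_expansion[OF assms] by auto
    moreover have "\<bar>b \<bullet> e i\<bar> \<le> r" if "i < n" for i
    proof -
      have "norm (e i) = 1"
        using assms that by (simp add: orthonormal_family_def norm_eq_1)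
      then show ?thesis
        using Cauchy_Schwarz_ineq2[of b "e i"] b by simp
    qed
    ultimately show "b \<in> ?Q \<inter> cball 0 r" using b by auto
  next
    fix b assume "b \<in> ?Q \<inter> cball 0 r"
    then show "b \<in> {b \<in> span (e ` {..<n}). norm b \<le> r}"
      by (auto intro!: span_sum intro: span_scale span_base)
  qed
  then show ?thesis
    using compact_coordinate_cube[of e n r] by (simp add: compact_Int_closed)
qed

text \<open>In an infinite-dimensional space bounded closed sets need not be compact; inside a finite-dimensional
affine subspace they are, since that subspace meets a ball in a compact set.\<close>

lemma closure_in_finite_span:
  assumes e: "orthonormal_family n e" and T: "bounded T" "T \<subseteq> (+) p ` span (e ` {..<n})"
  shows "compact (closure T)" "closure T \<subseteq> (+) p ` span (e ` {..<n})"
proof -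
  obtain r where r: "\<And>x. x \<in> T \<Longrightarrow> dist p x \<le> r"
    using T(1) bounded_any_center[of T p] by auto
  let ?D = "(+) p ` {b \<in> span (e ` {..<n}). norm b \<le> r}"
  have D: "compact ?D"
    by (intro compact_continuous_image compact_span_cball[OF e] continuous_intros)
  have "T \<subseteq> ?D"
  proof
    fix x assume x: "x \<in> T"
    then obtain b where "b \<in> span (e ` {..<n})" "x = p + b" using T(2) by auto
    then show "x \<in> ?D" using r[OF x] by (auto simp: dist_norm)
  qed
  then have sub: "closure T \<subseteq> ?D"
    using D by (simp add: closure_minimal compact_imp_closed)
  then show "closure T \<subseteq> (+) p ` span (e ` {..<n})" by auto
  have "closure T = ?D \<inter> closure T" using sub by auto
  then show "compact (closure T)"
    using compact_Int_closed[OF D closed_closure[of T]] by simp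
qed

section \<open>Volumes of subsets of an affine subspace\<close>

abbreviation evol :: "nat \<Rightarrow> 'a::real_inner \<Rightarrow> (nat \<Rightarrow> 'a) \<Rightarrow> 'a set \<Rightarrow> ennreal" where
  "evol n p e A \<equiv> chart_integral n p e (indicator A)"

lemma sets_affine_chart_vimage:
  assumes "A \<in> sets borel"
  shows "{x \<in> {..<n} \<rightarrow>\<^sub>E UNIV. affine_chart n p e x \<in> A} \<in> sets (coords n)"
  using measurable_sets[OF measurable_affine_chart assms, of n p e]
  by (simp add: vimage_def Int_def space_PiM conj_commute)

lemma evol_eq_emeasure:
  assumes "A \<in> sets borel"
  shows "evol n p e A = emeasure (coords n) {x \<in> {..<n} \<rightarrow>\<^sub>E UNIV. affine_chart n p e x \<in> A}"
    (is "_ = emeasure _ ?S")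
proof -
  have "evol n p e A = (\<integral>\<^sup>+ x. indicator ?S x \<partial>coords n)"
    unfolding chart_integral_def
    by (intro nn_integral_cong) (auto simp: indicator_def space_PiM)
  then show ?thesis using sets_affine_chart_vimage[OF assms] by simp
qed

lemma evol_mono: "A \<subseteq> B \<Longrightarrow> evol n p e A \<le> evol n p e B"
  unfolding chart_integral_def by (intro nn_integral_mono) (auto simp: indicator_def)

lemma evol_finite:
  assumes "orthonormal_family n e" "bounded A"
  shows "evol n p e A < \<infinity>"
proof -
  obtain r where r: "\<And>x. x \<in> A \<Longrightarrow> dist p x \<le> r"
    using assms(2) bounded_any_center[of A p] by auto
  have "A \<subseteq> cball p (max r 1)"
    using r by (auto simp: le_max_iff_disj)
  from evol_mono[OF this, of n p e]
  have "evol n p e A \<le> ennreal (unit_ball_vol (real n) * max r 1 ^ n)"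
    using chart_integral_cball[OF assms(1), of "max r 1" p] by simp
  then show ?thesis by (simp add: order_le_less_trans)
qed

text \<open>A convex set need not be Borel. It is squeezed between two Borel sets of equal volume, and the
completed measure then assigns it that volume.\<close>

lemma measure_completion_sandwich:
  assumes A: "A \<in> sets M" and B: "B \<in> sets M" and "A \<subseteq> S" "S \<subseteq> B"
    and eq: "emeasure M A = emeasure M B" and fin: "emeasure M B < \<infinity>"
  shows "measure (completion M) S = measure M B"
proof -
  have "emeasure M (B - A) = 0"
    using emeasure_Diff[of M A B] A B eq fin assms(3,4) by (simp add: order_trans)
  then have "B - A \<in> null_sets (completion M)"
    using A B by (intro null_sets_completionI) auto
  then have N: "S - A \<in> null_sets (completion M)"
    by (rule null_sets_completion_subset[rotated]) (use assms(4) in auto)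
  have A': "A \<in> sets (completion M)" using A by auto
  have "emeasure (completion M) (A \<union> (S - A)) = emeasure (completion M) A"
    using N A' by (rule emeasure_Un_null_set[rotated])
  moreover have "A \<union> (S - A) = S" using assms(3) by auto
  ultimately have "emeasure (completion M) S = emeasure M B"
    using A eq by simp
  then show ?thesis by (simp add: measure_def)
qed

lemma vol_eq_enn2real:
  assumes "A \<subseteq> T" "T \<subseteq> B" "A \<in> sets borel" "B \<in> sets borel"
    "evol n p e A = evol n p e B" "evol n p e B < \<infinity>"
  shows "vol n p e T = enn2real (evol n p e B)"
proof -
  let ?P = "\<lambda>A. {x \<in> {..<n} \<rightarrow>\<^sub>E UNIV. affine_chart n p e x \<in> A}"
  have "measure (completion (coords n)) (?P T) = measure (coords n) (?P B)"
    by (rule measure_completion_sandwich[OF sets_affine_chart_vimage[OF assms(3)] sets_affine_chart_vimage[OF assms(4)]])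
      (use assms in \<open>auto simp: evol_eq_emeasure\<close>)
  then show ?thesis
    using assms(4) by (simp add: vol_def lebesgue_space_def evol_eq_emeasure measure_def)
qed

lemma vol_borel:
  assumes "A \<in> sets borel" "orthonormal_family n e" "bounded A"
  shows "vol n p e A = enn2real (evol n p e A)"
  by (rule vol_eq_enn2real[OF order_refl order_refl assms(1,1)]) (use evol_finite assms in auto)

lemma evol_cong_chart:
  assumes "A \<in> sets borel" "orthonormal_family n e" "orthonormal_family m f"
    "span (e ` {..<n}) = span (f ` {..<m})" "q - p \<in> span (e ` {..<n})"
  shows "evol n p e A = evol m q f A"
  using assms by (intro chart_integral_eq_of_span_eq) auto

lemma evol_homothety:
  assumes e: "orthonormal_family n e" and s: "s > 0" and A: "A \<in> sets borel"
  shows "evol n p e ((\<lambda>y. p + s *\<^sub>R (y - p)) ` A) = ennreal (s ^ n) * evol n p e A"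
proof -
  let ?A = "(\<lambda>y. p + s *\<^sub>R (y - p)) ` A"
  have 1: "indicator A (v + p) = (indicator ?A (s *\<^sub>R v + p) :: ennreal)" for v
  proof -
    have "v + p \<in> A \<longleftrightarrow> s *\<^sub>R v + p \<in> ?A"
      using s by (auto simp: image_iff add.commute intro!: bexI[of _ "v + p"])
    then show ?thesis by (simp add: indicator_def)
  qed
  have "?A = (\<lambda>x. p + inverse s *\<^sub>R (x - p)) -` A"
  proof (intro equalityI subsetI)
    fix x assume "x \<in> (\<lambda>x. p + inverse s *\<^sub>R (x - p)) -` A"
    then show "x \<in> ?A"
      using s by (auto intro!: image_eqI[of _ _ "p + inverse s *\<^sub>R (x - p)"])
  qed (use s in auto)
  moreover have "(\<lambda>x. p + inverse s *\<^sub>R (x - p)) \<in> borel_measurable (borel :: 'a measure)"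
    by (intro borel_measurable_continuous_onI continuous_intros)
  ultimately have "?A \<in> sets borel"
    using measurable_sets[OF _ A, of "\<lambda>x. p + inverse s *\<^sub>R (x - p)" borel] by simp
  then have "(\<lambda>v. indicator ?A (v + p) :: ennreal) \<in> borel_measurable borel"
    by (intro borel_measurable_translate) simp
  from chart_integral_scale[OF this e s] show ?thesis
    by (simp add: chart_integral_translate[of n p] 1)
qed

section \<open>Bounded convex sets and their closures\<close>

lemma convex_sum_le_1:
  assumes "convex S" "0 \<in> S" "finite B" "B \<subseteq> S" "\<And>b. b \<in> B \<Longrightarrow> (0::real) \<le> l b" "sum l B \<le> 1"
  shows "(\<Sum>b\<in>B. l b *\<^sub>R b) \<in> S"
proof (cases "sum l B = 0")
  case True
  then have "\<forall>b\<in>B. l b = 0"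
    using assms by (simp add: sum_nonneg_eq_0_iff)
  then show ?thesis using assms by simp
next
  case False
  define \<mu> where "\<mu> = sum l B"
  have \<mu>: "0 < \<mu>" "\<mu> \<le> 1"
    using False assms sum_nonneg[of B l] by (auto simp: \<mu>_def)
  have "(\<Sum>b\<in>B. (l b / \<mu>) *\<^sub>R b) \<in> S"
    by (rule convex_sum[OF assms(3,1)])
      (use assms \<mu> in \<open>auto simp: sum_divide_distrib[symmetric] \<mu>_def\<close>)
  then have "(1 - \<mu>) *\<^sub>R 0 + \<mu> *\<^sub>R (\<Sum>b\<in>B. (l b / \<mu>) *\<^sub>R b) \<in> S"
    using \<mu> assms(1,2) by (intro convexD) auto
  then show ?thesis using \<mu> by (simp add: scaleR_sum_right)
qed

text \<open>The barycenter of \<open>0\<close> and of a basis chosen inside \<open>S\<close> is an interior point: small vectors change the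
barycentric coordinates, all equal to \<open>1 / (k + 1)\<close>, by little, because in finite dimension the
coordinates with respect to any basis are bounded by a multiple of the norm.\<close>

lemma convex_spanning_has_interior:
  assumes e: "orthonormal_family n e" and S: "convex S" "0 \<in> S"
    and sp: "span S = span (e ` {..<n})"
  obtains c \<rho> where "c \<in> S" "\<rho> > 0" "\<And>w. w \<in> span (e ` {..<n}) \<Longrightarrow> norm w < \<rho> \<Longrightarrow> c + w \<in> S"
proof -
  obtain B where B: "B \<subseteq> S" "independent B" "S \<subseteq> span B"
    by (rule maximal_independent_subset)
  have spB: "span B = span (e ` {..<n})"
    using B sp by (metis span_minimal subspace_span subset_antisym span_mono)
  have finB: "finite B"
    using independent_span_bound[of "e ` {..<n}" B] B(2) span_superset[of B] spB by auto
  define k where "k = real (card B)"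
  define K where "K = (\<Sum>b\<in>B. \<Sum>i<n. \<bar>representation B (e i) b\<bar>)"
  define c where "c = (\<Sum>b\<in>B. (1 / (k + 1)) *\<^sub>R b)"
  have K0: "K \<ge> 0" unfolding K_def by (intro sum_nonneg) auto
  have k0: "k \<ge> 0" by (simp add: k_def)
  \<comment> \<open>\<open>K + 1\<close> bounds the sum of the absolute values of the coordinates of a unit vector and is not zero.\<close>
  define \<rho> where "\<rho> = 1 / ((k + 1) * (K + 1))"
  have \<rho>: "\<rho> > 0" using K0 k0 by (simp add: \<rho>_def)
  have main: "c + w \<in> S" if w: "w \<in> span (e ` {..<n})" and nw: "norm w < \<rho>" for w
  proof -
    define l where "l b = 1 / (k + 1) + representation B w b" for b
    have wB: "w \<in> span B" using w spB by simp
    have rep: "representation B w b = (\<Sum>i<n. (w \<bullet> e i) * representation B (e i) b)" for b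
    proof -
      have "representation B w = representation B (\<Sum>i<n. (w \<bullet> e i) *\<^sub>R e i)"
        using orthonormal_expansion[OF e w] by simp
      also have "\<dots> = (\<lambda>b. \<Sum>i<n. representation B ((w \<bullet> e i) *\<^sub>R e i) b)"
        using B(2) spB by (intro representation_sum) (auto intro: span_scale span_base)
      also have "\<dots> = (\<lambda>b. \<Sum>i<n. (w \<bullet> e i) * representation B (e i) b)"
        using B(2) spB by (intro ext sum.cong) (auto simp: representation_scale span_base)
      finally show ?thesis by simp
    qed
    have bound: "\<bar>representation B w b\<bar> \<le> norm w * (\<Sum>i<n. \<bar>representation B (e i) b\<bar>)" for b
    proof -
      have "\<bar>representation B w b\<bar> \<le> (\<Sum>i<n. \<bar>(w \<bullet> e i) * representation B (e i) b\<bar>)"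
        unfolding rep by (rule sum_abs)
      also have "\<dots> \<le> (\<Sum>i<n. norm w * \<bar>representation B (e i) b\<bar>)"
      proof (rule sum_mono)
        fix i assume "i \<in> {..<n}"
        then have "norm (e i) = 1"
          using e by (simp add: orthonormal_family_def norm_eq_1)
        then have "\<bar>w \<bullet> e i\<bar> \<le> norm w"
          using Cauchy_Schwarz_ineq2[of w "e i"] by simp
        then show "\<bar>(w \<bullet> e i) * representation B (e i) b\<bar> \<le> norm w * \<bar>representation B (e i) b\<bar>"
          by (simp add: abs_mult mult_right_mono)
      qed
      finally show ?thesis by (simp add: sum_distrib_left)
    qed
    have total: "(\<Sum>b\<in>B. \<bar>representation B w b\<bar>) \<le> 1 / (k + 1)"
    proof -
      have "(\<Sum>b\<in>B. \<bar>representation B w b\<bar>) \<le> norm w * K"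
        unfolding K_def sum_distrib_left[of "norm w"] using bound
        by (intro sum_mono) (simp add: sum_distrib_left)
      also have "\<dots> \<le> \<rho> * (K + 1)"
        using nw K0 \<rho> by (intro mult_mono) auto
      also have "\<dots> = 1 / (k + 1)"
        using K0 k0 by (simp add: \<rho>_def)
      finally show ?thesis .
    qed
    have "\<bar>representation B w b\<bar> \<le> 1 / (k + 1)" if "b \<in> B" for b
      using total member_le_sum[of b B "\<lambda>b. \<bar>representation B w b\<bar>"] that finB by auto
    then have l0: "l b \<ge> 0" if "b \<in> B" for b
      using that unfolding l_def by (smt (verit))
    have "sum l B = k / (k + 1) + (\<Sum>b\<in>B. representation B w b)"
      by (simp add: l_def sum.distrib k_def)
    also have "\<dots> \<le> k / (k + 1) + (\<Sum>b\<in>B. \<bar>representation B w b\<bar>)"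
      by (intro add_left_mono sum_mono) auto
    also have "\<dots> \<le> k / (k + 1) + 1 / (k + 1)"
      using total by simp
    also have "\<dots> = 1"
      using k0 by (simp add: field_simps)
    finally have l1: "sum l B \<le> 1" .
    have "c + w = (\<Sum>b\<in>B. l b *\<^sub>R b)"
      using sum_representation_eq[OF B(2) wB finB order_refl]
      by (simp add: c_def l_def scaleR_add_left sum.distrib)
    then show ?thesis
      using convex_sum_le_1[OF S finB B(1) l0 l1] by simp
  qed
  have "c \<in> S" using main[of 0] \<rho> by (simp add: span_zero)
  then show thesis using that \<rho> main by blast
qed

lemma evol_lower_dimensional:
  assumes e: "orthonormal_family n e" and C: "C \<in> sets borel"
    and W: "W \<subseteq> span (e ` {..<n})" "subspace W" "W \<noteq> span (e ` {..<n})"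
    and CW: "C \<subseteq> (+) x ` W" and x: "x - p \<in> span (e ` {..<n})"
  shows "evol n p e C = 0"
proof -
  obtain k f where f: "orthonormal_family k f" "span (f ` {..<k}) = W"
    using orthonormal_family_of_subspace[OF W(2,1)] by blast
  obtain g where g: "k \<le> n" "orthonormal_family n g" "\<And>i. i < k \<Longrightarrow> g i = f i"
    "span (g ` {..<n}) = span (e ` {..<n})"
    using orthonormal_family_complete[OF e f(1)] f(2) W(1) by (metis span_superset order_trans)
  have gk: "span (g ` {..<k}) = W"
    using g(3) f(2) by (metis (no_types, lifting) image_cong lessThan_iff)
  have "k \<noteq> n" using gk g(4) W(3) by auto
  then obtain m where m: "n = Suc m" "k \<le> m"
    using g(1) by (cases n) auto
  have zero: "evol m (x + t *\<^sub>R g m) g C = 0" if "t \<noteq> 0" for t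
  proof -
    have "affine_chart m (x + t *\<^sub>R g m) g y \<notin> C" for y
    proof
      assume "affine_chart m (x + t *\<^sub>R g m) g y \<in> C"
      then obtain w where w: "w \<in> span (g ` {..<k})" "affine_chart m (x + t *\<^sub>R g m) g y = x + w"
        using CW gk by auto
      have "w = (\<Sum>i<Suc m. (y(m := t)) i *\<^sub>R g i)"
        using w(2) by (simp add: affine_chart_def algebra_simps)
      then have "w \<bullet> g m = t"
        using orthonormal_inner_sum[of "Suc m" g m "y(m := t)"] g(2) m by simp
      moreover have "w \<bullet> g m = 0"
      proof -
        obtain c where c: "w = (\<Sum>i<k. c i *\<^sub>R g i)"
          using w(1) by (rule span_image_lessThan)
        show ?thesis
          unfolding c inner_sum_left using g(2) m by (intro sum.neutral) (auto simp: orthonormal_family_def)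
      qed
      ultimately show False using that by simp
    qed
    then show ?thesis by (simp add: chart_integral_def)
  qed
  have "evol n p e C = evol n x g C"
    using C e g x by (intro evol_cong_chart) auto
  also have "\<dots> = (\<integral>\<^sup>+ t. evol m (x + t *\<^sub>R g m) g C \<partial>lborel)"
    unfolding m by (rule chart_integral_Suc) (use C in simp)
  also have "\<dots> = (\<integral>\<^sup>+ (t::real). 0 \<partial>lborel)"
  proof (rule nn_integral_cong_AE)
    have "AE t in lborel. t \<noteq> (0::real)"
      by (rule AE_lborel_singleton)
    then show "AE t in lborel. evol m (x + t *\<^sub>R g m) g C = 0"
      by eventually_elim (rule zero)
  qed
  finally show ?thesis by simp
qed

text \<open>A bounded convex set has the same volume as its closure. If it spans the ambient subspace it has an
interior point \<open>q\<close>, and shrinking the closure towards \<open>q\<close> by any factor \<open>s < 1\<close> moves it into the set; the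
volume of the shrunk closure tends to that of the closure as \<open>s \<rightarrow> 1\<close>. Otherwise the closure lies in a
proper affine subspace and both volumes vanish.\<close>

lemma vol_convex:
  assumes e: "orthonormal_family n e" and T: "convex T" "bounded T" "T \<subseteq> (+) p ` span (e ` {..<n})"
  shows "vol n p e T = enn2real (evol n p e (closure T))"
proof -
  let ?U = "span (e ` {..<n})"
  have cl: "compact (closure T)" "closure T \<subseteq> (+) p ` ?U"
    using closure_in_finite_span[OF e T(2,3)] by auto
  have clb: "closure T \<in> sets borel" by simp
  have fin: "evol n p e (closure T) < \<infinity>"
    using cl(1) by (intro evol_finite[OF e]) (simp add: compact_imp_bounded)
  show ?thesis
  proof (cases "T = {}")
    case True
    then show ?thesis by (simp add: vol_def chart_integral_def)
  next
    case False
    then obtain x0 where x0: "x0 \<in> T" by auto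
    then have x0p: "x0 - p \<in> ?U" using T(3) by auto
    define S where "S = (\<lambda>x. x - x0) ` T"
    have SU: "S \<subseteq> ?U"
    proof
      fix s assume "s \<in> S"
      then obtain x where x: "x \<in> T" "s = (x - p) - (x0 - p)" by (auto simp: S_def)
      then have "x - p \<in> ?U" using T(3) by auto
      then show "s \<in> ?U" unfolding x(2) by (rule span_diff[OF _ x0p])
    qed
    have S: "convex S" "0 \<in> S"
      using T(1) x0 by (auto simp: S_def convex_translation_subtract intro: image_eqI[of _ _ x0])
    show ?thesis
    proof (cases "span S = ?U")
      case False
      have "T \<subseteq> (+) x0 ` span S"
      proof
        fix x assume "x \<in> T"
        then have "x - x0 \<in> span S" by (intro span_base) (simp add: S_def)
        then show "x \<in> (+) x0 ` span S" by (rule rev_image_eqI) simp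
      qed
      moreover obtain k f where f: "orthonormal_family k f" "span (f ` {..<k}) = span S"
        using orthonormal_family_of_subspace[of "span S" e n] SU by (auto simp: span_minimal)
      ultimately have "closure T \<subseteq> (+) x0 ` span S"
        using closure_in_finite_span(2)[OF f(1) T(2), of x0] by simp
      then have "evol n p e (closure T) = 0"
        using SU False x0p by (intro evol_lower_dimensional[OF e clb, of "span S" x0]) (auto simp: span_minimal)
      then show ?thesis
        using fin by (intro vol_eq_enn2real[of "{}"]) (auto simp: closure_subset chart_integral_def)
    next
      case True
      obtain c \<rho> where c: "c \<in> S" "\<rho> > 0" "\<And>w. w \<in> ?U \<Longrightarrow> norm w < \<rho> \<Longrightarrow> c + w \<in> S"
        using convex_spanning_has_interior[OF e S True] by blast
      define q where "q = x0 + c"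
      have q: "q + w \<in> T" if "w \<in> ?U" "norm w < \<rho>" for w
        using c(3)[OF that] by (auto simp: S_def q_def algebra_simps)
      have qp: "q - p \<in> ?U"
      proof -
        have "q - p = (x0 - p) + c" by (simp add: q_def)
        also have "\<dots> \<in> ?U" by (intro span_add x0p subsetD[OF SU] c(1))
        finally show ?thesis .
      qed
      define D where "D s = (\<lambda>y. q + s *\<^sub>R (y - q)) ` closure T" for s :: real
      have DT: "D s \<subseteq> T" if s: "0 < s" "s < 1" for s
      proof
        fix z assume "z \<in> D s"
        then obtain y where y: "y \<in> closure T" "z = q + s *\<^sub>R (y - q)" by (auto simp: D_def)
        \<comment> \<open>Replacing \<open>y\<close> by a point \<open>y'\<close> of \<open>T\<close> this close to it is compensated by moving \<open>q\<close> by less than \<open>\<rho>\<close>.\<close>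
        define \<epsilon> where "\<epsilon> = \<rho> * (1 - s) / s"
        have "\<epsilon> > 0" using c(2) s by (simp add: \<epsilon>_def)
        then obtain y' where y': "y' \<in> T" "dist y' y < \<epsilon>"
          using y(1) by (auto simp: closure_approachable)
        define w where "w = (s / (1 - s)) *\<^sub>R (y - y')"
        have "y - p \<in> ?U" "y' - p \<in> ?U" using y(1) y'(1) T(3) cl(2) by auto
        from span_diff[OF this] have "y - y' \<in> ?U" by simp
        then have wU: "w \<in> ?U" unfolding w_def by (rule span_scale)
        have "norm w = (s / (1 - s)) * dist y' y"
          using s by (simp add: w_def dist_norm norm_minus_commute)
        also have "\<dots> < (s / (1 - s)) * \<epsilon>"
          using y'(2) s by (intro mult_strict_left_mono) auto
        also have "\<dots> = \<rho>" using s by (simp add: \<epsilon>_def)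
        finally have "q + w \<in> T" by (rule q[OF wU])
        then have "(1 - s) *\<^sub>R (q + w) + s *\<^sub>R y' \<in> T"
          using T(1) y'(1) s by (intro convexD) auto
        also have "(1 - s) *\<^sub>R (q + w) + s *\<^sub>R y' = (1 - s) *\<^sub>R q + ((1 - s) * (s / (1 - s))) *\<^sub>R (y - y') + s *\<^sub>R y'"
          by (simp add: w_def algebra_simps)
        also have "\<dots> = (1 - s) *\<^sub>R q + s *\<^sub>R (y - y') + s *\<^sub>R y'"
          using s by simp
        also have "\<dots> = z" using y(2) by (simp add: algebra_simps)
        finally show "z \<in> T" .
      qed
      have Dc: "compact (D s)" for s
        unfolding D_def by (intro compact_continuous_image cl(1) continuous_intros)
      have vD: "evol n q e (D s) = ennreal (s ^ n) * evol n q e (closure T)" if "0 < s" for s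
        unfolding D_def by (rule evol_homothety[OF e that clb])
      define s :: "nat \<Rightarrow> real" where "s j = 1 - inverse (real (Suc (Suc j)))" for j
      have s01: "0 < s j" "s j < 1" for j by (auto simp: s_def field_simps)
      define A where "A = (\<Union>j. D (s j))"
      have AT: "A \<subseteq> T" using DT s01 by (auto simp: A_def)
      have Ab: "A \<in> sets borel"
        unfolding A_def using Dc by (intro sets.countable_UN) (auto intro: borel_compact)
      have tr: "evol n p e X = evol n q e X" if "X \<in> sets borel" for X
        using that e qp by (intro evol_cong_chart) auto
      have "evol n q e (closure T) \<le> evol n q e A"
      proof (rule LIMSEQ_le_const2)
        have "s \<longlonglongrightarrow> 1 - 0"
          unfolding s_def by (intro tendsto_diff tendsto_const LIMSEQ_Suc[OF LIMSEQ_inverse_real_of_nat])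
        then have "(\<lambda>j. ennreal (s j ^ n)) \<longlonglongrightarrow> ennreal ((1 - 0) ^ n)"
          by (intro tendsto_ennrealI tendsto_power)
        from tendsto_mult_ennreal[OF this tendsto_const[of "evol n q e (closure T)"]]
        show "(\<lambda>j. ennreal (s j ^ n) * evol n q e (closure T)) \<longlonglongrightarrow> evol n q e (closure T)"
          using fin tr[OF clb] by simp
        have "ennreal (s j ^ n) * evol n q e (closure T) \<le> evol n q e A" for j
        proof -
          have "D (s j) \<subseteq> A" by (auto simp: A_def)
          from evol_mono[OF this, of n q e] show ?thesis using vD[of "s j"] s01 by simp
        qed
        then show "\<exists>N. \<forall>j\<ge>N. ennreal (s j ^ n) * evol n q e (closure T) \<le> evol n q e A"
          by blast
      qed
      moreover have "evol n q e A \<le> evol n q e (closure T)"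
        using AT closure_subset by (intro evol_mono) blast
      ultimately have "evol n p e A = evol n p e (closure T)"
        using tr[OF Ab] tr[OF clb] by simp
      then show ?thesis
        using AT Ab fin by (intro vol_eq_enn2real[of A]) (auto simp: closure_subset)
    qed
  qed
qed

section \<open>Projections, segments and zonotopes\<close>

text \<open>The projection onto the orthogonal complement of \<open>z\<close>; division by zero makes it the identity when
\<open>z = 0\<close>, which is the right value.\<close>

definition perp :: "'a::real_inner \<Rightarrow> 'a \<Rightarrow> 'a" where
  "perp z x = x - ((x \<bullet> z) / (z \<bullet> z)) *\<^sub>R z"

lemma perp_add: "perp z (x + y) = perp z x + perp z y"
  by (simp add: perp_def inner_add_left add_divide_distrib algebra_simps)

lemma perp_scale: "perp z (c *\<^sub>R x) = c *\<^sub>R perp z x"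
  by (simp add: perp_def algebra_simps)

lemma linear_perp: "linear (perp z)"
  by (rule linearI) (simp_all add: perp_add perp_scale)

lemma perp_zero_left [simp]: "perp 0 x = x"
  by (simp add: perp_def)

lemma perp_scale_left: "c \<noteq> 0 \<Longrightarrow> perp (c *\<^sub>R z) x = perp z x"
  by (simp add: perp_def)

lemma inner_perp [simp]: "perp z x \<bullet> z = 0"
  by (simp add: perp_def inner_diff_left)

lemma perp_orthogonal: "x \<bullet> z = 0 \<Longrightarrow> perp z x = x"
  by (simp add: perp_def)

lemma perp_self [simp]: "perp z z = 0"
  by (simp add: perp_def)

lemma norm_perp_le: "norm (perp z x) \<le> norm x"
proof -
  have "x = perp z x + ((x \<bullet> z) / (z \<bullet> z)) *\<^sub>R z" by (simp add: perp_def)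
  then have "(norm x)\<^sup>2 = (norm (perp z x))\<^sup>2 + (norm (((x \<bullet> z) / (z \<bullet> z)) *\<^sub>R z))\<^sup>2"
    by (metis norm_add_Pythagorean orthogonal_def inner_perp inner_scaleR_right mult_zero_right)
  then have "(norm (perp z x))\<^sup>2 \<le> (norm x)\<^sup>2" by simp
  then show ?thesis by simp
qed

lemma continuous_on_perp: "continuous_on A (perp z)"
  unfolding perp_def[abs_def] divide_inverse by (intro continuous_intros)

definition seg :: "'a::real_vector \<Rightarrow> 'a set" where
  "seg z = (\<lambda>t. t *\<^sub>R z) ` {-1..1}"

text \<open>The zonotope that is the Minkowski sum of the segments from \<open>-z\<close> to \<open>z\<close>.\<close>

primrec zono :: "'a::real_vector list \<Rightarrow> 'a set" where
  "zono [] = {0}"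
| "zono (z # zs) = seg z + zono zs"

lemma set_plus_zero_left [simp]: "{0} + (A :: 'a::monoid_add set) = A"
  by (auto simp: set_plus_def)

lemma set_plus_zero_right [simp]: "(A :: 'a::monoid_add set) + {0} = A"
  by (auto simp: set_plus_def)

lemma linear_image_set_plus: "linear h \<Longrightarrow> h ` (A + B) = h ` A + h ` B"
  by (force simp: set_plus_def linear_add image_iff)

lemma seg_zero [simp]: "seg 0 = {0}"
  by (simp add: seg_def image_constant_conv)

lemma linear_image_seg: "linear h \<Longrightarrow> h ` seg z = seg (h z)"
  by (simp add: seg_def image_image linear_scale)

lemma linear_image_zono: "linear h \<Longrightarrow> h ` zono zs = zono (map h zs)"
  by (induction zs) (simp_all add: linear_image_set_plus linear_image_seg linear_0)

lemma compact_seg: "compact (seg (z :: 'a::real_normed_vector))"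
  unfolding seg_def by (intro compact_continuous_image continuous_intros) simp

lemma compact_zono: "compact (zono (zs :: 'a::real_normed_vector list))"
  by (induction zs) (simp_all add: compact_set_plus compact_seg)

lemma convex_seg: "convex (seg z)"
proof -
  have "linear (\<lambda>t. t *\<^sub>R z)" by (rule linearI) (simp_all add: scaleR_add_left)
  then show ?thesis unfolding seg_def by (rule convex_linear_image) simp
qed

lemma convex_zono: "convex (zono zs)"
  by (induction zs) (simp_all add: convex_set_plus convex_seg)

lemma zono_append: "zono (as @ bs) = zono as + zono bs"
  by (induction as) (simp_all add: add.assoc)

lemma zero_in_seg: "0 \<in> seg z"
  unfolding seg_def by (rule image_eqI[of _ _ 0]) auto

lemma zono_subset_span: "zono zs \<subseteq> span (set zs)"
proof (induction zs)
  case (Cons z zs)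
  have "seg z \<subseteq> span (set (z # zs))"
    by (auto simp: seg_def intro: span_scale span_base)
  moreover have "zono zs \<subseteq> span (set (z # zs))"
    using Cons span_mono[of "set zs" "set (z # zs)"] by auto
  ultimately show ?case by (auto simp: set_plus_def intro!: span_add)
qed simp

lemma scale_zono_eq: "(*\<^sub>R) r ` zono zs = zono (map ((*\<^sub>R) r) zs)"
  by (rule linear_image_zono) (rule linearI, simp_all add: scaleR_add_right)

section \<open>Adding a segment\<close>

lemma evol_cong_on_chart:
  assumes "\<And>x. x \<in> span (e ` {..<n}) \<Longrightarrow> p + x \<in> A \<longleftrightarrow> p + x \<in> B"
  shows "evol n p e A = evol n p e B"
proof -
  have "affine_chart n p e x = p + affine_chart n 0 e x" for x
    by (simp add: affine_chart_def)
  then have "indicator A (affine_chart n p e x) = (indicator B (affine_chart n p e x) :: ennreal)" for x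
    using assms[OF affine_chart_in_span[of n e x]] by (simp add: indicator_def)
  then show ?thesis by (simp add: chart_integral_def)
qed

text \<open>A line in the direction \<open>u\<close> meets a compact convex set in an interval or not at all. Adding the segment
from \<open>- s u\<close> to \<open>s u\<close> lengthens every nonempty interval by \<open>2 s\<close> and leaves the empty ones empty; the
lines of the first kind are those that pass through the projection of the set.\<close>

lemma slice_length_add_segment:
  assumes A: "compact A" "convex A" and u: "norm u = 1" and y: "y \<bullet> u = 0" and s: "s \<ge> 0"
  shows "emeasure lborel {t. y + t *\<^sub>R u \<in> A + seg (s *\<^sub>R u)}
       = emeasure lborel {t. y + t *\<^sub>R u \<in> A} + ennreal (2 * s) * indicator (perp u ` A) y"
proof -
  let ?S = "{t. y + t *\<^sub>R u \<in> A}" and ?S' = "{t. y + t *\<^sub>R u \<in> A + seg (s *\<^sub>R u)}"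
  have uu: "u \<bullet> u = 1" using u by (simp add: norm_eq_1)
  have S': "?S' = {t. \<exists>r. \<bar>r\<bar> \<le> s \<and> t - r \<in> ?S}"
  proof (intro equalityI subsetI; clarsimp)
    fix t assume "y + t *\<^sub>R u \<in> A + seg (s *\<^sub>R u)"
    then obtain a c where a: "a \<in> A" "-1 \<le> c" "c \<le> 1" "y + t *\<^sub>R u = a + (c * s) *\<^sub>R u"
      by (auto simp: set_plus_def seg_def)
    then have "y + (t - c * s) *\<^sub>R u \<in> A" by (simp add: algebra_simps)
    moreover have "\<bar>c * s\<bar> \<le> s"
      using a s mult_right_mono[of "\<bar>c\<bar>" 1 s] by (simp add: abs_mult abs_le_iff)
    ultimately show "\<exists>r. \<bar>r\<bar> \<le> s \<and> y + (t - r) *\<^sub>R u \<in> A" by blast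
  next
    fix t r assume r: "\<bar>r\<bar> \<le> s" "y + (t - r) *\<^sub>R u \<in> A"
    have "r *\<^sub>R u \<in> seg (s *\<^sub>R u)"
    proof (cases "s = 0")
      case True
      then show ?thesis using r by simp
    next
      case False
      then have "r *\<^sub>R u = (r / s) *\<^sub>R (s *\<^sub>R u)" "r / s \<in> {-1..1}"
        using r s by (auto simp: field_simps abs_le_iff)
      then show ?thesis unfolding seg_def by (rule image_eqI)
    qed
    from set_plus_intro[OF r(2) this] show "y + t *\<^sub>R u \<in> A + seg (s *\<^sub>R u)"
      by (simp add: algebra_simps)
  qed
  have ind: "y \<in> perp u ` A \<longleftrightarrow> ?S \<noteq> {}"
  proof
    assume "y \<in> perp u ` A"
    then obtain a where "a \<in> A" "y = a - (a \<bullet> u) *\<^sub>R u" by (auto simp: perp_def uu)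
    then have "a \<bullet> u \<in> ?S" by simp
    then show "?S \<noteq> {}" by blast
  next
    assume "?S \<noteq> {}"
    then obtain t where t: "y + t *\<^sub>R u \<in> A" by auto
    have "perp u (y + t *\<^sub>R u) = y"
      by (simp add: perp_add perp_scale perp_orthogonal y)
    then show "y \<in> perp u ` A" using t by (metis imageI)
  qed
  show ?thesis
  proof (cases "?S = {}")
    case True
    then have "?S' = {}" unfolding S' by auto
    then show ?thesis using True ind by simp
  next
    case False
    have "compact ?S"
    proof -
      have "closed ?S"
      proof -
        have "?S = (\<lambda>t. y + t *\<^sub>R u) -` A" by auto
        moreover have "closed ((\<lambda>t. y + t *\<^sub>R u) -` A)"
          by (intro closed_vimage compact_imp_closed A continuous_intros)
        ultimately show ?thesis by simp
      qed
      moreover have "bounded ?S"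
      proof -
        obtain M where M: "\<And>a. a \<in> A \<Longrightarrow> norm a \<le> M"
          using compact_imp_bounded[OF A(1)] by (auto simp: bounded_iff)
        have "\<bar>t\<bar> \<le> M" if "t \<in> ?S" for t
        proof -
          have "t = (y + t *\<^sub>R u) \<bullet> u" by (simp add: inner_add_left y uu)
          then have "\<bar>t\<bar> \<le> norm (y + t *\<^sub>R u)"
            using Cauchy_Schwarz_ineq2[of "y + t *\<^sub>R u" u] u by simp
          then show ?thesis using M that by force
        qed
        then show ?thesis by (auto simp: bounded_iff)
      qed
      ultimately show ?thesis by (simp add: compact_eq_bounded_closed)
    qed
    moreover have "convex ?S"
    proof (rule convexI)
      fix a b and v w :: real
      assume ab: "a \<in> ?S" "b \<in> ?S" and vw: "0 \<le> v" "0 \<le> w" "v + w = 1"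
      have "v *\<^sub>R (y + a *\<^sub>R u) + w *\<^sub>R (y + b *\<^sub>R u) \<in> A"
        using A(2) ab vw by (intro convexD) auto
      also have "v *\<^sub>R (y + a *\<^sub>R u) + w *\<^sub>R (y + b *\<^sub>R u) = (v + w) *\<^sub>R y + (v * a + w * b) *\<^sub>R u"
        by (simp add: algebra_simps)
      finally show "v *\<^sub>R a + w *\<^sub>R b \<in> ?S" using vw by simp
    qed
    ultimately obtain a b where ab: "?S = {a..b}"
      using connected_compact_interval_1[of ?S] convex_connected[of ?S] by auto
    then have le: "a \<le> b" using False by auto
    have "?S' = {a - s..b + s}"
    proof (unfold S' ab, intro equalityI subsetI)
      fix t assume t: "t \<in> {a - s..b + s}"
      \<comment> \<open>The smallest displacement that brings \<open>t\<close> into the interval.\<close>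
      define r where "r = (if t < a then t - a else if t > b then t - b else 0)"
      have "\<bar>r\<bar> \<le> s \<and> t - r \<in> {a..b}"
        using t le s by (auto simp: r_def)
      then show "t \<in> {t. \<exists>r. \<bar>r\<bar> \<le> s \<and> t - r \<in> {a..b}}" by blast
    qed (auto simp: abs_le_iff)
    then have "emeasure lborel ?S' = ennreal ((b - a) + 2 * s)"
      using le s by simp
    also have "\<dots> = ennreal (b - a) + ennreal (2 * s)"
      using le s by (intro ennreal_plus) auto
    also have "ennreal (b - a) = emeasure lborel ?S"
      unfolding ab using le by simp
    finally show ?thesis using False ind by simp
  qed
qed

text \<open>The slice formula, integrated over the hyperplane orthogonal to the segment.\<close>

lemma evol_add_segment:
  assumes f: "orthonormal_family (Suc m) f" and A: "compact A" "convex A"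
    and p: "p \<bullet> f m = 0" and s: "s \<ge> 0"
  shows "evol (Suc m) p f (A + seg (s *\<^sub>R f m))
       = evol (Suc m) p f A + ennreal (2 * s) * evol m p f (perp (f m) ` A)"
proof -
  have u: "norm (f m) = 1" using f by (simp add: orthonormal_family_def norm_eq_1)
  have y: "affine_chart m p f x \<bullet> f m = 0" for x
  proof -
    have "(\<Sum>i<m. x i *\<^sub>R f i) \<bullet> f m = 0"
      unfolding inner_sum_left using f by (intro sum.neutral) (auto simp: orthonormal_family_def)
    then show ?thesis using p by (simp add: affine_chart_def inner_add_left)
  qed
  have slice: "evol (Suc m) p f X = (\<integral>\<^sup>+ x. emeasure lborel {t. affine_chart m p f x + t *\<^sub>R f m \<in> X} \<partial>coords m)"
    if "compact X" for X
  proof -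
    have X: "X \<in> sets borel" using that by (rule borel_compact)
    have "evol (Suc m) p f X
        = (\<integral>\<^sup>+ x. (\<integral>\<^sup>+ t. indicator X (affine_chart m p f x + t *\<^sub>R f m) \<partial>lborel) \<partial>coords m)"
      using X by (intro chart_integral_Suc_slice) simp
    also have "\<dots> = (\<integral>\<^sup>+ x. emeasure lborel {t. affine_chart m p f x + t *\<^sub>R f m \<in> X} \<partial>coords m)"
    proof (intro nn_integral_cong)
      fix x
      have "closed {t. affine_chart m p f x + t *\<^sub>R f m \<in> X}"
      proof -
        have "{t. affine_chart m p f x + t *\<^sub>R f m \<in> X} = (\<lambda>t. affine_chart m p f x + t *\<^sub>R f m) -` X" by auto
        moreover have "closed ((\<lambda>t. affine_chart m p f x + t *\<^sub>R f m) -` X)"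
          by (intro closed_vimage compact_imp_closed that continuous_intros)
        ultimately show ?thesis by simp
      qed
      then have "{t. affine_chart m p f x + t *\<^sub>R f m \<in> X} \<in> sets lborel" by simp
      from nn_integral_indicator[OF this]
      show "(\<integral>\<^sup>+ t. indicator X (affine_chart m p f x + t *\<^sub>R f m) \<partial>lborel)
          = emeasure lborel {t. affine_chart m p f x + t *\<^sub>R f m \<in> X}"
        by (simp add: indicator_def)
    qed
    finally show ?thesis .
  qed
  have meas: "(\<lambda>x. emeasure lborel {t. affine_chart m p f x + t *\<^sub>R f m \<in> A}) \<in> borel_measurable (coords m)"
  proof -
    have "(\<lambda>z. p + (\<Sum>i<m. fst z i *\<^sub>R f i) + (\<Sum>i<Suc 0. snd z *\<^sub>R f m)) \<in> borel_measurable (coords m \<Otimes>\<^sub>M lborel)"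
      by (rule borel_measurable_sum_charts) measurable
    then have ch: "(\<lambda>z. affine_chart m p f (fst z) + snd z *\<^sub>R f m) \<in> borel_measurable (coords m \<Otimes>\<^sub>M lborel)"
      by (simp add: affine_chart_def)
    have "{z \<in> space (coords m \<Otimes>\<^sub>M lborel). affine_chart m p f (fst z) + snd z *\<^sub>R f m \<in> A} \<in> sets (coords m \<Otimes>\<^sub>M lborel)"
      using measurable_sets[OF ch borel_compact[OF A(1)]] by (simp add: vimage_def Int_def conj_commute)
    from lborel.measurable_emeasure_Pair[OF this]
    have "(\<lambda>x. emeasure lborel (Pair x -` {z \<in> space (coords m \<Otimes>\<^sub>M lborel). affine_chart m p f (fst z) + snd z *\<^sub>R f m \<in> A}))
      \<in> borel_measurable (coords m)" .
    then show ?thesis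
      by (rule measurable_cong[THEN iffD1, rotated]) (auto simp: space_pair_measure intro!: arg_cong[where f = "emeasure lborel"])
  qed
  have cP: "compact (perp (f m) ` A)"
    by (intro compact_continuous_image A continuous_on_perp)
  have "evol (Suc m) p f (A + seg (s *\<^sub>R f m))
      = (\<integral>\<^sup>+ x. emeasure lborel {t. affine_chart m p f x + t *\<^sub>R f m \<in> A}
          + ennreal (2 * s) * indicator (perp (f m) ` A) (affine_chart m p f x) \<partial>coords m)"
    using slice_length_add_segment[OF A u y s]
    by (simp add: slice[OF compact_set_plus[OF A(1) compact_seg]])
  also have "\<dots> = evol (Suc m) p f A + ennreal (2 * s) * evol m p f (perp (f m) ` A)"
  proof -
    have i: "(\<lambda>x. indicator (perp (f m) ` A) (affine_chart m p f x) :: ennreal) \<in> borel_measurable (coords m)"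
      using borel_compact[OF cP] by measurable
    show ?thesis
      unfolding slice[OF A(1)] chart_integral_def[of m]
      using meas i by (simp add: nn_integral_add nn_integral_cmult)
  qed
  finally show ?thesis .
qed

lemma vol_compact:
  assumes "orthonormal_family n e" "compact A"
  shows "vol n p e A = enn2real (evol n p e A)"
  using assms by (intro vol_borel) (auto simp: borel_compact compact_imp_bounded)

text \<open>The central identity: polynomiality and monotonicity of parallel volumes, and the recursion for the
intrinsic volumes of zonotopes, are obtained by iterating it.\<close>

lemma vol_add_segment:
  assumes f: "orthonormal_family (Suc m) f" and A: "compact A" "convex A"
    and p: "p \<bullet> f m = 0" and s: "s \<ge> 0"
  shows "vol (Suc m) p f (A + seg (s *\<^sub>R f m))
       = vol (Suc m) p f A + 2 * s * vol m p f (perp (f m) ` A)"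
proof -
  have f': "orthonormal_family m f" using f by (simp add: orthonormal_family_def)
  have cP: "compact (perp (f m) ` A)"
    by (intro compact_continuous_image A continuous_on_perp)
  have fin: "evol (Suc m) p f A < \<infinity>" "evol m p f (perp (f m) ` A) < \<infinity>"
    using evol_finite[OF f] evol_finite[OF f'] A(1) cP by (auto simp: compact_imp_bounded)
  show ?thesis
    using fin s unfolding vol_compact[OF f compact_set_plus[OF A(1) compact_seg]] vol_compact[OF f A(1)]
      vol_compact[OF f' cP] evol_add_segment[OF assms]
    by (simp add: enn2real_plus enn2real_mult ennreal_mult_less_top)
qed

lemma vol_mono:
  assumes "orthonormal_family n e" "compact A" "compact B" "A \<subseteq> B"
  shows "vol n p e A \<le> vol n p e B"
  unfolding vol_compact[OF assms(1,2)] vol_compact[OF assms(1,3)]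
  using evol_finite[OF assms(1) compact_imp_bounded[OF assms(3)]]
  by (intro enn2real_mono evol_mono assms) simp

lemma vol_nonneg: "vol n p e A \<ge> 0"
  by (simp add: vol_def)

lemma vol_cong_chart:
  assumes "compact A" "orthonormal_family n e" "orthonormal_family m f"
    "span (e ` {..<n}) = span (f ` {..<m})" "q - p \<in> span (e ` {..<n})"
  shows "vol n p e A = vol m q f A"
  using evol_cong_chart[OF borel_compact[OF assms(1)] assms(2-5)]
  by (simp add: vol_compact assms)

lemma perp_in_span:
  assumes f: "orthonormal_family (Suc m) f" and x: "x \<in> span (f ` {..<Suc m})"
  shows "perp (f m) x \<in> span (f ` {..<m})"
proof -
  have ff: "f m \<bullet> f m = 1" using f by (simp add: orthonormal_family_def)
  have "x = (\<Sum>i<Suc m. (x \<bullet> f i) *\<^sub>R f i)" by (rule orthonormal_expansion[OF f x])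
  then have "perp (f m) x = (\<Sum>i<m. (x \<bullet> f i) *\<^sub>R f i)"
    unfolding perp_def ff by (simp add: algebra_simps)
  then show ?thesis by (auto intro!: span_sum intro: span_scale span_base)
qed

lemma compact_perp: "compact A \<Longrightarrow> compact (perp u ` A)"
  by (intro compact_continuous_image continuous_on_perp)

lemma convex_perp: "convex A \<Longrightarrow> convex (perp u ` A)"
  by (intro convex_linear_image linear_perp)

lemma adapted_chart:
  assumes e: "orthonormal_family n e" and z: "z \<in> span (e ` {..<n})" "z \<noteq> 0"
  obtains m f where "n = Suc m" "orthonormal_family (Suc m) f" "orthonormal_family m f" "z = norm z *\<^sub>R f m"
    "span (f ` {..<Suc m}) = span (e ` {..<n})" "perp z = perp (f m)"
    "perp (f m) p \<bullet> f m = 0" "perp (f m) p - p \<in> span (e ` {..<n})"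
proof -
  have "inverse (norm z) *\<^sub>R z \<in> span (e ` {..<n})" "norm (inverse (norm z) *\<^sub>R z) = 1"
    using z by (auto intro: span_scale)
  then obtain m f where f: "n = Suc m" "orthonormal_family (Suc m) f" "f m = inverse (norm z) *\<^sub>R z"
    "span (f ` {..<Suc m}) = span (e ` {..<n})"
    using orthonormal_family_last[OF e] by metis
  have "z = norm z *\<^sub>R f m" using z f(3) by simp
  moreover have "perp z = perp (f m)"
    unfolding f(3) using z by (simp add: perp_scale_left fun_eq_iff)
  moreover have "orthonormal_family m f" using f(2) by (simp add: orthonormal_family_def)
  moreover have "perp (f m) p - p \<in> span (e ` {..<n})"
  proof -
    have "perp (f m) p - p = (- ((p \<bullet> f m) / (f m \<bullet> f m))) *\<^sub>R f m" by (simp add: perp_def)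
    also have "\<dots> \<in> span (f ` {..<Suc m})" by (intro span_scale span_base) auto
    finally show ?thesis using f(4) by simp
  qed
  ultimately show thesis using that f by simp
qed

lemma perp_image_zono: "perp u ` (T + zono zs) = perp u ` T + zono (map (perp u) zs)"
  by (simp add: linear_image_set_plus linear_image_zono linear_perp)

text \<open>Each segment of the zonotope contributes, by the segment formula, one term of the form \<open>r\<close> times a
volume in one dimension less, to which induction applies after projection. All coefficients are
sums of volumes of projections of \<open>T\<close>, times nonnegative factors, and hence increase with \<open>T\<close>. Two
bodies are treated at once in order to express this monotonicity.\<close>

lemma vol_plus_zono_polynomial:
  assumes "orthonormal_family n e" "compact T" "convex T" "compact T'" "convex T'" "T \<subseteq> T'"
    "set zs \<subseteq> span (e ` {..<n})"
  shows "\<exists>a b. (\<forall>j. 0 \<le> a j \<and> a j \<le> b j) \<and>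
    (\<forall>r\<ge>0. vol n p e (T + zono (map ((*\<^sub>R) r) zs)) = (\<Sum>j\<le>n. a j * r ^ j) \<and>
            vol n p e (T' + zono (map ((*\<^sub>R) r) zs)) = (\<Sum>j\<le>n. b j * r ^ j))"
  using assms
proof (induction "length zs" arbitrary: n p e T T' zs)
  case 0
  then have [simp]: "zs = []" by simp
  define a where "a j = (if j = 0 then vol n p e T else 0)" for j :: nat
  define b where "b j = (if j = 0 then vol n p e T' else 0)" for j :: nat
  have "\<forall>j. 0 \<le> a j \<and> a j \<le> b j"
    using vol_mono[of n e T T' p] 0 vol_nonneg[of n p e T] by (auto simp: a_def b_def)
  moreover have "(\<Sum>j\<le>n. a j * r ^ j) = vol n p e T" "(\<Sum>j\<le>n. b j * r ^ j) = vol n p e T'" for r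
    by (simp_all add: a_def b_def if_distrib[where f = "\<lambda>x. x * _"] cong: if_cong)
  ultimately show ?case by (intro exI[of _ a] exI[of _ b]) simp
next
  case (Suc l zzs)
  obtain z zs where zzs: "zzs = z # zs" and l: "l = length zs"
    using Suc.hyps(2) by (cases zzs) auto
  note e = Suc.prems(1) and T = Suc.prems(2,3) and T' = Suc.prems(4,5)
  have zs: "set zs \<subseteq> span (e ` {..<n})" and z: "z \<in> span (e ` {..<n})"
    using Suc.prems(7) by (auto simp: zzs)
  show ?case
  proof (cases "z = 0")
    case True
    then show ?thesis using Suc.hyps(1)[OF l Suc.prems(1-6) zs, of p] by (simp add: zzs)
  next
    case False
    then obtain m f where f: "n = Suc m" "orthonormal_family (Suc m) f" "orthonormal_family m f" "z = norm z *\<^sub>R f m"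
      "span (f ` {..<Suc m}) = span (e ` {..<n})" "perp z = perp (f m)"
      "perp (f m) p \<bullet> f m = 0" "perp (f m) p - p \<in> span (e ` {..<n})"
      using adapted_chart[OF e z] by metis
    define P where "P = perp (f m)"
    define q where "q = P p"
    have "set (map P zs) \<subseteq> span (f ` {..<m})"
      using perp_in_span[OF f(2)] zs f(5) by (auto simp: P_def)
    then obtain a' b' where ab': "\<forall>j. 0 \<le> a' j \<and> a' j \<le> b' j"
      "\<And>r. r \<ge> 0 \<Longrightarrow> vol m q f (P ` T + zono (map ((*\<^sub>R) r) (map P zs))) = (\<Sum>j\<le>m. a' j * r ^ j)"
      "\<And>r. r \<ge> 0 \<Longrightarrow> vol m q f (P ` T' + zono (map ((*\<^sub>R) r) (map P zs))) = (\<Sum>j\<le>m. b' j * r ^ j)"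
    proof -
      have "l = length (map P zs)" using l by simp
      note IH = Suc.hyps(1)[OF this f(3) _ _ _ _ _ \<open>set (map P zs) \<subseteq> span (f ` {..<m})\<close>, of "P ` T" "P ` T'" q]
      show thesis
        using IH that Suc.prems(2-6) unfolding P_def by (blast intro: compact_perp convex_perp)
    qed
    obtain a b where ab: "\<forall>j. 0 \<le> a j \<and> a j \<le> b j"
      "\<And>r. r \<ge> 0 \<Longrightarrow> vol n p e (T + zono (map ((*\<^sub>R) r) zs)) = (\<Sum>j\<le>n. a j * r ^ j)"
      "\<And>r. r \<ge> 0 \<Longrightarrow> vol n p e (T' + zono (map ((*\<^sub>R) r) zs)) = (\<Sum>j\<le>n. b j * r ^ j)"
      using Suc.hyps(1)[OF l Suc.prems(1-6) zs, of p] by blast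
    define c where "c (a :: nat \<Rightarrow> real) a' j = a j + (case j of 0 \<Rightarrow> 0 | Suc i \<Rightarrow> 2 * norm z * a' i)" for a a' :: "nat \<Rightarrow> real" and j
    have step: "vol n p e (S + zono (map ((*\<^sub>R) r) (z # zs))) = (\<Sum>j\<le>n. c g g' j * r ^ j)"
      if r: "r \<ge> 0" and S: "compact S" "convex S"
        and g: "vol n p e (S + zono (map ((*\<^sub>R) r) zs)) = (\<Sum>j\<le>n. g j * r ^ j)"
        and g': "vol m q f (P ` S + zono (map ((*\<^sub>R) r) (map P zs))) = (\<Sum>j\<le>m. g' j * r ^ j)"
      for S r g g'
    proof -
      define A where "A = S + zono (map ((*\<^sub>R) r) zs)"
      have A: "compact A" "convex A"
        using S by (auto simp: A_def compact_set_plus compact_zono convex_set_plus convex_zono)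
      have sz: "r *\<^sub>R z = (r * norm z) *\<^sub>R f m" using f(4) by (metis scaleR_scaleR)
      have "S + zono (map ((*\<^sub>R) r) (z # zs)) = A + seg ((r * norm z) *\<^sub>R f m)"
        by (simp add: A_def sz[symmetric] ac_simps)
      moreover have "vol n p e (A + seg ((r * norm z) *\<^sub>R f m)) = vol (Suc m) q f (A + seg ((r * norm z) *\<^sub>R f m))"
        by (rule vol_cong_chart[OF compact_set_plus[OF A(1) compact_seg] e f(2) f(5)[symmetric]])
          (use f(8) in \<open>simp add: q_def P_def\<close>)
      moreover have "\<dots> = vol (Suc m) q f A + 2 * (r * norm z) * vol m q f (P ` A)"
        unfolding P_def using r f(7) by (intro vol_add_segment[OF f(2) A]) (auto simp: q_def P_def)
      moreover have "vol (Suc m) q f A = vol n p e A"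
        by (rule vol_cong_chart[OF A(1) e f(2) f(5)[symmetric], symmetric])
          (use f(8) in \<open>simp add: q_def P_def\<close>)
      moreover have "P ` A = P ` S + zono (map ((*\<^sub>R) r) (map P zs))"
        unfolding A_def P_def perp_image_zono by (simp add: perp_scale comp_def)
      ultimately have "vol n p e (S + zono (map ((*\<^sub>R) r) (z # zs)))
          = (\<Sum>j\<le>n. g j * r ^ j) + 2 * (r * norm z) * (\<Sum>j\<le>m. g' j * r ^ j)"
        using g g' by (simp add: A_def)
      also have "2 * (r * norm z) * (\<Sum>j\<le>m. g' j * r ^ j)
          = (\<Sum>j\<le>n. (case j of 0 \<Rightarrow> 0 | Suc i \<Rightarrow> 2 * norm z * g' i) * r ^ j)"
        unfolding f(1) sum.atMost_Suc_shift by (simp add: sum_distrib_left algebra_simps)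
      finally show ?thesis
        by (simp add: c_def distrib_right sum.distrib)
    qed
    have "\<forall>j. 0 \<le> c a a' j \<and> c a a' j \<le> c b b' j"
      using ab(1) ab'(1) by (auto simp: c_def split: nat.split intro!: add_mono add_nonneg_nonneg mult_nonneg_nonneg mult_left_mono)
    moreover have "vol n p e (T + zono (map ((*\<^sub>R) r) (z # zs))) = (\<Sum>j\<le>n. c a a' j * r ^ j)" if "r \<ge> 0" for r
      by (rule step[OF that T ab(2)[OF that] ab'(2)[OF that]])
    moreover have "vol n p e (T' + zono (map ((*\<^sub>R) r) (z # zs))) = (\<Sum>j\<le>n. c b b' j * r ^ j)" if "r \<ge> 0" for r
      by (rule step[OF that T' ab(3)[OF that] ab'(3)[OF that]])
    ultimately show ?thesis unfolding zzs by blast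
  qed
qed

section \<open>Steiner's formula for zonotopes\<close>

definition steiner :: "nat \<Rightarrow> 'a::real_inner \<Rightarrow> (nat \<Rightarrow> 'a) \<Rightarrow> 'a set \<Rightarrow> (nat \<Rightarrow> real) \<Rightarrow> bool" where
  "steiner n p e T V \<longleftrightarrow>
     (\<forall>r\<ge>0. vol n p e (parallel_body n e T r) =
        (\<Sum>k\<le>n. unit_ball_vol (real (n - k)) * V k * r ^ (n - k))) \<and> (\<forall>k>n. V k = 0)"

definition span_ball :: "nat \<Rightarrow> (nat \<Rightarrow> 'a::real_inner) \<Rightarrow> real \<Rightarrow> 'a set" where
  "span_ball n e r = {b \<in> span (e ` {..<n}). norm b \<le> r}"

lemma parallel_body_eq:
  assumes "r \<ge> 0" shows "parallel_body n e T r = T + span_ball n e r"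
proof (intro equalityI subsetI)
  fix x assume "x \<in> parallel_body n e T r"
  then obtain t b where b: "x = t + r *\<^sub>R b" "t \<in> T" "b \<in> span (e ` {..<n})" "norm b \<le> 1"
    by (auto simp: parallel_body_def)
  then have "r *\<^sub>R b \<in> span_ball n e r"
    using assms by (auto simp: span_ball_def mult_left_le intro: span_scale)
  then show "x \<in> T + span_ball n e r" using b set_plus_intro by blast
next
  fix x assume "x \<in> T + span_ball n e r"
  then obtain t b where b: "x = t + b" "t \<in> T" "b \<in> span (e ` {..<n})" "norm b \<le> r"
    by (auto simp: set_plus_def span_ball_def)
  show "x \<in> parallel_body n e T r"
  proof (cases "r = 0")
    case True
    then have "x = t + r *\<^sub>R 0" using b by simp
    then show ?thesis unfolding parallel_body_def using b span_zero by fastforce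
  next
    case False
    then have "x = t + r *\<^sub>R (inverse r *\<^sub>R b)" "norm (inverse r *\<^sub>R b) \<le> 1" "inverse r *\<^sub>R b \<in> span (e ` {..<n})"
      using b assms by (auto simp: field_simps intro: span_scale)
    then show ?thesis unfolding parallel_body_def using b by blast
  qed
qed

lemma compact_span_ball: "orthonormal_family n e \<Longrightarrow> compact (span_ball n e r)"
  unfolding span_ball_def by (rule compact_span_cball)

lemma convex_span_ball: "convex (span_ball n e r)"
proof -
  have "span_ball n e r = span (e ` {..<n}) \<inter> cball 0 r" by (auto simp: span_ball_def)
  then show ?thesis by (simp add: convex_Int subspace_imp_convex)
qed

lemma perp_span_ball:
  assumes f: "orthonormal_family (Suc m) f"
  shows "perp (f m) ` span_ball (Suc m) f r = span_ball m f r"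
proof (intro equalityI subsetI)
  fix x assume "x \<in> perp (f m) ` span_ball (Suc m) f r"
  then show "x \<in> span_ball m f r"
    using perp_in_span[OF f] norm_perp_le[of "f m"] by (auto simp: span_ball_def intro: order_trans)
next
  fix x assume x: "x \<in> span_ball m f r"
  then obtain c where c: "x = (\<Sum>i<m. c i *\<^sub>R f i)"
    unfolding span_ball_def using span_image_lessThan by blast
  have "x \<bullet> f m = 0"
    unfolding c inner_sum_left using f by (intro sum.neutral) (auto simp: orthonormal_family_def)
  then have "x = perp (f m) x" by (simp add: perp_orthogonal)
  moreover have "span (f ` {..<m}) \<subseteq> span (f ` {..<Suc m})" by (intro span_mono) auto
  then have "x \<in> span_ball (Suc m) f r" using x by (auto simp: span_ball_def)
  ultimately show "x \<in> perp (f m) ` span_ball (Suc m) f r" by (rule image_eqI)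
qed

lemma steiner_cong_chart:
  assumes T: "compact T" and e: "orthonormal_family n e" and f: "orthonormal_family m f"
    and sp: "span (e ` {..<n}) = span (f ` {..<m})" and q: "q - p \<in> span (e ` {..<n})"
    and st: "steiner n p e T V"
  shows "steiner m q f T V"
proof -
  have nm: "n = m"
    using orthonormal_family_dim[OF e] orthonormal_family_dim[OF f] sp by simp
  have "vol m q f (parallel_body m f T r) = vol n p e (parallel_body n e T r)" if "r \<ge> 0" for r
  proof -
    have "parallel_body m f T r = parallel_body n e T r"
      using that sp by (simp add: parallel_body_eq span_ball_def)
    moreover have "compact (parallel_body n e T r)"
      using that T e by (simp add: parallel_body_eq compact_set_plus compact_span_ball)
    ultimately show ?thesis using vol_cong_chart[OF _ e f sp q] by simp
  qed
  then show ?thesis using st by (simp add: steiner_def nm)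
qed

text \<open>The segment formula for the parallel body \<open>T + r B\<close>, whose projection is the parallel body of the
projection of \<open>T\<close>. Comparing coefficients gives
\<open>V\<^sub>k(T + [-z,z]) = V\<^sub>k(T) + 2 \<bar>z\<bar> V\<^sub>k\<^sub>-\<^sub>1(T')\<close> for the projection \<open>T'\<close> of \<open>T\<close> along \<open>z\<close>.\<close>

lemma steiner_add_segment:
  assumes f: "orthonormal_family (Suc m) f" and T: "compact T" "convex T"
    and p: "p \<bullet> f m = 0" and s: "s \<ge> 0"
    and V: "steiner (Suc m) p f T V" and V': "steiner m p f (perp (f m) ` T) V'"
  shows "steiner (Suc m) p f (T + seg (s *\<^sub>R f m)) (\<lambda>k. V k + (case k of 0 \<Rightarrow> 0 | Suc i \<Rightarrow> 2 * s * V' i))"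
  unfolding steiner_def
proof (intro conjI allI impI)
  fix r :: real assume r: "0 \<le> r"
  define A where "A = T + span_ball (Suc m) f r"
  have A: "compact A" "convex A"
    using T f by (auto simp: A_def compact_set_plus compact_span_ball convex_set_plus convex_span_ball)
  have "vol (Suc m) p f (parallel_body (Suc m) f (T + seg (s *\<^sub>R f m)) r) = vol (Suc m) p f (A + seg (s *\<^sub>R f m))"
    using r by (simp add: parallel_body_eq A_def ac_simps)
  also have "\<dots> = vol (Suc m) p f A + 2 * s * vol m p f (perp (f m) ` A)"
    by (rule vol_add_segment[OF f A p s])
  also have "perp (f m) ` A = parallel_body m f (perp (f m) ` T) r"
    using r by (simp add: A_def linear_image_set_plus linear_perp perp_span_ball[OF f] parallel_body_eq)
  also have "A = parallel_body (Suc m) f T r"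
    using r by (simp add: A_def parallel_body_eq)
  also have "vol (Suc m) p f (parallel_body (Suc m) f T r) + 2 * s * vol m p f (parallel_body m f (perp (f m) ` T) r)
      = (\<Sum>k\<le>Suc m. unit_ball_vol (real (Suc m - k)) * V k * r ^ (Suc m - k))
        + 2 * s * (\<Sum>k\<le>m. unit_ball_vol (real (m - k)) * V' k * r ^ (m - k))"
    using V V' r by (simp add: steiner_def)
  also have "2 * s * (\<Sum>k\<le>m. unit_ball_vol (real (m - k)) * V' k * r ^ (m - k))
      = (\<Sum>k\<le>Suc m. unit_ball_vol (real (Suc m - k)) * (case k of 0 \<Rightarrow> 0 | Suc i \<Rightarrow> 2 * s * V' i) * r ^ (Suc m - k))"
    unfolding sum.atMost_Suc_shift by (simp add: sum_distrib_left algebra_simps)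
  finally show "vol (Suc m) p f (parallel_body (Suc m) f (T + seg (s *\<^sub>R f m)) r) =
      (\<Sum>k\<le>Suc m. unit_ball_vol (real (Suc m - k)) * (V k + (case k of 0 \<Rightarrow> 0 | Suc i \<Rightarrow> 2 * s * V' i)) * r ^ (Suc m - k))"
    by (simp only: distrib_left distrib_right sum.distrib)
next
  fix k assume "k > Suc m"
  then show "V k + (case k of 0 \<Rightarrow> 0 | Suc i \<Rightarrow> 2 * s * V' i) = 0"
    using V V' by (auto simp: steiner_def split: nat.split)
qed

text \<open>The recursion that the segment formula imposes on the intrinsic volumes of a zonotope. Unfolded, it
reads \<open>2\<^sup>k\<close> times the sum, over all \<open>k\<close>-element subfamilies of \<open>zs\<close>, of the volume of the parallelotope
that they span, computed by successive orthogonal projection.\<close>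

fun zono_vol :: "nat \<Rightarrow> 'a::real_inner list \<Rightarrow> real" where
  "zono_vol 0 zs = 1"
| "zono_vol (Suc k) [] = 0"
| "zono_vol (Suc k) (z # zs) = zono_vol (Suc k) zs + 2 * norm z * zono_vol k (map (perp z) zs)"

lemma vol_span_ball:
  assumes e: "orthonormal_family n e" and r: "r \<ge> 0"
  shows "vol n 0 e (span_ball n e r) = unit_ball_vol (real n) * r ^ n"
proof -
  have eq: "evol n 0 e (span_ball n e r) = evol n 0 e (cball 0 r)"
    by (rule evol_cong_on_chart) (simp add: span_ball_def)
  have *: "evol n 0 e (span_ball n e r) = ennreal (unit_ball_vol (real n) * r ^ n)"
  proof (cases "r = 0 \<and> n \<noteq> 0")
    case True
    have "span (e ` {..<n}) \<noteq> {0}"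
    proof
      assume sp: "span (e ` {..<n}) = {0}"
      have "dim {0::'a} = dim ({} :: 'a set)"
        by (rule span_eq_dim) simp
      then show False
        using True orthonormal_family_dim[OF e] dim_eq_card_independent[OF independent_empty, where 'a = 'a]
        unfolding sp by simp
    qed
    then have "evol n 0 e {0} = 0"
      by (intro evol_lower_dimensional[OF e, of "{0}" "{0}" 0]) (auto simp: span_zero subspace_0)
    then show ?thesis using True eq by simp
  next
    case False
    show ?thesis
    proof (cases "r = 0")
      case True
      then have n: "n = 0" using False by simp
      have "evol n 0 e (cball 0 r) = evol n 0 e (cball 0 1)"
        unfolding n by (rule evol_cong_on_chart) (use r in auto)
      then show ?thesis using chart_integral_cball[OF e, of 1 0] eq n by simp
    next
      case False
      then show ?thesis using eq chart_integral_cball[OF e, of r 0] r by simp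
    qed
  qed
  then show ?thesis
    using r by (simp add: vol_compact[OF e compact_span_ball[OF e]])
qed

text \<open>Induction is on the number of generators and not on the list, since the recursion passes to the
projections of the remaining generators.\<close>

lemma steiner_zono:
  assumes "orthonormal_family n e" "set zs \<subseteq> span (e ` {..<n})"
  shows "steiner n 0 e (zono zs) (\<lambda>k. zono_vol k zs)"
  using assms
proof (induction "length zs" arbitrary: n e zs)
  case 0
  then have [simp]: "zs = []" by simp
  have z: "zono_vol k [] = (if k = 0 then 1 else 0)" for k by (cases k) auto
  have "(\<Sum>k\<le>n. unit_ball_vol (real (n - k)) * (if k = 0 then 1 else 0) * r ^ (n - k))
      = unit_ball_vol (real n) * r ^ n" for r
    by (simp add: if_distrib[where f = "\<lambda>x. _ * x * _"] cong: if_cong)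
  then show ?case
    using vol_span_ball[OF 0(2)] by (auto simp: steiner_def parallel_body_eq z)
next
  case (Suc l zzs)
  obtain z zs where zzs: "zzs = z # zs" and l: "l = length zs"
    using Suc.hyps(2) by (cases zzs) auto
  note e = Suc.prems(1)
  have zs: "set zs \<subseteq> span (e ` {..<n})" and z: "z \<in> span (e ` {..<n})"
    using Suc.prems(2) by (auto simp: zzs)
  have IH: "steiner n 0 e (zono zs) (\<lambda>k. zono_vol k zs)" by (rule Suc.hyps(1)[OF l e zs])
  show ?case
  proof (cases "z = 0")
    case True
    have "zono_vol k (z # zs) = zono_vol k zs" for k using True by (cases k) auto
    then show ?thesis using True IH by (simp add: zzs)
  next
    case False
    then obtain m f where f: "n = Suc m" "orthonormal_family (Suc m) f" "orthonormal_family m f" "z = norm z *\<^sub>R f m"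
      "span (f ` {..<Suc m}) = span (e ` {..<n})" "perp z = perp (f m)"
      using adapted_chart[OF e z] by metis
    have "set (map (perp z) zs) \<subseteq> span (f ` {..<m})"
      using perp_in_span[OF f(2)] zs f(5,6) by auto
    from Suc.hyps(1)[OF _ f(3) this] l
    have V': "steiner m 0 f (zono (map (perp z) zs)) (\<lambda>k. zono_vol k (map (perp z) zs))"
      by simp
    have V: "steiner (Suc m) 0 f (zono zs) (\<lambda>k. zono_vol k zs)"
      by (rule steiner_cong_chart[OF compact_zono e f(2) f(5)[symmetric] _ IH]) (simp add: span_zero)
    have "steiner (Suc m) 0 f (zono zs + seg (norm z *\<^sub>R f m))
      (\<lambda>k. zono_vol k zs + (case k of 0 \<Rightarrow> 0 | Suc i \<Rightarrow> 2 * norm z * zono_vol i (map (perp z) zs)))"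
      using V V' f(6) by (intro steiner_add_segment[OF f(2) compact_zono convex_zono])
        (auto simp: linear_image_zono linear_perp)
    moreover have "zono zs + seg (norm z *\<^sub>R f m) = zono (z # zs)"
      using f(4) by (simp add: add.commute)
    moreover have "zono_vol k (z # zs) = zono_vol k zs + (case k of 0 \<Rightarrow> 0 | Suc i \<Rightarrow> 2 * norm z * zono_vol i (map (perp z) zs))" for k
      by (cases k) auto
    ultimately have st: "steiner (Suc m) 0 f (zono (z # zs)) (\<lambda>k. zono_vol k (z # zs))" by simp
    show ?thesis unfolding zzs
      by (rule steiner_cong_chart[OF compact_zono f(2) e f(5) _ st]) (simp add: span_zero)
  qed
qed

section \<open>Approximating the ball by zonotopes\<close>

text \<open>The support function of the zonotope.\<close>

definition zono_support :: "'a::real_inner list \<Rightarrow> 'a \<Rightarrow> real" where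
  "zono_support zs u = (\<Sum>z\<leftarrow>zs. \<bar>z \<bullet> u\<bar>)"

lemma zono_inner_le: "y \<in> zono zs \<Longrightarrow> y \<bullet> u \<le> zono_support zs u"
proof (induction zs arbitrary: y)
  case (Cons z zs)
  from Cons.prems obtain s x where "s \<in> seg z" "x \<in> zono zs" "y = s + x"
    unfolding zono.simps by (rule set_plus_elim)
  then obtain t where x: "x \<in> zono zs" "y = t *\<^sub>R z + x" "-1 \<le> t" "t \<le> 1"
    unfolding seg_def by (metis (no_types, lifting) atLeastAtMost_iff imageE)
  have "t * (z \<bullet> u) \<le> \<bar>t\<bar> * \<bar>z \<bullet> u\<bar>" by (simp flip: abs_mult)
  also have "\<dots> \<le> 1 * \<bar>z \<bullet> u\<bar>" using x by (intro mult_right_mono) auto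
  finally show ?case using Cons.IH[OF x(1)] x by (simp add: inner_add_left zono_support_def)
qed (simp add: zono_support_def)

lemma zono_support_attained: "\<exists>y\<in>zono zs. y \<bullet> u = zono_support zs u"
proof (induction zs)
  case (Cons z zs)
  then obtain y where y: "y \<in> zono zs" "y \<bullet> u = zono_support zs u" by blast
  have "sgn (z \<bullet> u) *\<^sub>R z \<in> seg z" unfolding seg_def by (intro imageI) (auto simp: sgn_if)
  then have "sgn (z \<bullet> u) *\<^sub>R z + y \<in> zono (z # zs)" using y by (simp add: set_plus_intro)
  moreover have "(sgn (z \<bullet> u) *\<^sub>R z + y) \<bullet> u = zono_support (z # zs) u"
    using y by (simp add: inner_add_left zono_support_def sgn_if abs_if)
  ultimately show ?case by blast
qed (simp add: zono_support_def)

lemma zono_subset_span_ball: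
  assumes zs: "set zs \<subseteq> span (e ` {..<n})" and R: "R \<ge> 0"
    and h: "\<And>u. u \<in> span (e ` {..<n}) \<Longrightarrow> zono_support zs u \<le> R * norm u"
  shows "zono zs \<subseteq> span_ball n e R"
proof
  fix y assume y: "y \<in> zono zs"
  then have ys: "y \<in> span (e ` {..<n})"
    using zono_subset_span[of zs] zs span_minimal[OF zs subspace_span] by auto
  have "norm y * norm y \<le> R * norm y"
    using zono_inner_le[OF y, of y] h[OF ys] by (simp flip: power2_eq_square add: power2_norm_eq_inner)
  then have "norm y \<le> R" using R by (cases "y = 0") auto
  then show "y \<in> span_ball n e R" using ys by (simp add: span_ball_def)
qed

text \<open>A point outside the zonotope is separated from it by the hyperplane through the closest point of the
zonotope, which exists because the zonotope is compact.\<close>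

lemma span_ball_subset_zono:
  assumes zs: "set zs \<subseteq> span (e ` {..<n})"
    and h: "\<And>u. u \<in> span (e ` {..<n}) \<Longrightarrow> R * norm u \<le> zono_support zs u"
  shows "span_ball n e R \<subseteq> zono zs"
proof (rule ccontr)
  assume "\<not> span_ball n e R \<subseteq> zono zs"
  then obtain y where y: "y \<in> span (e ` {..<n})" "norm y \<le> R" "y \<notin> zono zs"
    by (auto simp: span_ball_def)
  have ne: "zono zs \<noteq> {}" using zono_support_attained[of zs 0] by auto
  obtain z0 where z0: "z0 \<in> zono zs" "\<And>z. z \<in> zono zs \<Longrightarrow> dist y z0 \<le> dist y z"
    using continuous_attains_inf[OF compact_zono ne, of "dist y"] continuous_on_dist[OF continuous_on_const continuous_on_id]
    by blast
  define w where "w = y - z0"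
  have w0: "w \<noteq> 0" using z0 y by (auto simp: w_def)
  have "z0 \<in> span (e ` {..<n})"
    using z0(1) zono_subset_span[of zs] span_minimal[OF zs subspace_span] by auto
  then have ws: "w \<in> span (e ` {..<n})" using y by (simp add: w_def span_diff)
  obtain z where z: "z \<in> zono zs" "z \<bullet> w = zono_support zs w" using zono_support_attained by blast
  have "w \<bullet> (z - z0) \<le> 0"
    unfolding w_def using z0 z(1) compact_zono[of zs] convex_zono[of zs]
    by (intro any_closest_point_dot[of "zono zs"]) (auto simp: compact_imp_closed)
  then have "zono_support zs w \<le> z0 \<bullet> w" using z by (simp add: inner_diff_right inner_commute)
  also have "z0 \<bullet> w = y \<bullet> w - w \<bullet> w" by (simp add: w_def inner_diff_left)
  also have "\<dots> < y \<bullet> w" using w0 by simp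
  also have "\<dots> \<le> norm y * norm w" by (rule norm_cauchy_schwarz)
  also have "\<dots> \<le> R * norm w" using y by (intro mult_right_mono) auto
  also have "\<dots> \<le> zono_support zs w" by (rule h[OF ws])
  finally show False by simp
qed

lemma evol_unit_ball:
  assumes "orthonormal_family n e"
  shows "evol n 0 e (span_ball n e 1) = ennreal (unit_ball_vol (real n))"
proof -
  have "evol n 0 e (span_ball n e 1) = evol n 0 e (cball 0 1)"
    by (rule evol_cong_on_chart) (simp add: span_ball_def)
  then show ?thesis using chart_integral_cball[OF assms, of 1 0] by simp
qed

definition coord_ball :: "nat \<Rightarrow> (nat \<Rightarrow> real) set" where
  "coord_ball n = {x \<in> space (coords n). (\<Sum>i<n. (x i)\<^sup>2) \<le> 1}"

lemma sets_coord_ball [measurable]: "coord_ball n \<in> sets (coords n)"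
  unfolding coord_ball_def by measurable

lemma emeasure_coord_ball: "emeasure (coords n) (coord_ball n) = ennreal (unit_ball_vol (real n))"
proof -
  have "coord_ball n = {x. sqrt (\<Sum>i\<in>{..<n}. (x i)\<^sup>2) \<le> 1} \<inter> space (coords n)"
    by (auto simp: coord_ball_def real_sqrt_le_1_iff)
  then show ?thesis using emeasure_cball_aux[of "{..<n}" 1] by simp
qed

lemma measure_coord_ball: "measure (coords n) (coord_ball n) = unit_ball_vol (real n)"
  by (simp add: measure_def emeasure_coord_ball)

lemma norm_affine_chart:
  "orthonormal_family n e \<Longrightarrow> norm (affine_chart n 0 e x) = sqrt (\<Sum>i<n. (x i)\<^sup>2)"
  by (simp add: affine_chart_def norm_sum_orthonormal)

lemma integrable_indicator_coord_ball:
  "integrable (coords n) (\<lambda>x. c * indicator (coord_ball n) x :: real)"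
  by (intro integrable_mult_right integrable_real_indicator) (auto simp: emeasure_coord_ball)

text \<open>The support function of the zonoid \<open>\<integral> [-x, x] dx\<close>, the integral being over the unit ball of the span.
By rotation invariance this zonoid is again a ball, and its Riemann sums are zonotopes that
approximate a ball.\<close>

definition ball_moment :: "nat \<Rightarrow> (nat \<Rightarrow> 'a::real_inner) \<Rightarrow> 'a \<Rightarrow> real" where
  "ball_moment n e u = (\<integral>x. indicator (coord_ball n) x * \<bar>affine_chart n 0 e x \<bullet> u\<bar> \<partial>coords n)"

lemma measurable_chart_inner: "(\<lambda>x. affine_chart n 0 e x \<bullet> u) \<in> borel_measurable (coords n)"
  unfolding affine_chart_def inner_add_left inner_sum_left inner_scaleR_left by measurable

lemma chart_inner_le:
  assumes "orthonormal_family n e" "x \<in> coord_ball n"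
  shows "\<bar>affine_chart n 0 e x \<bullet> u\<bar> \<le> norm u"
proof -
  have "norm (affine_chart n 0 e x) \<le> 1"
    using assms by (simp add: norm_affine_chart coord_ball_def real_sqrt_le_1_iff)
  then show ?thesis
    using Cauchy_Schwarz_ineq2[of "affine_chart n 0 e x" u]
      mult_right_mono[of "norm (affine_chart n 0 e x)" 1 "norm u"] by simp
qed

lemma integrable_ball_moment:
  assumes "orthonormal_family n e"
  shows "integrable (coords n) (\<lambda>x. indicator (coord_ball n) x * \<bar>affine_chart n 0 e x \<bullet> u\<bar> :: real)"
proof (rule Bochner_Integration.integrable_bound[OF integrable_indicator_coord_ball[of n "norm u"]])
  show "(\<lambda>x. indicator (coord_ball n) x * \<bar>affine_chart n 0 e x \<bullet> u\<bar> :: real) \<in> borel_measurable (coords n)"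
    using measurable_chart_inner[of n e u] by measurable
  show "AE x in coords n. norm (indicator (coord_ball n) x * \<bar>affine_chart n 0 e x \<bullet> u\<bar> :: real)
      \<le> norm (norm u * indicator (coord_ball n) x :: real)"
    using chart_inner_le[OF assms] by (intro AE_I2) (auto simp: indicator_def)
qed

lemma ball_moment_unit:
  assumes e: "orthonormal_family (Suc m) e" and u: "u \<in> span (e ` {..<Suc m})" "norm u = 1"
  shows "ball_moment (Suc m) e u
    = enn2real (\<integral>\<^sup>+ x. indicator {x. sqrt (\<Sum>i<Suc m. (x i)\<^sup>2) \<le> 1} x * ennreal \<bar>x m\<bar> \<partial>coords (Suc m))"
proof -
  define G where "G v = indicator (cball 0 1) v * ennreal \<bar>v \<bullet> u\<bar>" for v :: 'a
  have G: "G \<in> borel_measurable borel"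
  proof -
    have "(\<lambda>v::'a. v \<bullet> u) \<in> borel_measurable borel"
      by (intro borel_measurable_continuous_onI continuous_intros)
    moreover have "(indicator (cball 0 1) :: 'a \<Rightarrow> ennreal) \<in> borel_measurable borel"
      by (intro borel_measurable_indicator borel_closed closed_cball)
    ultimately show ?thesis unfolding G_def by measurable
  qed
  obtain m' f where f': "Suc m = Suc m'" "orthonormal_family (Suc m') f" "f m' = u"
    "span (f ` {..<Suc m'}) = span (e ` {..<Suc m})"
    using orthonormal_family_last[OF e u] by metis
  then have f: "orthonormal_family (Suc m) f" "f m = u" "span (f ` {..<Suc m}) = span (e ` {..<Suc m})"
    by auto
  have "ball_moment (Suc m) e u
      = enn2real (\<integral>\<^sup>+ x. ennreal (indicator (coord_ball (Suc m)) x * \<bar>affine_chart (Suc m) 0 e x \<bullet> u\<bar>) \<partial>coords (Suc m))"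
    unfolding ball_moment_def
    by (rule integral_eq_nn_integral) (use integrable_ball_moment[OF e, of u] in auto)
  also have "(\<integral>\<^sup>+ x. ennreal (indicator (coord_ball (Suc m)) x * \<bar>affine_chart (Suc m) 0 e x \<bullet> u\<bar>) \<partial>coords (Suc m))
      = chart_integral (Suc m) 0 e G"
    unfolding chart_integral_def G_def
    by (intro nn_integral_cong)
      (auto simp: indicator_def coord_ball_def norm_affine_chart[OF e] real_sqrt_le_1_iff)
  also have "\<dots> = chart_integral (Suc m) 0 f G"
    using f by (intro chart_integral_eq_of_span_eq[OF G e f(1)]) (auto simp: span_zero)
  also have "\<dots> = (\<integral>\<^sup>+ x. indicator {x. sqrt (\<Sum>i<Suc m. (x i)\<^sup>2) \<le> 1} x * ennreal \<bar>x m\<bar> \<partial>coords (Suc m))"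
  proof -
    have "affine_chart (Suc m) 0 f x \<bullet> u = x m" for x
      using orthonormal_inner_sum[OF f(1), of m x] f(2) by (simp add: affine_chart_def)
    then show ?thesis
      unfolding chart_integral_def G_def
      by (intro nn_integral_cong) (simp add: indicator_def norm_affine_chart[OF f(1)])
  qed
  finally show ?thesis .
qed

lemma ball_moment_scale: "ball_moment n e (r *\<^sub>R u) = \<bar>r\<bar> * ball_moment n e u"
  unfolding ball_moment_def by (simp add: abs_mult mult.left_commute flip: integral_mult_right_zero)

text \<open>By chart invariance the moment is the same for all unit vectors. It is positive, since otherwise the
unit ball would be contained, up to a null set, in a hyperplane.\<close>

lemma ball_moment_proportional:
  assumes e: "orthonormal_family n e" and n: "n > 0"
  obtains c where "c > 0" "\<And>u. u \<in> span (e ` {..<n}) \<Longrightarrow> ball_moment n e u = c * norm u"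
proof -
  obtain m where m: "n = Suc m" using n by (cases n) auto
  define c where "c = enn2real (\<integral>\<^sup>+ x. indicator {x. sqrt (\<Sum>i<Suc m. (x i)\<^sup>2) \<le> 1} x * ennreal \<bar>x m\<bar> \<partial>coords (Suc m))"
  have unit: "ball_moment n e u = c" if "u \<in> span (e ` {..<n})" "norm u = 1" for u
    using ball_moment_unit[of m e u] that e by (simp add: m c_def)
  have proportional: "ball_moment n e u = c * norm u" if u: "u \<in> span (e ` {..<n})" for u
  proof (cases "u = 0")
    case True
    then show ?thesis using ball_moment_scale[of n e 0 0] by simp
  next
    case False
    have "ball_moment n e (norm u *\<^sub>R (inverse (norm u) *\<^sub>R u)) = norm u * ball_moment n e (inverse (norm u) *\<^sub>R u)"
      unfolding ball_moment_scale by simp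
    moreover have "ball_moment n e (inverse (norm u) *\<^sub>R u) = c"
      using False u by (intro unit) (auto intro: span_scale)
    ultimately show ?thesis using False by simp
  qed
  have "c \<noteq> 0"
  proof
    assume c0: "c = 0"
    define u where "u = e m"
    have u: "u \<in> span (e ` {..<n})" "norm u = 1"
      using e by (auto simp: u_def m orthonormal_family_def norm_eq_1 intro: span_base)
    let ?C = "span_ball n e 1 \<inter> {v. v \<bullet> u = 0}"
    have "(\<integral>x. indicator (coord_ball n) x * \<bar>affine_chart n 0 e x \<bullet> u\<bar> \<partial>coords n) = 0"
      using unit[OF u] c0 by (simp add: ball_moment_def)
    then have ae: "AE x in coords n. indicator (coord_ball n) x * \<bar>affine_chart n 0 e x \<bullet> u\<bar> = (0::real)"
      by (subst (asm) integral_nonneg_eq_0_iff_AE[OF integrable_ball_moment[OF e]]) auto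
    have "evol n 0 e (span_ball n e 1) = evol n 0 e ?C"
      unfolding chart_integral_def
    proof (rule nn_integral_cong_AE)
      from ae AE_space show "AE x in coords n. indicator (span_ball n e 1) (affine_chart n 0 e x) =
          (indicator ?C (affine_chart n 0 e x) :: ennreal)"
      proof eventually_elim
        case (elim x)
        then show ?case
          by (auto simp: indicator_def span_ball_def coord_ball_def norm_affine_chart[OF e] real_sqrt_le_1_iff split: if_splits)
      qed
    qed
    also have "evol n 0 e ?C = 0"
    proof (rule evol_lower_dimensional[OF e])
      have "closed {v. v \<bullet> u = 0}"
        by (intro closed_Collect_eq continuous_intros)
      then show "?C \<in> sets borel"
        using compact_span_ball[OF e] by (intro borel_compact compact_Int_closed)
      let ?W = "{v \<in> span (e ` {..<n}). v \<bullet> u = 0}"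
      show "?W \<subseteq> span (e ` {..<n})" by auto
      show "subspace ?W"
        by (auto simp: subspace_def span_zero inner_add_left intro: span_add span_scale)
      have "u \<notin> ?W" using u by (auto simp: norm_eq_1)
      then show "?W \<noteq> span (e ` {..<n})" using u by blast
      show "?C \<subseteq> (+) 0 ` ?W" by (auto simp: span_ball_def)
      show "0 - 0 \<in> span (e ` {..<n})" by (simp add: span_zero)
    qed
    finally show False
      using unit_ball_vol_pos[of "real n"] by (simp add: evol_unit_ball[OF e] del: unit_ball_vol_pos)
  qed
  moreover have "c \<ge> 0" by (simp add: c_def)
  ultimately have "c > 0" by simp
  then show thesis using that proportional by blast
qed

text \<open>Rounding the coordinates to multiples of \<open>1 / M\<close> turns the integral over the ball into a finite sum, the
support function of a zonotope, and changes the integrand by at most \<open>n / M\<close> times the norm of \<open>u\<close>.\<close>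

lemma zono_support_approximates_ball_moment:
  assumes e: "orthonormal_family n e" and M: "M > (0::nat)"
  obtains zs where "set zs \<subseteq> span (e ` {..<n})"
    "\<And>u. \<bar>zono_support zs u - ball_moment n e u\<bar> \<le> unit_ball_vol (real n) * (real n / real M) * norm u"
proof -
  let ?\<mu> = "coords n" and ?B = "coord_ball n"
  define grid where "grid x = (\<lambda>i\<in>{..<n}. real_of_int \<lfloor>real M * x i\<rfloor> / real M)" for x :: "nat \<Rightarrow> real"
  define G where "G = grid ` ?B"
  define C where "C g = {x \<in> ?B. grid x = g}" for g
  have xi: "\<bar>x i\<bar> \<le> 1" if "x \<in> ?B" "i < n" for x i
  proof -
    have "(x i)\<^sup>2 \<le> (\<Sum>i<n. (x i)\<^sup>2)" using that by (intro member_le_sum) auto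
    also have "\<dots> \<le> 1" using that by (simp add: coord_ball_def)
    finally show ?thesis by (simp add: abs_square_le_1)
  qed
  have "G \<subseteq> PiE {..<n} (\<lambda>_. (\<lambda>k. real_of_int k / real M) ` {- int M..int M})"
  proof
    fix g assume "g \<in> G"
    then obtain x where x: "x \<in> ?B" "g = grid x" by (auto simp: G_def)
    have "\<lfloor>real M * x i\<rfloor> \<in> {- int M..int M}" if "i < n" for i
    proof -
      have "- 1 \<le> x i" "x i \<le> 1" using xi[OF x(1) that] by (auto simp: abs_le_iff)
      then have "real M * (-1) \<le> real M * x i" "real M * x i \<le> real M * 1" by (intro mult_left_mono; simp)+
      then show ?thesis by (simp add: le_floor_iff floor_le_iff)
    qed
    then show "g \<in> PiE {..<n} (\<lambda>_. (\<lambda>k. real_of_int k / real M) ` {- int M..int M})"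
      using x by (auto simp: grid_def)
  qed
  then have finG: "finite G" by (rule finite_subset) (intro finite_PiE, auto)
  have Csets: "C g \<in> sets ?\<mu>" if g: "g \<in> G" for g
  proof -
    have "C g = ?B \<inter> {x \<in> space ?\<mu>. \<forall>i\<in>{..<n}. real_of_int \<lfloor>real M * x i\<rfloor> / real M = g i}"
      using g unfolding C_def G_def by (auto simp: grid_def fun_eq_iff coord_ball_def)
    moreover have "{x \<in> space ?\<mu>. \<forall>i\<in>{..<n}. real_of_int \<lfloor>real M * x i\<rfloor> / real M = g i} \<in> sets ?\<mu>"
      by measurable
    ultimately show ?thesis by simp
  qed
  have Cfin: "emeasure ?\<mu> (C g) < \<infinity>" for g
  proof -
    have "emeasure ?\<mu> (C g) \<le> emeasure ?\<mu> ?B" by (intro emeasure_mono) (auto simp: C_def)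
    then show ?thesis by (simp add: emeasure_coord_ball order_le_less_trans)
  qed
  obtain gl where gl: "set gl = G" "distinct gl" using finite_distinct_list[OF finG] by blast
  define zs where "zs = map (\<lambda>g. measure ?\<mu> (C g) *\<^sub>R affine_chart n 0 e g) gl"
  have "set zs \<subseteq> span (e ` {..<n})"
    using affine_chart_in_span[of n e] by (auto simp: zs_def intro: span_scale)
  moreover have "\<bar>zono_support zs u - ball_moment n e u\<bar> \<le> unit_ball_vol (real n) * (real n / real M) * norm u" for u
  proof -
    let ?F = "\<lambda>x. \<bar>affine_chart n 0 e x \<bullet> u\<bar>"
    have int: "integrable ?\<mu> (\<lambda>x. indicator (C g) x * ?F g :: real)" if "g \<in> G" for g
      using Csets[OF that] Cfin[of g] by (intro integrable_mult_left integrable_real_indicator) auto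
    have pt: "(\<Sum>g\<in>G. indicator (C g) x * ?F g) = (indicator ?B x * ?F (grid x) :: real)" for x
    proof (cases "x \<in> ?B")
      case True
      then have gx: "grid x \<in> G" by (simp add: G_def)
      have "(\<Sum>g\<in>G. indicator (C g) x * ?F g) = (\<Sum>g\<in>G. if g = grid x then ?F (grid x) else 0)"
        using True by (intro sum.cong) (auto simp: C_def indicator_def)
      then show ?thesis using gx finG True by simp
    qed (auto simp: C_def)
    have "zono_support zs u = (\<Sum>g\<leftarrow>gl. measure ?\<mu> (C g) * ?F g)"
      by (simp add: zono_support_def zs_def comp_def abs_mult)
    also have "\<dots> = (\<Sum>g\<in>G. measure ?\<mu> (C g) * ?F g)"
      using gl by (simp add: sum_list_distinct_conv_sum_set)
    also have "\<dots> = (\<Sum>g\<in>G. \<integral>x. indicator (C g) x * ?F g \<partial>?\<mu>)"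
      using Csets by (intro sum.cong) auto
    also have "\<dots> = (\<integral>x. (\<Sum>g\<in>G. indicator (C g) x * ?F g) \<partial>?\<mu>)"
      using int by (intro Bochner_Integration.integral_sum[symmetric]) auto
    finally have h: "zono_support zs u = (\<integral>x. indicator ?B x * ?F (grid x) \<partial>?\<mu>)"
      unfolding pt .
    have ig: "integrable ?\<mu> (\<lambda>x. indicator ?B x * ?F (grid x) :: real)"
      unfolding pt[symmetric] using int by (intro Bochner_Integration.integrable_sum) auto
    have close: "\<bar>?F (grid x) - ?F x\<bar> \<le> (real n / real M) * norm u" for x
    proof -
      have "\<bar>?F (grid x) - ?F x\<bar> \<le> \<bar>(affine_chart n 0 e (grid x) - affine_chart n 0 e x) \<bullet> u\<bar>"
        by (simp add: inner_diff_left)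
      also have "\<dots> \<le> norm (affine_chart n 0 e (grid x) - affine_chart n 0 e x) * norm u"
        by (rule Cauchy_Schwarz_ineq2)
      also have "norm (affine_chart n 0 e (grid x) - affine_chart n 0 e x) = norm (\<Sum>i<n. (grid x i - x i) *\<^sub>R e i)"
        by (simp add: affine_chart_def scaleR_diff_left sum_subtractf)
      also have "\<dots> \<le> (\<Sum>i<n. 1 / real M)"
      proof (rule sum_norm_le)
        fix i assume i: "i \<in> {..<n}"
        then have ne: "norm (e i) = 1" using e by (simp add: orthonormal_family_def norm_eq_1)
        have "\<bar>real_of_int \<lfloor>real M * x i\<rfloor> - real M * x i\<bar> \<le> 1" by linarith
        then have "\<bar>real_of_int \<lfloor>real M * x i\<rfloor> - real M * x i\<bar> / real M \<le> 1 / real M"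
          by (intro divide_right_mono) auto
        also have "\<bar>real_of_int \<lfloor>real M * x i\<rfloor> - real M * x i\<bar> / real M = \<bar>grid x i - x i\<bar>"
          using M i by (simp add: grid_def abs_if field_simps)
        finally show "norm ((grid x i - x i) *\<^sub>R e i) \<le> 1 / real M" using ne by simp
      qed
      finally show ?thesis by (simp add: mult_right_mono)
    qed
    have "\<bar>zono_support zs u - ball_moment n e u\<bar>
        = norm (\<integral>x. indicator ?B x * ?F (grid x) - indicator ?B x * ?F x \<partial>?\<mu>)"
      unfolding h ball_moment_def
      by (subst Bochner_Integration.integral_diff[OF ig integrable_ball_moment[OF e]]) simp
    also have "\<dots> \<le> (\<integral>x. ((real n / real M) * norm u) * indicator ?B x \<partial>?\<mu>)"
    proof (rule order_trans[OF integral_norm_bound], rule integral_mono)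
      show "integrable ?\<mu> (\<lambda>x. norm (indicator ?B x * ?F (grid x) - indicator ?B x * ?F x))"
        by (intro integrable_norm Bochner_Integration.integrable_diff ig integrable_ball_moment[OF e])
      show "integrable ?\<mu> (\<lambda>x. ((real n / real M) * norm u) * indicator ?B x :: real)"
        by (rule integrable_indicator_coord_ball)
      show "norm (indicator ?B x * ?F (grid x) - indicator ?B x * ?F x) \<le> ((real n / real M) * norm u) * indicator ?B x" for x
        using close[of x] by (cases "x \<in> ?B") auto
    qed
    also have "\<dots> = unit_ball_vol (real n) * (real n / real M) * norm u"
      by (simp add: measure_coord_ball)
    finally show ?thesis .
  qed
  ultimately show thesis using that by blast
qed

lemma zono_approximates_ball:
  assumes e: "orthonormal_family n e" and d: "d > 0"
  obtains zs where "set zs \<subseteq> span (e ` {..<n})" "span_ball n e 1 \<subseteq> zono zs" "zono zs \<subseteq> span_ball n e (1 + d)"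
proof (cases "n = 0")
  case True
  then have "span_ball n e r = {0}" if "r \<ge> 0" for r using that by (auto simp: span_ball_def)
  then show thesis using that[of "[]"] d by simp
next
  case False
  then obtain c where c: "c > 0" "\<And>u. u \<in> span (e ` {..<n}) \<Longrightarrow> ball_moment n e u = c * norm u"
    using ball_moment_proportional[OF e] by auto
  define \<kappa> where "\<kappa> = unit_ball_vol (real n) * real n"
  \<comment> \<open>Chosen so that \<open>(1 + t) / (1 - t) = 1 + d\<close>.\<close>
  define t where "t = d / (2 + d)"
  have t: "0 < t" "t < 1" using d by (auto simp: t_def)
  obtain M :: nat where M: "\<kappa> / (c * t) < real M" using reals_Archimedean2 by blast
  have k0: "0 < \<kappa>" using False by (simp add: \<kappa>_def)
  then have "0 < \<kappa> / (c * t)" using c t by simp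
  then have M0: "M > 0" using M by (cases M) auto
  have \<eta>: "\<kappa> / real M \<le> c * t" using M M0 c t by (simp add: field_simps)
  obtain zs where zs: "set zs \<subseteq> span (e ` {..<n})"
    "\<And>u. \<bar>zono_support zs u - ball_moment n e u\<bar> \<le> unit_ball_vol (real n) * (real n / real M) * norm u"
    using zono_support_approximates_ball_moment[OF e M0] by blast
  have b: "\<bar>zono_support zs u - c * norm u\<bar> \<le> c * t * norm u" if "u \<in> span (e ` {..<n})" for u
  proof -
    have "\<bar>zono_support zs u - c * norm u\<bar> \<le> (\<kappa> / real M) * norm u"
      using zs(2)[of u] c(2)[OF that] by (simp add: \<kappa>_def)
    also have "\<dots> \<le> c * t * norm u" using \<eta> by (intro mult_right_mono) auto
    finally show ?thesis .
  qed
  define s where "s = 1 / (c * (1 - t))"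
  have s: "s > 0" using c t by (simp add: s_def)
  have sup: "zono_support (map ((*\<^sub>R) s) zs) u = s * zono_support zs u" for u
    using s by (simp add: zono_support_def comp_def abs_mult sum_list_const_mult)
  have sub: "set (map ((*\<^sub>R) s) zs) \<subseteq> span (e ` {..<n})" using zs(1) by (auto intro: span_scale)
  have "span_ball n e 1 \<subseteq> zono (map ((*\<^sub>R) s) zs)"
  proof (rule span_ball_subset_zono[OF sub])
    fix u assume "u \<in> span (e ` {..<n})"
    then have "c * (1 - t) * norm u \<le> zono_support zs u" using b[of u] by (simp add: abs_le_iff algebra_simps)
    then have "s * (c * (1 - t) * norm u) \<le> s * zono_support zs u" using s by (intro mult_left_mono) auto
    then show "1 * norm u \<le> zono_support (map ((*\<^sub>R) s) zs) u" using c t unfolding sup by (simp add: s_def)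
  qed
  moreover have "zono (map ((*\<^sub>R) s) zs) \<subseteq> span_ball n e (1 + d)"
  proof (rule zono_subset_span_ball[OF sub])
    fix u assume "u \<in> span (e ` {..<n})"
    then have "zono_support zs u \<le> c * (1 + t) * norm u" using b[of u] by (simp add: abs_le_iff algebra_simps)
    then have "s * zono_support zs u \<le> s * (c * (1 + t) * norm u)" using s by (intro mult_left_mono) auto
    also have "\<dots> = ((1 + t) / (1 - t)) * norm u" using c t by (simp add: s_def)
    also have "(1 + t) / (1 - t) = 1 + d" using d by (simp add: t_def field_simps)
    finally show "zono_support (map ((*\<^sub>R) s) zs) u \<le> (1 + d) * norm u" by (simp add: sup)
  qed (use d in simp)
  ultimately show thesis using that sub by blast
qed

section \<open>Existence of intrinsic volumes\<close>

lemma bounded_coordinates_convergent_subseq: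
  fixes x :: "nat \<Rightarrow> nat \<Rightarrow> 'a::heine_borel"
  assumes "\<And>j. j < K \<Longrightarrow> bounded (range (\<lambda>N. x N j))"
  obtains s l where "strict_mono s" "\<And>j. j < K \<Longrightarrow> (\<lambda>N. x (s N) j) \<longlonglongrightarrow> l j"
proof -
  have "\<exists>s l. strict_mono s \<and> (\<forall>j<K. (\<lambda>N. x (s N) j) \<longlonglongrightarrow> l j)"
    using assms
  proof (induction K)
    case 0
    then show ?case using strict_mono_id by blast
  next
    case (Suc K)
    then obtain s l where s: "strict_mono (s :: nat \<Rightarrow> nat)" "\<forall>j<K. (\<lambda>N. x (s N) j) \<longlonglongrightarrow> l j" by force
    have "bounded (range (\<lambda>N. x (s N) K))"
      using Suc.prems[of K] by (rule bounded_subset) auto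
    then obtain a r where r: "strict_mono (r :: nat \<Rightarrow> nat)" "((\<lambda>N. x (s N) K) \<circ> r) \<longlonglongrightarrow> a"
      using bounded_imp_convergent_subsequence by blast
    have "(\<lambda>N. x ((s \<circ> r) N) j) \<longlonglongrightarrow> (l(K := a)) j" if "j < Suc K" for j
    proof (cases "j = K")
      case True
      then show ?thesis using r(2) by (simp add: comp_def)
    next
      case False
      then have "(\<lambda>N. x (s N) j) \<longlonglongrightarrow> l j" using s that by auto
      from LIMSEQ_subseq_LIMSEQ[OF this r(1)] show ?thesis using False by (simp add: comp_def)
    qed
    then show ?case using strict_mono_o[OF s(1) r(1)] by blast
  qed
  then show thesis using that by blast
qed

text \<open>Steiner's formula, with coefficients that increase with the body. The ball is replaced by zonotopes
\<open>Z\<^sub>N\<close> with \<open>B \<subseteq> Z\<^sub>N \<subseteq> (1 + d\<^sub>N) B\<close>, where \<open>d\<^sub>N\<close> tends to zero. The volume of \<open>T + r Z\<^sub>N\<close> is a polynomial of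
degree at most \<open>n\<close> with nonnegative coefficients, and the inclusions squeeze it between the volume of
\<open>T + r B\<close> and \<open>(1 + d\<^sub>N)\<^sup>n\<close> times that volume. A subsequence along which all the coefficients converge
therefore exhibits the volume of \<open>T + r B\<close> as a polynomial.\<close>

lemma steiner_exists_mono:
  assumes e: "orthonormal_family n e" and T: "compact T" "convex T" and T': "compact T'" "convex T'"
    and TT': "T \<subseteq> T'"
  obtains V V' where "steiner n p e T V" "steiner n p e T' V'" "\<And>k. 0 \<le> V k \<and> V k \<le> V' k"
proof -
  define f where "f S r = vol n p e (S + span_ball n e r)" for S r
  define d where "d N = 1 / real (Suc N)" for N
  have d: "0 < d N" "d N \<le> 1" for N by (auto simp: d_def)
  have "\<exists>zs. set zs \<subseteq> span (e ` {..<n}) \<and> span_ball n e 1 \<subseteq> zono zs \<and> zono zs \<subseteq> span_ball n e (1 + d N)" for N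
    using zono_approximates_ball[OF e d(1)[of N]] by metis
  then obtain zs where zs: "\<And>N. set (zs N) \<subseteq> span (e ` {..<n})" "\<And>N. span_ball n e 1 \<subseteq> zono (zs N)"
    "\<And>N. zono (zs N) \<subseteq> span_ball n e (1 + d N)"
    by metis
  let ?P = "\<lambda>N a b. (\<forall>j. 0 \<le> a j \<and> a j \<le> b j) \<and>
    (\<forall>r\<ge>0. vol n p e (T + zono (map ((*\<^sub>R) r) (zs N))) = (\<Sum>j\<le>n. a j * r ^ j) \<and>
            vol n p e (T' + zono (map ((*\<^sub>R) r) (zs N))) = (\<Sum>j\<le>n. b j * r ^ j))"
  have "\<forall>N. \<exists>a b. ?P N a b"
    using vol_plus_zono_polynomial[OF e T T' TT' zs(1)] by blast
  from choice[OF this] obtain a where "\<forall>N. \<exists>b. ?P N (a N) b" ..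
  from choice[OF this] obtain b where ab0: "\<forall>N. ?P N (a N) (b N)" ..
  have ab: "\<And>N j. 0 \<le> a N j \<and> a N j \<le> b N j"
    "\<And>N r. r \<ge> 0 \<Longrightarrow> vol n p e (T + zono (map ((*\<^sub>R) r) (zs N))) = (\<Sum>j\<le>n. a N j * r ^ j)"
    "\<And>N r. r \<ge> 0 \<Longrightarrow> vol n p e (T' + zono (map ((*\<^sub>R) r) (zs N))) = (\<Sum>j\<le>n. b N j * r ^ j)"
    using ab0 by blast+
  have sandwich: "f S r \<le> (\<Sum>j\<le>n. c N j * r ^ j) \<and> (\<Sum>j\<le>n. c N j * r ^ j) \<le> (1 + d N) ^ n * f S r"
    if r: "r \<ge> 0" and S: "compact S" and c0: "\<And>N j. 0 \<le> c N j"
      and c: "\<And>N r. r \<ge> 0 \<Longrightarrow> vol n p e (S + zono (map ((*\<^sub>R) r) (zs N))) = (\<Sum>j\<le>n. c N j * r ^ j)"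
    for S r c N
  proof
    have sc: "(*\<^sub>R) q ` span_ball n e t = span_ball n e (q * t)" if "q > 0" for q t
    proof (intro equalityI subsetI)
      fix x assume "x \<in> span_ball n e (q * t)"
      then have "x = q *\<^sub>R (inverse q *\<^sub>R x)" "inverse q *\<^sub>R x \<in> span_ball n e t"
        using that by (auto simp: span_ball_def field_simps intro: span_scale)
      then show "x \<in> (*\<^sub>R) q ` span_ball n e t" by (rule image_eqI)
    qed (use that in \<open>auto simp: span_ball_def intro: span_scale\<close>)
    have sub1: "span_ball n e q \<subseteq> zono (map ((*\<^sub>R) q) (zs N))" if "q \<ge> 0" for q
    proof (cases "q = 0")
      case True
      have "0 \<in> zono ws" for ws :: "'a list"
      proof (induction ws)
        case (Cons w ws)
        from set_plus_intro[OF zero_in_seg Cons] show ?case by simp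
      qed simp
      moreover have "span_ball n e q = {0}" using True by (auto simp: span_ball_def span_zero)
      ultimately show ?thesis by simp
    next
      case False
      then have "span_ball n e q = (*\<^sub>R) q ` span_ball n e 1" using sc[of q 1] that by simp
      also have "\<dots> \<subseteq> (*\<^sub>R) q ` zono (zs N)" using zs(2) by (intro image_mono)
      finally show ?thesis by (simp only: scale_zono_eq)
    qed
    have sub2: "zono (map ((*\<^sub>R) q) (zs N)) \<subseteq> span_ball n e (q * (1 + d N))" if "q > 0" for q
      unfolding scale_zono_eq[symmetric] sc[OF that, symmetric] using zs(3) by (intro image_mono)
    have cS: "compact (S + span_ball n e q)" "compact (S + zono ws)" for q ws
      using S e by (auto simp: compact_set_plus compact_span_ball compact_zono)
    show "f S r \<le> (\<Sum>j\<le>n. c N j * r ^ j)"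
      unfolding f_def c[OF r, symmetric]
      by (rule vol_mono[OF e cS]) (intro set_plus_mono2 order_refl sub1 r)
    show "(\<Sum>j\<le>n. c N j * r ^ j) \<le> (1 + d N) ^ n * f S r"
    proof (cases "r = 0")
      case True
      have "(\<Sum>j\<le>n. c N j * r ^ j) = f S r"
      proof -
        have "zono (map ((*\<^sub>R) 0) ws) = {0}" for ws :: "'a list" by (induction ws) auto
        moreover have "span_ball n e 0 = {0}" by (auto simp: span_ball_def span_zero)
        ultimately show ?thesis using c[OF r, symmetric] True by (simp add: f_def)
      qed
      also have "\<dots> \<le> (1 + d N) ^ n * f S r"
      proof -
        have "1 \<le> (1 + d N) ^ n" using d(1)[of N] by (intro one_le_power) simp
        from mult_right_mono[OF this, of "f S r"] show ?thesis by (simp add: f_def vol_nonneg)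
      qed
      finally show ?thesis .
    next
      case False
      \<comment> \<open>A polynomial of degree \<open>n\<close> with nonnegative coefficients grows at most by the factor \<open>(1 + d N)\<^sup>n\<close> from \<open>q\<close> to \<open>r\<close>.\<close>
      define q where "q = r / (1 + d N)"
      have q: "q > 0" "q * (1 + d N) = r" using r False d(1)[of N] by (auto simp: q_def field_simps add_pos_pos)
      have "(\<Sum>j\<le>n. c N j * r ^ j) \<le> (\<Sum>j\<le>n. (1 + d N) ^ n * (c N j * q ^ j))"
      proof (rule sum_mono)
        fix j assume "j \<in> {..n}"
        then have "(1 + d N) ^ j \<le> (1 + d N) ^ n" using d(1)[of N] by (intro power_increasing) auto
        then have "(c N j * q ^ j) * (1 + d N) ^ j \<le> (c N j * q ^ j) * (1 + d N) ^ n"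
          using c0 q by (intro mult_left_mono) auto
        then show "c N j * r ^ j \<le> (1 + d N) ^ n * (c N j * q ^ j)"
          unfolding q(2)[symmetric] by (simp add: power_mult_distrib mult_ac)
      qed
      also have "\<dots> = (1 + d N) ^ n * vol n p e (S + zono (map ((*\<^sub>R) q) (zs N)))"
        using q by (simp add: c sum_distrib_left)
      also have "\<dots> \<le> (1 + d N) ^ n * f S r"
        unfolding f_def using d(1)[of N] sub2[OF q(1)] q(2)
        by (intro mult_left_mono vol_mono[OF e cS(2,1)] set_plus_mono2) auto
      finally show ?thesis .
    qed
  qed
  have a0: "0 \<le> a N j" and aleb: "a N j \<le> b N j" and b0: "0 \<le> b N j" for N j
    using ab(1)[of N j] by auto
  note sa = sandwich[OF _ T(1), of _ a, OF _ a0 ab(2)]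
  note sb = sandwich[OF _ T'(1), of _ b, OF _ b0 ab(3)]
  define R where "R = 2 ^ n * f T' 1"
  have bR: "b N j \<le> R" if "j \<le> n" for N j
  proof -
    have "b N j = b N j * 1 ^ j" by simp
    also have "\<dots> \<le> (\<Sum>j\<le>n. b N j * 1 ^ j)"
      using that b0 by (intro member_le_sum) auto
    also have "\<dots> \<le> (1 + d N) ^ n * f T' 1" using sb[of 1 N] by simp
    also have "\<dots> \<le> R"
      unfolding R_def using d[of N] vol_nonneg by (intro mult_right_mono power_mono) (auto simp: f_def)
    finally show ?thesis .
  qed
  have bnd: "bounded (range (\<lambda>N. (a N j, b N j)))" if "j < Suc n" for j
  proof -
    have "(a N j, b N j) \<in> {0..R} \<times> {0..R}" for N
      using a0[of N j] aleb[of N j] b0[of N j] bR[of j N] that by auto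
    then have "range (\<lambda>N. (a N j, b N j)) \<subseteq> {0..R} \<times> {0..R}" by (rule image_subsetI)
    then show ?thesis by (rule bounded_subset[rotated]) (intro bounded_Times bounded_closed_interval)
  qed
  obtain s l where s: "strict_mono s" "\<And>j. j < Suc n \<Longrightarrow> (\<lambda>N. (a (s N) j, b (s N) j)) \<longlonglongrightarrow> l j"
    by (rule bounded_coordinates_convergent_subseq[of "Suc n" "\<lambda>N j. (a N j, b N j)"]) (use bnd in auto)
  define A where "A j = fst (l j)" for j
  define B where "B j = snd (l j)" for j
  have lim: "(\<lambda>N. a (s N) j) \<longlonglongrightarrow> A j" "(\<lambda>N. b (s N) j) \<longlonglongrightarrow> B j" if "j \<le> n" for j
    using tendsto_fst[OF s(2)[of j]] tendsto_snd[OF s(2)[of j]] that by (auto simp: A_def B_def)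
  have dlim: "(\<lambda>N. d (s N)) \<longlonglongrightarrow> 0"
  proof -
    have "d \<longlonglongrightarrow> 0"
      unfolding d_def using LIMSEQ_inverse_real_of_nat by (simp add: inverse_eq_divide)
    from LIMSEQ_subseq_LIMSEQ[OF this s(1)] show ?thesis by (simp add: comp_def)
  qed
  have poly: "f S r = (\<Sum>j\<le>n. C j * r ^ j)"
    if sw: "\<And>N. f S r \<le> (\<Sum>j\<le>n. c N j * r ^ j) \<and> (\<Sum>j\<le>n. c N j * r ^ j) \<le> (1 + d N) ^ n * f S r"
      and cl: "\<And>j. j \<le> n \<Longrightarrow> (\<lambda>N. c (s N) j) \<longlonglongrightarrow> C j" for S r c C
  proof (rule LIMSEQ_unique)
    show "(\<lambda>N. \<Sum>j\<le>n. c (s N) j * r ^ j) \<longlonglongrightarrow> (\<Sum>j\<le>n. C j * r ^ j)"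
      using cl by (intro tendsto_intros) auto
    show "(\<lambda>N. \<Sum>j\<le>n. c (s N) j * r ^ j) \<longlonglongrightarrow> f S r"
    proof (rule tendsto_sandwich[OF _ _ tendsto_const])
      have "(\<lambda>N. (1 + d (s N)) ^ n * f S r) \<longlonglongrightarrow> (1 + 0) ^ n * f S r"
        by (intro tendsto_intros dlim)
      then show "(\<lambda>N. (1 + d (s N)) ^ n * f S r) \<longlonglongrightarrow> f S r" by simp
    qed (use sw in auto)
  qed
  define V where "V C k = (if k \<le> n then C (n - k) / unit_ball_vol (real (n - k)) else 0)" for C :: "nat \<Rightarrow> real" and k
  have st: "steiner n p e S (V C)" if "\<And>r. r \<ge> 0 \<Longrightarrow> f S r = (\<Sum>j\<le>n. C j * r ^ j)" for S C
    unfolding steiner_def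
  proof (intro conjI allI impI)
    fix r :: real assume r: "0 \<le> r"
    have "vol n p e (parallel_body n e S r) = (\<Sum>j\<le>n. C j * r ^ j)"
      using that[OF r] r by (simp add: f_def parallel_body_eq)
    also have "\<dots> = (\<Sum>k\<le>n. C (n - k) * r ^ (n - k))"
      by (rule sum.reindex_bij_witness[of _ "\<lambda>k. n - k" "\<lambda>k. n - k"]) auto
    also have "\<dots> = (\<Sum>k\<le>n. unit_ball_vol (real (n - k)) * V C k * r ^ (n - k))"
    proof (intro sum.cong refl)
      fix k assume "k \<in> {..n}"
      moreover have "unit_ball_vol (real (n - k)) \<noteq> 0"
        using unit_ball_vol_pos[of "real (n - k)"] by linarith
      ultimately show "C (n - k) * r ^ (n - k) = unit_ball_vol (real (n - k)) * V C k * r ^ (n - k)"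
        by (simp add: V_def)
    qed
    finally show "vol n p e (parallel_body n e S r) = (\<Sum>k\<le>n. unit_ball_vol (real (n - k)) * V C k * r ^ (n - k))" .
  qed (simp add: V_def)
  have AB: "0 \<le> A j" "A j \<le> B j" if "j \<le> n" for j
  proof -
    show "0 \<le> A j" by (rule LIMSEQ_le_const[OF lim(1)[OF that]]) (use a0 in auto)
    show "A j \<le> B j" by (rule LIMSEQ_le[OF lim[OF that]]) (use aleb in auto)
  qed
  show thesis
  proof (rule that)
    show "steiner n p e T (V A)" by (rule st) (rule poly[of T _ a], use sa lim in auto)
    show "steiner n p e T' (V B)" by (rule st) (rule poly[of T' _ b], use sb lim in auto)
    show "0 \<le> V A k \<and> V A k \<le> V B k" for k
      using AB by (auto simp: V_def intro!: divide_right_mono)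
  qed
qed

section \<open>Passing to the closure\<close>

lemma span_translate_plus_ball:
  assumes "T \<subseteq> (+) p ` span (e ` {..<n})"
  shows "T + span_ball n e r \<subseteq> (+) p ` span (e ` {..<n})"
proof
  fix x assume "x \<in> T + span_ball n e r"
  then obtain t b where tb: "t \<in> T" "b \<in> span_ball n e r" "x = t + b" by (rule set_plus_elim)
  then obtain y where y: "y \<in> span (e ` {..<n})" "t = p + y" using assms by auto
  have "y + b \<in> span (e ` {..<n})" using y tb by (intro span_add) (auto simp: span_ball_def)
  then show "x \<in> (+) p ` span (e ` {..<n})"
    using tb y by (intro image_eqI[of _ _ "y + b"]) (auto simp: add.assoc)
qed

lemma vol_parallel_body_closure:
  assumes e: "orthonormal_family n e" and T: "convex T" "bounded T" "T \<subseteq> (+) p ` span (e ` {..<n})"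
    and r: "r \<ge> 0"
  shows "vol n p e (parallel_body n e T r) = vol n p e (parallel_body n e (closure T) r)"
proof -
  let ?B = "span_ball n e r"
  have B: "compact ?B" by (rule compact_span_ball[OF e])
  have cT: "compact (closure T)" by (rule closure_in_finite_span(1)[OF e T(2,3)])
  have cl: "closure (T + ?B) = closure T + ?B"
  proof
    show "closure (T + ?B) \<subseteq> closure T + ?B"
      by (intro closure_minimal set_plus_mono2 closure_subset order_refl compact_imp_closed compact_set_plus cT B)
    show "closure T + ?B \<subseteq> closure (T + ?B)"
      using closure_sum[of T ?B] closure_closed[OF compact_imp_closed[OF B]] by simp
  qed
  have "bounded (T + ?B)"
    by (rule bounded_subset[OF compact_imp_bounded[OF compact_set_plus[OF cT B]]])
      (intro set_plus_mono2 closure_subset order_refl)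
  moreover have "convex (T + ?B)" by (intro convex_set_plus T convex_span_ball)
  ultimately have "vol n p e (T + ?B) = enn2real (evol n p e (closure T + ?B))"
    using vol_convex[OF e _ _ span_translate_plus_ball[OF T(3)], of r] cl by simp
  also have "\<dots> = vol n p e (closure T + ?B)"
    by (rule vol_compact[OF e compact_set_plus[OF cT B], symmetric])
  finally show ?thesis using r by (simp add: parallel_body_eq)
qed

lemma steiner_closure:
  assumes "orthonormal_family n e" "convex T" "bounded T" "T \<subseteq> (+) p ` span (e ` {..<n})"
  shows "steiner n p e T V \<longleftrightarrow> steiner n p e (closure T) V"
  using vol_parallel_body_closure[OF assms] by (simp add: steiner_def)

section \<open>Independence of the dimension of the surrounding space\<close>

lemma evol_eq_vol:
  assumes "orthonormal_family n e" "compact A"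
  shows "evol n p e A = ennreal (vol n p e A)"
  using evol_finite[OF assms(1) compact_imp_bounded[OF assms(2)]]
  by (simp add: vol_compact[OF assms] less_top)

text \<open>At height \<open>t\<close> the ball of radius \<open>r\<close> has radius \<open>sqrt (r\<^sup>2 - t\<^sup>2)\<close>, so the slices of a parallel body in
dimension \<open>n + 1\<close> are parallel bodies in dimension \<open>n\<close>.\<close>

lemma evol_parallel_slice:
  assumes e: "orthonormal_family (Suc n) e" and T: "compact T" "T \<subseteq> (+) p ` span (e ` {..<n})"
    and r: "r \<ge> 0"
  shows "evol (Suc n) p e (T + span_ball (Suc n) e r)
    = (\<integral>\<^sup>+ t. indicator {-r..r} t * evol n p e (T + span_ball n e (sqrt (r\<^sup>2 - t\<^sup>2))) \<partial>lborel)"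
proof -
  have en: "norm (e n) = 1" using e by (simp add: orthonormal_family_def norm_eq_1)
  have orth: "x \<bullet> e n = 0" if "x \<in> span (e ` {..<n})" for x
  proof -
    obtain c where c: "x = (\<Sum>i<n. c i *\<^sub>R e i)" using \<open>x \<in> span (e ` {..<n})\<close> by (rule span_image_lessThan)
    show ?thesis
      unfolding c inner_sum_left using e by (intro sum.neutral) (auto simp: orthonormal_family_def)
  qed
  have sub: "span (e ` {..<n}) \<subseteq> span (e ` {..<Suc n})" by (intro span_mono) auto
  have ens: "e n \<in> span (e ` {..<Suc n})" by (intro span_base) auto
  have pyth: "norm (x + t *\<^sub>R e n) \<le> r \<longleftrightarrow> \<bar>t\<bar> \<le> r \<and> norm x \<le> sqrt (r\<^sup>2 - t\<^sup>2)"
    if "x \<in> span (e ` {..<n})" for x t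
  proof -
    have eq: "(norm (x + t *\<^sub>R e n))\<^sup>2 = (norm x)\<^sup>2 + t\<^sup>2"
      using orth[OF that] en by (simp add: norm_add_Pythagorean orthogonal_def)
    have "norm (x + t *\<^sub>R e n) \<le> r \<longleftrightarrow> (norm x)\<^sup>2 + t\<^sup>2 \<le> r\<^sup>2"
      unfolding eq[symmetric] using r by (simp add: power2_le_iff_abs_le)
    also have "\<dots> \<longleftrightarrow> \<bar>t\<bar> \<le> r \<and> norm x \<le> sqrt (r\<^sup>2 - t\<^sup>2)"
    proof
      assume h: "(norm x)\<^sup>2 + t\<^sup>2 \<le> r\<^sup>2"
      have "t\<^sup>2 \<le> r\<^sup>2" using h zero_le_power2[of "norm x"] by linarith
      moreover have "norm x \<le> sqrt (r\<^sup>2 - t\<^sup>2)" using h by (intro real_le_rsqrt) simp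
      ultimately show "\<bar>t\<bar> \<le> r \<and> norm x \<le> sqrt (r\<^sup>2 - t\<^sup>2)" using r by (simp add: power2_le_iff_abs_le)
    next
      assume h: "\<bar>t\<bar> \<le> r \<and> norm x \<le> sqrt (r\<^sup>2 - t\<^sup>2)"
      then have "t\<^sup>2 \<le> r\<^sup>2" using r by (simp add: power2_le_iff_abs_le)
      moreover have "(norm x)\<^sup>2 \<le> (sqrt (r\<^sup>2 - t\<^sup>2))\<^sup>2" using h by (intro power_mono) auto
      ultimately show "(norm x)\<^sup>2 + t\<^sup>2 \<le> r\<^sup>2" by simp
    qed
    finally show ?thesis .
  qed
  \<comment> \<open>Pythagoras, applied to the horizontal and vertical parts of the displacement.\<close>
  have mem: "p + t *\<^sub>R e n + x \<in> T + span_ball (Suc n) e r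
      \<longleftrightarrow> \<bar>t\<bar> \<le> r \<and> p + x \<in> T + span_ball n e (sqrt (r\<^sup>2 - t\<^sup>2))"
    if x: "x \<in> span (e ` {..<n})" for x t
  proof
    assume "p + t *\<^sub>R e n + x \<in> T + span_ball (Suc n) e r"
    then obtain \<tau> b where b: "\<tau> \<in> T" "b \<in> span_ball (Suc n) e r" "p + t *\<^sub>R e n + x = \<tau> + b"
      by (rule set_plus_elim)
    then obtain y where y: "y \<in> span (e ` {..<n})" "\<tau> = p + y" using T by auto
    have beq: "b = (x - y) + t *\<^sub>R e n" using b y by (simp add: algebra_simps)
    have xy: "x - y \<in> span (e ` {..<n})" using x y by (simp add: span_diff)
    have "\<bar>t\<bar> \<le> r" "norm (x - y) \<le> sqrt (r\<^sup>2 - t\<^sup>2)"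
      using b(2) pyth[OF xy] by (auto simp: span_ball_def beq)
    then have "x - y \<in> span_ball n e (sqrt (r\<^sup>2 - t\<^sup>2))" using xy by (simp add: span_ball_def)
    from set_plus_intro[OF b(1) this] \<open>\<bar>t\<bar> \<le> r\<close>
    show "\<bar>t\<bar> \<le> r \<and> p + x \<in> T + span_ball n e (sqrt (r\<^sup>2 - t\<^sup>2))" using y by simp
  next
    assume a: "\<bar>t\<bar> \<le> r \<and> p + x \<in> T + span_ball n e (sqrt (r\<^sup>2 - t\<^sup>2))"
    then obtain \<tau> b where b: "\<tau> \<in> T" "b \<in> span_ball n e (sqrt (r\<^sup>2 - t\<^sup>2))" "p + x = \<tau> + b"
      by (auto elim: set_plus_elim)
    have "b + t *\<^sub>R e n \<in> span_ball (Suc n) e r"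
      using b(2) pyth[of b t] a sub ens by (auto simp: span_ball_def intro!: span_add span_scale)
    from set_plus_intro[OF b(1) this] b(3)
    show "p + t *\<^sub>R e n + x \<in> T + span_ball (Suc n) e r"
      by (metis add.assoc add.commute)
  qed
  have cB: "T + span_ball (Suc n) e r \<in> sets borel"
    using T e by (intro borel_compact compact_set_plus compact_span_ball)
  have "evol (Suc n) p e (T + span_ball (Suc n) e r)
      = (\<integral>\<^sup>+ t. evol n (p + t *\<^sub>R e n) e (T + span_ball (Suc n) e r) \<partial>lborel)"
    by (rule chart_integral_Suc) (use cB in simp)
  also have "\<dots> = (\<integral>\<^sup>+ t. indicator {-r..r} t * evol n p e (T + span_ball n e (sqrt (r\<^sup>2 - t\<^sup>2))) \<partial>lborel)"
  proof (rule nn_integral_cong)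
    fix t :: real
    have ind: "indicator (T + span_ball (Suc n) e r) (affine_chart n (p + t *\<^sub>R e n) e x)
        = (indicator {-r..r} t * indicator (T + span_ball n e (sqrt (r\<^sup>2 - t\<^sup>2))) (affine_chart n p e x) :: ennreal)" for x
      using mem[OF affine_chart_in_span[of n e x], of t]
      by (auto simp: indicator_def affine_chart_def abs_le_iff)
    have "compact (T + span_ball n e (sqrt (r\<^sup>2 - t\<^sup>2)))"
      using T e by (intro compact_set_plus compact_span_ball) (simp_all add: orthonormal_family_def)
    then have "(\<lambda>x. indicator (T + span_ball n e (sqrt (r\<^sup>2 - t\<^sup>2))) (affine_chart n p e x) :: ennreal) \<in> borel_measurable (coords n)"
      using borel_compact by measurable
    then show "evol n (p + t *\<^sub>R e n) e (T + span_ball (Suc n) e r)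
        = indicator {-r..r} t * evol n p e (T + span_ball n e (sqrt (r\<^sup>2 - t\<^sup>2)))"
      unfolding chart_integral_def ind by (rule nn_integral_cmult)
  qed
  finally show ?thesis .
qed

text \<open>The slice formula for a single point, whose parallel bodies are balls of known volume, evaluates the
one-dimensional integrals that arise for a general body.\<close>

lemma unit_ball_vol_slice:
  assumes e: "orthonormal_family (Suc j) e" and r: "r \<ge> 0"
  shows "(\<integral>\<^sup>+ t. indicator {-r..r} t * ennreal (unit_ball_vol (real j) * sqrt (r\<^sup>2 - t\<^sup>2) ^ j) \<partial>lborel)
    = ennreal (unit_ball_vol (real (Suc j)) * r ^ Suc j)"
proof -
  have e': "orthonormal_family j e" using e by (simp add: orthonormal_family_def)
  have "ennreal (unit_ball_vol (real (Suc j)) * r ^ Suc j) = evol (Suc j) 0 e ({0} + span_ball (Suc j) e r)"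
    using vol_span_ball[OF e r] evol_eq_vol[OF e compact_span_ball[OF e]] by simp
  also have "\<dots> = (\<integral>\<^sup>+ t. indicator {-r..r} t * evol j 0 e ({0} + span_ball j e (sqrt (r\<^sup>2 - t\<^sup>2))) \<partial>lborel)"
    by (rule evol_parallel_slice[OF e]) (use r in \<open>auto simp: span_zero\<close>)
  also have "\<dots> = (\<integral>\<^sup>+ t. indicator {-r..r} t * ennreal (unit_ball_vol (real j) * sqrt (r\<^sup>2 - t\<^sup>2) ^ j) \<partial>lborel)"
  proof (rule nn_integral_cong)
    fix t :: real
    show "indicator {-r..r} t * evol j 0 e ({0} + span_ball j e (sqrt (r\<^sup>2 - t\<^sup>2)))
        = indicator {-r..r} t * ennreal (unit_ball_vol (real j) * sqrt (r\<^sup>2 - t\<^sup>2) ^ j)"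
    proof (cases "t \<in> {-r..r}")
      case True
      then have "t\<^sup>2 \<le> r\<^sup>2" using r by (simp add: power2_le_iff_abs_le abs_le_iff)
      then show ?thesis
        using vol_span_ball[OF e', of "sqrt (r\<^sup>2 - t\<^sup>2)"] evol_eq_vol[OF e' compact_span_ball[OF e']] by simp
    qed simp
  qed
  finally show ?thesis by simp
qed

text \<open>Intrinsic volumes do not change when the surrounding space gains a dimension: integrating the Steiner
polynomial over the slices multiplies the coefficient of \<open>r\<^sup>j\<close> by the factor that turns the volume of
the \<open>j\<close>-dimensional unit ball into that of the \<open>(j + 1)\<close>-dimensional one.\<close>

lemma steiner_Suc:
  assumes e: "orthonormal_family (Suc n) e" and T: "compact T" "T \<subseteq> (+) p ` span (e ` {..<n})"
    and V: "steiner n p e T V" "\<And>k. V k \<ge> 0"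
  shows "steiner (Suc n) p e T V"
  unfolding steiner_def
proof (intro conjI allI impI)
  fix r :: real assume r: "0 \<le> r"
  have e': "orthonormal_family n e" using e by (simp add: orthonormal_family_def)
  let ?g = "\<lambda>j t. indicator {-r..r} t * ennreal (unit_ball_vol (real j) * sqrt (r\<^sup>2 - t\<^sup>2) ^ j)"
  have "evol (Suc n) p e (T + span_ball (Suc n) e r)
      = (\<integral>\<^sup>+ t. indicator {-r..r} t * evol n p e (T + span_ball n e (sqrt (r\<^sup>2 - t\<^sup>2))) \<partial>lborel)"
    by (rule evol_parallel_slice[OF e T r])
  also have "\<dots> = (\<integral>\<^sup>+ t. (\<Sum>k\<le>n. ennreal (V k) * ?g (n - k) t) \<partial>lborel)"
  proof (rule nn_integral_cong)
    fix t :: real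
    show "indicator {-r..r} t * evol n p e (T + span_ball n e (sqrt (r\<^sup>2 - t\<^sup>2))) = (\<Sum>k\<le>n. ennreal (V k) * ?g (n - k) t)"
    proof (cases "t \<in> {-r..r}")
      case True
      then have tr: "0 \<le> sqrt (r\<^sup>2 - t\<^sup>2)" using r by (simp add: power2_le_iff_abs_le abs_le_iff)
      have "evol n p e (T + span_ball n e (sqrt (r\<^sup>2 - t\<^sup>2)))
          = ennreal (\<Sum>k\<le>n. unit_ball_vol (real (n - k)) * V k * sqrt (r\<^sup>2 - t\<^sup>2) ^ (n - k))"
        using V(1) tr evol_eq_vol[OF e' compact_set_plus[OF T(1) compact_span_ball[OF e']]]
        by (simp add: steiner_def parallel_body_eq)
      also have "\<dots> = (\<Sum>k\<le>n. ennreal (unit_ball_vol (real (n - k)) * V k * sqrt (r\<^sup>2 - t\<^sup>2) ^ (n - k)))"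
        using V(2) tr by (intro sum_ennreal[symmetric]) auto
      also have "\<dots> = (\<Sum>k\<le>n. ennreal (V k) * ennreal (unit_ball_vol (real (n - k)) * sqrt (r\<^sup>2 - t\<^sup>2) ^ (n - k)))"
        using V(2) tr by (intro sum.cong) (auto simp: mult_ac simp flip: ennreal_mult)
      finally show ?thesis using True by simp
    qed simp
  qed
  also have "\<dots> = (\<Sum>k\<le>n. ennreal (V k) * (\<integral>\<^sup>+ t. ?g (n - k) t \<partial>lborel))"
    by (subst nn_integral_sum) (auto simp: nn_integral_cmult)
  also have "\<dots> = (\<Sum>k\<le>n. ennreal (V k) * ennreal (unit_ball_vol (real (Suc (n - k))) * r ^ Suc (n - k)))"
  proof (intro sum.cong refl)
    fix k assume "k \<in> {..n}"
    have "orthonormal_family (Suc (n - k)) e" using e by (auto simp: orthonormal_family_def)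
    then show "ennreal (V k) * (\<integral>\<^sup>+ t. ?g (n - k) t \<partial>lborel) = ennreal (V k) * ennreal (unit_ball_vol (real (Suc (n - k))) * r ^ Suc (n - k))"
      by (subst unit_ball_vol_slice[OF _ r]) simp_all
  qed
  also have "\<dots> = (\<Sum>k\<le>n. ennreal (unit_ball_vol (real (Suc n - k)) * V k * r ^ (Suc n - k)))"
    using V(2) r by (intro sum.cong) (auto simp: Suc_diff_le mult_ac simp flip: ennreal_mult)
  also have "\<dots> = ennreal (\<Sum>k\<le>n. unit_ball_vol (real (Suc n - k)) * V k * r ^ (Suc n - k))"
    using V(2) r by (intro sum_ennreal) auto
  also have "(\<Sum>k\<le>n. unit_ball_vol (real (Suc n - k)) * V k * r ^ (Suc n - k))
      = (\<Sum>k\<le>Suc n. unit_ball_vol (real (Suc n - k)) * V k * r ^ (Suc n - k))"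
    using V(1) by (simp add: steiner_def)
  finally have *: "evol (Suc n) p e (T + span_ball (Suc n) e r)
    = ennreal (\<Sum>k\<le>Suc n. unit_ball_vol (real (Suc n - k)) * V k * r ^ (Suc n - k))" .
  have "0 \<le> (\<Sum>k\<le>Suc n. unit_ball_vol (real (Suc n - k)) * V k * r ^ (Suc n - k))"
    using V(2) r by (intro sum_nonneg mult_nonneg_nonneg) auto
  then show "vol (Suc n) p e (parallel_body (Suc n) e T r)
      = (\<Sum>k\<le>Suc n. unit_ball_vol (real (Suc n - k)) * V k * r ^ (Suc n - k))"
    using r * vol_compact[OF e compact_set_plus[OF T(1) compact_span_ball[OF e]]]
    by (simp add: parallel_body_eq)
qed (use V in \<open>auto simp: steiner_def\<close>)

lemma steiner_dimension_mono:
  assumes "n \<le> N" "orthonormal_family N e" "compact T" "T \<subseteq> (+) p ` span (e ` {..<n})"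
    "steiner n p e T V" "\<And>k. V k \<ge> 0"
  shows "steiner N p e T V"
  using assms(1,2)
proof (induction N rule: dec_induct)
  case (step m)
  have "orthonormal_family m e" using step.prems by (simp add: orthonormal_family_def)
  then have st: "steiner m p e T V" by (rule step.IH)
  have "span (e ` {..<n}) \<subseteq> span (e ` {..<m})" using step.hyps by (intro span_mono) auto
  then have "T \<subseteq> (+) p ` span (e ` {..<m})" by (rule order_trans[OF assms(4) image_mono])
  then show ?case using steiner_Suc[OF step.prems assms(3) _ st assms(6)] by simp
qed (use assms in simp)

lemma polynomial_coeffs_unique:
  fixes a b :: "nat \<Rightarrow> real"
  assumes "\<And>r. r \<ge> 0 \<Longrightarrow> (\<Sum>j\<le>n. a j * r ^ j) = (\<Sum>j\<le>n. b j * r ^ j)" "j \<le> n"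
  shows "a j = b j"
proof (rule ccontr)
  assume "a j \<noteq> b j"
  then have "finite {x::real. (\<Sum>i\<le>n. (a i - b i) * x ^ i) = 0}"
    using assms(2) by (intro polyfun_finite_roots[THEN iffD2]) auto
  moreover have "{0..1} \<subseteq> {x::real. (\<Sum>i\<le>n. (a i - b i) * x ^ i) = 0}"
    using assms(1) by (auto simp: left_diff_distrib sum_subtractf)
  ultimately have "finite {0..1::real}" by (rule rev_finite_subset)
  then show False using infinite_Icc[of "0::real" 1] by simp
qed

lemma steiner_unique_chart:
  assumes "steiner n p e T V" "steiner n p e T V'"
  shows "V = V'"
proof
  fix k
  have rev: "(\<Sum>k\<le>n. unit_ball_vol (real (n - k)) * W k * r ^ (n - k))
      = (\<Sum>j\<le>n. (unit_ball_vol (real j) * W (n - j)) * r ^ j)" for W and r :: real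
    by (rule sum.reindex_bij_witness[of _ "\<lambda>k. n - k" "\<lambda>k. n - k"]) auto
  show "V k = V' k"
  proof (cases "k \<le> n")
    case True
    have "(\<Sum>j\<le>n. (unit_ball_vol (real j) * V (n - j)) * r ^ j) = (\<Sum>j\<le>n. (unit_ball_vol (real j) * V' (n - j)) * r ^ j)"
      if "r \<ge> 0" for r
      using assms that unfolding steiner_def rev by metis
    from polynomial_coeffs_unique[OF this, of "n - k"]
    have "unit_ball_vol (real (n - k)) * V k = unit_ball_vol (real (n - k)) * V' k" using True by simp
    moreover have "unit_ball_vol (real (n - k)) \<noteq> 0"
      using unit_ball_vol_pos[of "real (n - k)"] by linarith
    ultimately show ?thesis by simp
  next
    case False
    then show ?thesis using assms by (simp add: steiner_def)
  qed
qed

lemma steiner_nonneg: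
  assumes "orthonormal_family n e" "compact T" "convex T" "steiner n p e T V"
  shows "V k \<ge> 0"
  using steiner_exists_mono[OF assms(1-3,2,3) order_refl, of p] steiner_unique_chart[OF assms(4)] by metis

text \<open>Both charts are extended to orthonormal charts of one common subspace, where the two Steiner
polynomials describe the same volumes.\<close>

lemma steiner_unique:
  assumes T: "compact T" "convex T"
    and e: "orthonormal_family n e" "T \<subseteq> (+) p ` span (e ` {..<n})" "steiner n p e T V"
    and f: "orthonormal_family m f" "T \<subseteq> (+) q ` span (f ` {..<m})" "steiner m q f T V'"
  shows "V = V'"
proof -
  have V: "V k \<ge> 0" and V': "V' k \<ge> 0" for k
    using steiner_nonneg[OF e(1) T e(3)] steiner_nonneg[OF f(1) T f(3)] by auto
  let ?S = "span (e ` {..<n} \<union> (f ` {..<m} \<union> {q - p}))"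
  obtain N g where g: "n \<le> N" "orthonormal_family N g" "\<And>i. i < n \<Longrightarrow> g i = e i"
    "span (g ` {..<N}) = ?S"
    using orthonormal_family_extend[OF e(1), of "f ` {..<m} \<union> {q - p}"] by auto
  obtain N' g' where g': "m \<le> N'" "orthonormal_family N' g'" "\<And>i. i < m \<Longrightarrow> g' i = f i"
    "span (g' ` {..<N'}) = span (f ` {..<m} \<union> (e ` {..<n} \<union> {q - p}))"
    using orthonormal_family_extend[OF f(1), of "e ` {..<n} \<union> {q - p}"] by auto
  have sp: "span (g' ` {..<N'}) = span (g ` {..<N})"
    using g(4) g'(4) by (simp add: Un_ac)
  have gn: "g ` {..<n} = e ` {..<n}" using g(3) by auto
  have gm: "g' ` {..<m} = f ` {..<m}" using g'(3) by auto
  have "orthonormal_family n g" using g(1,2) by (auto simp: orthonormal_family_def)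
  then have "steiner n p g T V"
    by (rule steiner_cong_chart[OF T(1) e(1) _ _ _ e(3)]) (auto simp: gn span_zero)
  then have 1: "steiner N p g T V"
    using e(2) V by (intro steiner_dimension_mono[OF g(1,2) T(1)]) (auto simp: gn)
  have "orthonormal_family m g'" using g'(1,2) by (auto simp: orthonormal_family_def)
  then have "steiner m q g' T V'"
    by (rule steiner_cong_chart[OF T(1) f(1) _ _ _ f(3)]) (auto simp: gm span_zero)
  then have "steiner N' q g' T V'"
    using f(2) V' by (intro steiner_dimension_mono[OF g'(1,2) T(1)]) (auto simp: gm)
  moreover have "p - q \<in> span (g' ` {..<N'})"
  proof -
    have "- (q - p) \<in> ?S" by (intro span_neg span_base) auto
    then show ?thesis using sp g(4) by simp
  qed
  ultimately have 2: "steiner N p g T V'"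
    using steiner_cong_chart[OF T(1) g'(2) g(2) sp] by blast
  show ?thesis by (rule steiner_unique_chart[OF 1 2])
qed

section \<open>Intrinsic volumes of bounded convex sets of finite dimension\<close>

lemma has_intrinsic_volumes_iff:
  "has_intrinsic_volumes T V \<longleftrightarrow>
    (\<exists>n p e. orthonormal_family n e \<and> T \<subseteq> (+) p ` span (e ` {..<n}) \<and> steiner n p e T V)"
  unfolding has_intrinsic_volumes_def steiner_def range_affine_chart by blast

lemma intrinsic_volume_fin_eq:
  assumes T: "convex T" "bounded T" "T \<subseteq> (+) p ` span (e ` {..<n})"
    and e: "orthonormal_family n e" and V: "steiner n p e (closure T) V"
  shows "intrinsic_volume_fin k T = V k"
proof -
  have "(THE V. has_intrinsic_volumes T V) = V"
  proof (rule the_equality)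
    show "has_intrinsic_volumes T V"
      unfolding has_intrinsic_volumes_iff using e T V steiner_closure[OF e T] by blast
  next
    fix V' assume "has_intrinsic_volumes T V'"
    then obtain m q f where f: "orthonormal_family m f" "T \<subseteq> (+) q ` span (f ` {..<m})" "steiner m q f T V'"
      by (auto simp: has_intrinsic_volumes_iff)
    have V': "steiner m q f (closure T) V'"
      using f steiner_closure[OF f(1) T(1,2) f(2)] by simp
    note c = closure_in_finite_span[OF e T(2,3)] closure_in_finite_span(2)[OF f(1) T(2) f(2)]
    show "V' = V"
      by (rule steiner_unique[OF c(1) convex_closure[OF T(1)] f(1) c(3) V' e c(2) V])
  qed
  then show ?thesis by (simp add: intrinsic_volume_fin_def)
qed

lemma steiner_translate:
  assumes "steiner n p e T V"
  shows "steiner n (c + p) e ((+) c ` T) V"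
proof -
  have "parallel_body n e ((+) c ` T) r = (+) c ` parallel_body n e T r" if "r \<ge> 0" for r
    using that by (force simp: parallel_body_eq set_plus_def image_iff add.assoc)
  moreover have "vol n (c + p) e ((+) c ` A) = vol n p e A" for A
  proof -
    have "affine_chart n (c + p) e x = c + affine_chart n p e x" for x
      by (simp add: affine_chart_def add.assoc)
    then show ?thesis by (simp add: vol_def image_iff)
  qed
  ultimately show ?thesis using assms by (simp add: steiner_def)
qed

text \<open>Monotonicity of intrinsic volumes under inclusion in a translate of a zonotope, the only kind of
upper bound that occurs below.\<close>

lemma intrinsic_volume_fin_zono_upper:
  assumes T: "convex T" "bounded T" "T \<subseteq> (+) c ` zono zs"
  shows "intrinsic_volume_fin k T \<le> zono_vol k zs"
proof -
  obtain n e where e: "orthonormal_family n e" "span (e ` {..<n}) = span (set zs)"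
    using orthonormal_family_of_finite[of "set zs"] by auto
  have zs: "zono zs \<subseteq> span (e ` {..<n})" using zono_subset_span e by auto
  have Z: "compact ((+) c ` zono zs)" "convex ((+) c ` zono zs)"
    by (auto simp: compact_translation compact_zono convex_translation convex_zono)
  have Tc: "T \<subseteq> (+) c ` span (e ` {..<n})" using T(3) zs by blast
  note cT = closure_in_finite_span[OF e(1) T(2) Tc]
  have "closure T \<subseteq> (+) c ` zono zs" using T(3) Z(1) by (intro closure_minimal compact_imp_closed)
  then obtain V V' where V: "steiner n c e (closure T) V" "steiner n c e ((+) c ` zono zs) V'" "\<And>k. 0 \<le> V k \<and> V k \<le> V' k"
    using steiner_exists_mono[OF e(1) cT(1) convex_closure[OF T(1)] Z, of c] by metis
  have "steiner n 0 e (zono zs) (\<lambda>k. zono_vol k zs)"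
    by (rule steiner_zono[OF e(1)]) (use e(2) span_superset in blast)
  from steiner_translate[OF this, of c] have "steiner n c e ((+) c ` zono zs) (\<lambda>k. zono_vol k zs)" by simp
  then have "V' = (\<lambda>k. zono_vol k zs)" using V(2) steiner_unique_chart by blast
  then show ?thesis
    using V(3)[of k] intrinsic_volume_fin_eq[OF T(1,2) Tc e(1) V(1)] by simp
qed

lemma intrinsic_volume_fin_zono:
  "intrinsic_volume_fin k ((+) c ` zono zs) = zono_vol k zs"
proof -
  obtain n e where e: "orthonormal_family n e" "span (e ` {..<n}) = span (set zs)"
    using orthonormal_family_of_finite[of "set zs"] by auto
  have Z: "compact ((+) c ` zono zs)" "convex ((+) c ` zono zs)"
    by (auto simp: compact_translation compact_zono convex_translation convex_zono)
  have "steiner n 0 e (zono zs) (\<lambda>k. zono_vol k zs)"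
    by (rule steiner_zono[OF e(1)]) (use e(2) span_superset in blast)
  from steiner_translate[OF this, of c] have "steiner n c e (closure ((+) c ` zono zs)) (\<lambda>k. zono_vol k zs)"
    using Z(1) by (simp add: closure_closed compact_imp_closed)
  then show ?thesis
    using zono_subset_span[of zs] e Z by (intro intrinsic_volume_fin_eq[of _ c e n]) (auto simp: compact_imp_bounded)
qed

lemma zono_vol_mono: "zono ws \<subseteq> zono zs \<Longrightarrow> zono_vol k ws \<le> zono_vol k zs"
  using intrinsic_volume_fin_zono_upper[of "zono ws" 0 zs k] intrinsic_volume_fin_zono[of k 0 ws]
  by (simp add: convex_zono compact_imp_bounded compact_zono)

section \<open>Estimates for zonotopes\<close>

lemma sum_list_norm_perp_le: "(\<Sum>z\<leftarrow>map (perp u) zs. norm z) \<le> (\<Sum>z\<leftarrow>zs. norm z)"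
  by (induction zs) (auto intro: add_mono norm_perp_le)

lemma zono_vol_bounds: "0 \<le> zono_vol k zs \<and> zono_vol k zs \<le> (2 * (\<Sum>z\<leftarrow>zs. norm z)) ^ k"
proof (induction k zs rule: zono_vol.induct)
  case (3 k z zs)
  let ?S = "\<Sum>z\<leftarrow>zs. norm z"
  have S: "0 \<le> ?S" by (intro sum_list_nonneg) auto
  have Sp: "0 \<le> (\<Sum>z\<leftarrow>map (perp z) zs. norm z)" by (intro sum_list_nonneg) auto
  have "zono_vol k (map (perp z) zs) \<le> (2 * ?S) ^ k"
    using "3.IH"(2) sum_list_norm_perp_le[of z zs] Sp power_mono[of "2 * (\<Sum>z\<leftarrow>map (perp z) zs. norm z)" "2 * ?S" k]
    by linarith
  then have "zono_vol (Suc k) (z # zs) \<le> (2 * ?S) * (2 * ?S) ^ k + 2 * norm z * (2 * ?S) ^ k"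
    using "3.IH"(1) by (auto intro!: add_mono mult_left_mono)
  also have "\<dots> = (2 * (\<Sum>z\<leftarrow>z # zs. norm z)) * (2 * ?S) ^ k" by (simp add: algebra_simps)
  also have "\<dots> \<le> (2 * (\<Sum>z\<leftarrow>z # zs. norm z)) * (2 * (\<Sum>z\<leftarrow>z # zs. norm z)) ^ k"
    using S by (intro mult_left_mono power_mono) auto
  finally show ?case using 3 by simp
qed auto

text \<open>Additional generators of small total length change the intrinsic volumes of a zonotope by little. All
the approximation errors below are absorbed by adding short generators.\<close>

lemma zono_vol_append_le:
  "zono_vol (Suc k) (bs @ zs) \<le> zono_vol (Suc k) zs
    + 2 * (\<Sum>b\<leftarrow>bs. norm b) * (2 * ((\<Sum>b\<leftarrow>bs. norm b) + (\<Sum>z\<leftarrow>zs. norm z))) ^ k"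
proof (induction bs)
  case (Cons b bs)
  let ?B = "\<Sum>b\<leftarrow>bs. norm b" and ?S = "\<Sum>z\<leftarrow>zs. norm z"
  have nn: "0 \<le> ?B" "0 \<le> ?S" by (intro sum_list_nonneg; auto)+
  have Sp: "0 \<le> (\<Sum>z\<leftarrow>map (perp b) (bs @ zs). norm z)" by (intro sum_list_nonneg) auto
  have m: "(2 * (?B + ?S)) ^ k \<le> (2 * ((norm b + ?B) + ?S)) ^ k"
    using nn by (intro power_mono) auto
  have "zono_vol k (map (perp b) (bs @ zs)) \<le> (2 * (\<Sum>z\<leftarrow>map (perp b) (bs @ zs). norm z)) ^ k"
    using zono_vol_bounds by blast
  also have "\<dots> \<le> (2 * (\<Sum>z\<leftarrow>bs @ zs. norm z)) ^ k"
    using sum_list_norm_perp_le[of b "bs @ zs"] Sp by (intro power_mono) auto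
  finally have 1: "zono_vol k (map (perp b) (bs @ zs)) \<le> (2 * ((norm b + ?B) + ?S)) ^ k"
    using m by simp
  have "zono_vol (Suc k) ((b # bs) @ zs) = zono_vol (Suc k) (bs @ zs) + 2 * norm b * zono_vol k (map (perp b) (bs @ zs))"
    by simp
  also have "\<dots> \<le> (zono_vol (Suc k) zs + 2 * ?B * (2 * ((norm b + ?B) + ?S)) ^ k)
      + 2 * norm b * (2 * ((norm b + ?B) + ?S)) ^ k"
  proof (rule add_mono)
    have "2 * ?B * (2 * (?B + ?S)) ^ k \<le> 2 * ?B * (2 * ((norm b + ?B) + ?S)) ^ k"
      using m nn by (intro mult_left_mono) auto
    then show "zono_vol (Suc k) (bs @ zs) \<le> zono_vol (Suc k) zs + 2 * ?B * (2 * ((norm b + ?B) + ?S)) ^ k"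
      using Cons by linarith
    show "2 * norm b * zono_vol k (map (perp b) (bs @ zs)) \<le> 2 * norm b * (2 * ((norm b + ?B) + ?S)) ^ k"
      using 1 by (intro mult_left_mono) auto
  qed
  finally show ?case by (simp add: algebra_simps)
qed simp

lemma zono_vol_scale:
  assumes "s \<noteq> 0"
  shows "zono_vol k (map ((*\<^sub>R) s) zs) = \<bar>s\<bar> ^ k * zono_vol k zs"
proof (induction k zs rule: zono_vol.induct)
  case (3 k z zs)
  have "map (perp (s *\<^sub>R z)) (map ((*\<^sub>R) s) zs) = map ((*\<^sub>R) s) (map (perp z) zs)"
    using assms by (simp add: perp_scale_left perp_scale)
  then have "zono_vol (Suc k) (map ((*\<^sub>R) s) (z # zs))
     = \<bar>s\<bar> ^ Suc k * zono_vol (Suc k) zs + 2 * (\<bar>s\<bar> * norm z) * (\<bar>s\<bar> ^ k * zono_vol k (map (perp z) zs))"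
    using 3 by (simp del: map_map)
  then show ?case by (simp add: algebra_simps)
qed simp_all

lemma scaleR_in_seg:
  assumes "\<bar>a\<bar> \<le> r" shows "a *\<^sub>R b \<in> seg (r *\<^sub>R b)"
proof (cases "r = 0")
  case True
  then show ?thesis using assms by simp
next
  case False
  then have "a *\<^sub>R b = (a / r) *\<^sub>R (r *\<^sub>R b)" "a / r \<in> {-1..1}"
    using assms by (auto simp: field_simps abs_le_iff)
  then show ?thesis unfolding seg_def by (rule image_eqI)
qed

lemma sum_in_zono:
  assumes "\<And>i. i \<in> set is \<Longrightarrow> \<bar>a i\<bar> \<le> r i"
  shows "(\<Sum>i\<leftarrow>is. a i *\<^sub>R b i) \<in> zono (map (\<lambda>i. r i *\<^sub>R b i) is)"
  using assms by (induction "is") (auto intro!: set_plus_intro scaleR_in_seg)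

section \<open>Sets that are approximated by zonotopes\<close>

lemma fin_dim_translated_span:
  assumes "finite B" "T \<subseteq> (+) c ` span B"
  shows "fin_dim T"
proof -
  let ?S = "insert c ((+) c ` B)"
  have "affine hull ?S = (+) c ` span ((\<lambda>x. - c + x) ` (?S - {c}))"
    using affine_hull_span2[of c ?S] by auto
  moreover have "span B \<subseteq> span ((\<lambda>x. - c + x) ` (?S - {c}))"
  proof -
    have "B - {0} \<subseteq> (\<lambda>x. - c + x) ` (?S - {c})"
    proof
      fix b assume "b \<in> B - {0}"
      then show "b \<in> (\<lambda>x. - c + x) ` (?S - {c})" by (intro image_eqI[of _ _ "c + b"]) auto
    qed
    from span_mono[OF this] show ?thesis by simp
  qed
  ultimately have "T \<subseteq> affine hull ?S" using assms(2) by blast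
  moreover have "finite ?S" using assms(1) by simp
  ultimately show ?thesis unfolding fin_dim_def by blast
qed

text \<open>Suppose that linear maps \<open>J m\<close> move the points of \<open>K\<close> by at most \<open>\<epsilon> m\<close> and send \<open>K\<close> into zonotopes. For a
convex set \<open>T\<close> of finite dimension in \<open>K\<close> the differences \<open>x - J m x\<close> range over a subspace whose dimension
is bounded independently of \<open>m\<close>, by linearity. So \<open>T\<close> is contained in the zonotope enlarged by a bounded
number of orthogonal generators of length \<open>\<epsilon> m\<close>, which do not matter in the limit. The lower bound comes
from zonotopes inside \<open>K\<close>.\<close>

lemma intrinsic_volume_of_approximable:
  fixes K :: "'a::real_inner set" and J :: "nat \<Rightarrow> 'a \<Rightarrow> 'a"
  assumes k: "k \<ge> 1" and s: "s > 0"
    and J: "\<And>m. linear (J m)" "\<And>m x. x \<in> K \<Longrightarrow> J m x \<in> zono (ws m)"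
      "\<And>m x. x \<in> K \<Longrightarrow> norm (x - J m x) \<le> \<epsilon> m"
    and \<epsilon>: "\<epsilon> \<longlonglongrightarrow> 0" and S: "\<And>m. (\<Sum>w\<leftarrow>ws m. norm w) \<le> S"
    and u: "\<And>m. zono_vol k (ws m) \<le> u m" "u \<longlonglongrightarrow> L"
    and vs: "\<And>m. zono (vs m) \<subseteq> K"
    and l: "\<And>m. l m \<le> zono_vol k (vs m)" "l \<longlonglongrightarrow> L"
  shows "intrinsic_volume k ((\<lambda>x. c + s *\<^sub>R x) ` K) = ennreal (s ^ k * L)"
proof (rule antisym)
  obtain k' where k': "k = Suc k'" using k by (cases k) auto
  show "intrinsic_volume k ((\<lambda>x. c + s *\<^sub>R x) ` K) \<le> ennreal (s ^ k * L)"
    unfolding intrinsic_volume_def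
  proof (rule SUP_least, clarify)
    fix T assume T: "T \<subseteq> (\<lambda>x. c + s *\<^sub>R x) ` K" "convex T" "bounded T" "fin_dim T"
    then obtain B where B: "finite B" "T \<subseteq> affine hull B" by (auto simp: fin_dim_def)
    define B' where "B' = insert c B"
    define D where "D = real (card B')"
    have B': "finite B'" using B by (simp add: B'_def)
    have "intrinsic_volume_fin k T \<le> s ^ k * (u m + 2 * (D * \<epsilon> m) * (2 * (D * \<epsilon> m + S)) ^ k')" for m
    proof -
      have "K \<noteq> {}" using vs[of m] zono_support_attained[of "vs m" 0] by auto
      then have \<epsilon>0: "\<epsilon> m \<ge> 0" using J(3)[of _ m] norm_ge_zero order_trans by blast
      define R where "R x = x - J m x" for x
      have R: "linear R" unfolding R_def using J(1)[of m] by (intro linear_compose_sub linear_id[unfolded id_def])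
      \<comment> \<open>The errors \<open>R x\<close> lie in a subspace of dimension at most \<open>card B'\<close>.\<close>
      obtain d b where b: "orthonormal_family d b" "span (b ` {..<d}) = span (R ` B')"
        using orthonormal_family_of_finite[of "R ` B'"] B' by auto
      have "d = dim (span (R ` B'))" using orthonormal_family_dim[OF b(1)] b(2) by simp
      also have "\<dots> \<le> card (R ` B')" using B' by (intro dim_le_card) auto
      also have "\<dots> \<le> card B'" using B' by (rule card_image_le)
      finally have dD: "real d \<le> D" by (simp add: D_def)
      define bs where "bs = map (\<lambda>i. \<epsilon> m *\<^sub>R b i) [0..<d]"
      have nb: "norm (b i) = 1" if "i < d" for i
        using b(1) that by (simp add: orthonormal_family_def norm_eq_1)
      have "(\<Sum>z\<leftarrow>bs. norm z) = (\<Sum>i\<leftarrow>[0..<d]. \<epsilon> m)"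
        unfolding bs_def map_map using \<epsilon>0 nb by (intro arg_cong[where f = sum_list] map_cong) auto
      then have nbs: "(\<Sum>z\<leftarrow>bs. norm z) = real d * \<epsilon> m" by (simp add: sum_list_triv)
      have "T \<subseteq> (+) c ` zono (map ((*\<^sub>R) s) (bs @ ws m))"
      proof
        fix y assume y: "y \<in> T"
        then obtain x where x: "x \<in> K" "y = c + s *\<^sub>R x" using T(1) by auto
        have "y \<in> span B'" using y B(2) affine_hull_subset_span[of B] span_mono[of B B'] by (auto simp: B'_def)
        moreover have "c \<in> span B'" by (intro span_base) (simp add: B'_def)
        ultimately have "inverse s *\<^sub>R (y - c) \<in> span B'" by (intro span_scale span_diff)
        then have "x \<in> span B'" using x s by simp
        then have Rx: "R x \<in> span (b ` {..<d})" unfolding b(2) linear_span_image[OF R] by (rule imageI)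
        have "R x = (\<Sum>i<d. (R x \<bullet> b i) *\<^sub>R b i)" by (rule orthonormal_expansion[OF b(1) Rx])
        also have "\<dots> = (\<Sum>i\<leftarrow>[0..<d]. (R x \<bullet> b i) *\<^sub>R b i)"
          by (simp add: sum_list_distinct_conv_sum_set atLeast0LessThan)
        also have "\<dots> \<in> zono bs" unfolding bs_def
        proof (rule sum_in_zono)
          fix i assume "i \<in> set [0..<d]"
          then have "norm (b i) = 1" using nb by simp
          then have "\<bar>R x \<bullet> b i\<bar> \<le> norm (R x)" using Cauchy_Schwarz_ineq2[of "R x" "b i"] by simp
          also have "\<dots> \<le> \<epsilon> m" unfolding R_def by (rule J(3)[OF x(1)])
          finally show "\<bar>R x \<bullet> b i\<bar> \<le> \<epsilon> m" .
        qed
        finally have "R x + J m x \<in> zono (bs @ ws m)"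
          using J(2)[OF x(1), of m] by (simp add: zono_append set_plus_intro)
        then have "x \<in> zono (bs @ ws m)" by (simp add: R_def)
        then have "s *\<^sub>R x \<in> zono (map ((*\<^sub>R) s) (bs @ ws m))"
          unfolding scale_zono_eq[symmetric] by (rule imageI)
        then show "y \<in> (+) c ` zono (map ((*\<^sub>R) s) (bs @ ws m))" using x by blast
      qed
      from intrinsic_volume_fin_zono_upper[OF T(2,3) this]
      have "intrinsic_volume_fin k T \<le> s ^ k * zono_vol k (bs @ ws m)"
        using s by (simp only: zono_vol_scale) simp
      also have "zono_vol k (bs @ ws m) \<le> zono_vol k (ws m)
          + 2 * (real d * \<epsilon> m) * (2 * (real d * \<epsilon> m + (\<Sum>w\<leftarrow>ws m. norm w))) ^ k'"
        using zono_vol_append_le[of k' bs "ws m"] nbs k' by simp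
      also have "\<dots> \<le> u m + 2 * (D * \<epsilon> m) * (2 * (D * \<epsilon> m + S)) ^ k'"
      proof -
        have "0 \<le> (\<Sum>w\<leftarrow>ws m. norm w)" by (intro sum_list_nonneg) auto
        then show ?thesis
          using dD \<epsilon>0 S[of m]
          by (intro add_mono u mult_mono power_mono mult_left_mono) (auto simp: D_def intro: mult_right_mono)
      qed
      finally show ?thesis using s by simp
    qed
    moreover have "(\<lambda>m. s ^ k * (u m + 2 * (D * \<epsilon> m) * (2 * (D * \<epsilon> m + S)) ^ k')) \<longlonglongrightarrow> s ^ k * (L + 2 * (D * 0) * (2 * (D * 0 + S)) ^ k')"
      by (intro tendsto_intros \<epsilon> u)
    ultimately have "intrinsic_volume_fin k T \<le> s ^ k * L"
      by (intro LIMSEQ_le_const[of _ "s ^ k * L"]) auto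
    then show "ennreal (intrinsic_volume_fin k T) \<le> ennreal (s ^ k * L)" by (rule ennreal_leI)
  qed
  show "ennreal (s ^ k * L) \<le> intrinsic_volume k ((\<lambda>x. c + s *\<^sub>R x) ` K)"
  proof (rule LIMSEQ_le_const2)
    show "(\<lambda>m. ennreal (s ^ k * l m)) \<longlonglongrightarrow> ennreal (s ^ k * L)"
      by (intro tendsto_ennrealI tendsto_intros l)
    have "ennreal (s ^ k * l m) \<le> intrinsic_volume k ((\<lambda>x. c + s *\<^sub>R x) ` K)" for m
    proof -
      let ?T = "(+) c ` zono (map ((*\<^sub>R) s) (vs m))"
      have "?T \<subseteq> (\<lambda>x. c + s *\<^sub>R x) ` K"
        unfolding scale_zono_eq[symmetric] using vs[of m] by auto
      moreover have "convex ?T" "bounded ?T"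
        by (simp_all add: convex_translation convex_zono compact_imp_bounded compact_translation compact_zono)
      moreover have "fin_dim ?T"
        by (rule fin_dim_translated_span[of "set (map ((*\<^sub>R) s) (vs m))"]) (use zono_subset_span in blast)+
      ultimately have "ennreal (intrinsic_volume_fin k ?T) \<le> intrinsic_volume k ((\<lambda>x. c + s *\<^sub>R x) ` K)"
        unfolding intrinsic_volume_def by (intro SUP_upper) blast
      moreover have "s ^ k * l m \<le> intrinsic_volume_fin k ?T"
        unfolding intrinsic_volume_fin_zono using s l(1)[of m] by (simp add: zono_vol_scale)
      ultimately show ?thesis using ennreal_leI order_trans by blast
    qed
    then show "\<exists>N. \<forall>m\<ge>N. ennreal (s ^ k * l m) \<le> intrinsic_volume k ((\<lambda>x. c + s *\<^sub>R x) ` K)" by blast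
  qed
qed

section \<open>Riemann sums for products of monotone functions\<close>

text \<open>On each cell the product of a decreasing and an increasing function varies by at most the sum of
their two variations, and these add up to at most \<open>2\<close> over all cells.\<close>

lemma riemann_sum_monotone_product:
  fixes f g :: "real \<Rightarrow> real"
  assumes h: "h > 0"
    and f: "\<And>x y. 0 \<le> x \<Longrightarrow> x \<le> y \<Longrightarrow> y \<le> real l * h \<Longrightarrow> f y \<le> f x"
      "\<And>x. 0 \<le> x \<Longrightarrow> x \<le> real l * h \<Longrightarrow> 0 \<le> f x \<and> f x \<le> 1"
    and g: "\<And>x y. 0 \<le> x \<Longrightarrow> x \<le> y \<Longrightarrow> y \<le> real l * h \<Longrightarrow> g x \<le> g y"
      "\<And>x. 0 \<le> x \<Longrightarrow> x \<le> real l * h \<Longrightarrow> 0 \<le> g x \<and> g x \<le> 1"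
    and int: "(\<lambda>s. f s * g s) integrable_on {0..real l * h}"
  shows "\<bar>h * (\<Sum>i<l. f (real i * h) * g (real i * h)) - integral {0..real l * h} (\<lambda>s. f s * g s)\<bar> \<le> 2 * h"
proof -
  let ?F = "\<lambda>s. f s * g s"
  let ?x = "\<lambda>i. real i * h"
  have "\<bar>h * (\<Sum>i<n. ?F (?x i)) - integral {0..?x n} ?F\<bar> \<le> h * ((g (?x n) - g 0) + (f 0 - f (?x n)))"
    if "n \<le> l" for n
    using that
  proof (induction n)
    case (Suc n)
    have xl: "?x (Suc n) \<le> ?x l" using Suc.prems h by (intro mult_right_mono) auto
    have xn: "?x n \<le> ?x (Suc n)" using h by simp
    have x0: "0 \<le> ?x n" using h by simp
    have I: "?F integrable_on {0..?x (Suc n)}"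
      by (rule integrable_subinterval_real[OF int]) (use xl in auto)
    have Ic: "?F integrable_on {?x n..?x (Suc n)}"
      by (rule integrable_subinterval_real[OF int]) (use xl x0 in auto)
    have comb: "integral {0..?x n} ?F + integral {?x n..?x (Suc n)} ?F = integral {0..?x (Suc n)} ?F"
      by (rule Henstock_Kurzweil_Integration.integral_combine[OF x0 xn I])
    have fn: "0 \<le> f (?x n)" "f (?x n) \<le> 1" "0 \<le> f (?x (Suc n))" "f (?x (Suc n)) \<le> f (?x n)"
      using f(2)[of "?x n"] f(2)[of "?x (Suc n)"] f(1)[OF x0 xn xl] x0 xn xl by auto
    have gn: "0 \<le> g (?x n)" "g (?x n) \<le> 1" "g (?x n) \<le> g (?x (Suc n))"
      using g(2)[of "?x n"] g(1)[OF x0 xn xl] x0 xn xl by auto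
    have hi: "integral {?x n..?x (Suc n)} ?F \<le> h * (f (?x n) * g (?x (Suc n)))"
    proof -
      have "integral {?x n..?x (Suc n)} ?F \<le> integral {?x n..?x (Suc n)} (\<lambda>_. f (?x n) * g (?x (Suc n)))"
      proof (rule integral_le[OF Ic integrable_const_ivl])
        fix s assume s: "s \<in> {?x n..?x (Suc n)}"
        then have "f s \<le> f (?x n)" "g s \<le> g (?x (Suc n))" "0 \<le> f s" "0 \<le> g s"
          using f(1)[of "?x n" s] g(1)[of s "?x (Suc n)"] f(2)[of s] g(2)[of s] x0 xl by auto
        then show "?F s \<le> f (?x n) * g (?x (Suc n))" using fn by (intro mult_mono) auto
      qed
      also have "\<dots> = h * (f (?x n) * g (?x (Suc n)))" using xn by (simp add: algebra_simps)
      finally show ?thesis .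
    qed
    have lo: "h * (f (?x (Suc n)) * g (?x n)) \<le> integral {?x n..?x (Suc n)} ?F"
    proof -
      have "h * (f (?x (Suc n)) * g (?x n)) = integral {?x n..?x (Suc n)} (\<lambda>_. f (?x (Suc n)) * g (?x n))"
        using xn by (simp add: algebra_simps)
      also have "\<dots> \<le> integral {?x n..?x (Suc n)} ?F"
      proof (rule integral_le[OF integrable_const_ivl Ic])
        fix s assume s: "s \<in> {?x n..?x (Suc n)}"
        then have "f (?x (Suc n)) \<le> f s" "g (?x n) \<le> g s" "0 \<le> f s" "0 \<le> g s"
          using f(1)[of s "?x (Suc n)"] g(1)[of "?x n" s] f(2)[of s] g(2)[of s] x0 xl by auto
        then show "f (?x (Suc n)) * g (?x n) \<le> ?F s" using fn gn by (intro mult_mono) auto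
      qed
      finally show ?thesis .
    qed
    have bounds: "h * (f (?x (Suc n)) * g (?x n)) \<le> h * ?F (?x n)" "h * ?F (?x n) \<le> h * (f (?x n) * g (?x (Suc n)))"
      using fn gn h by (auto intro!: mult_left_mono mult_mono)
    have "f (?x n) * (g (?x (Suc n)) - g (?x n)) \<le> 1 * (g (?x (Suc n)) - g (?x n))"
      "g (?x n) * (f (?x n) - f (?x (Suc n))) \<le> 1 * (f (?x n) - f (?x (Suc n)))"
      by (rule mult_right_mono; use fn gn in linarith)+
    then have "f (?x n) * g (?x (Suc n)) - f (?x (Suc n)) * g (?x n)
        \<le> (g (?x (Suc n)) - g (?x n)) + (f (?x n) - f (?x (Suc n)))"
      by (simp add: algebra_simps)
    then have "h * (f (?x n) * g (?x (Suc n)) - f (?x (Suc n)) * g (?x n))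
        \<le> h * ((g (?x (Suc n)) - g (?x n)) + (f (?x n) - f (?x (Suc n))))"
      using h by (intro mult_left_mono) auto
    then have osc: "h * (f (?x n) * g (?x (Suc n))) - h * (f (?x (Suc n)) * g (?x n))
        \<le> h * ((g (?x (Suc n)) - g (?x n)) + (f (?x n) - f (?x (Suc n))))"
      by (simp only: right_diff_distrib)
    have "\<bar>h * ?F (?x n) - integral {?x n..?x (Suc n)} ?F\<bar>
        \<le> h * ((g (?x (Suc n)) - g (?x n)) + (f (?x n) - f (?x (Suc n))))"
      using hi lo bounds osc by (simp only: abs_le_iff) linarith
    moreover have "\<bar>h * (\<Sum>i<n. ?F (?x i)) - integral {0..?x n} ?F\<bar> \<le> h * ((g (?x n) - g 0) + (f 0 - f (?x n)))"
      using Suc by simp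
    ultimately have "\<bar>(h * (\<Sum>i<n. ?F (?x i)) - integral {0..?x n} ?F) + (h * ?F (?x n) - integral {?x n..?x (Suc n)} ?F)\<bar>
        \<le> h * ((g (?x n) - g 0) + (f 0 - f (?x n))) + h * ((g (?x (Suc n)) - g (?x n)) + (f (?x n) - f (?x (Suc n))))"
      by linarith
    also have "\<dots> = h * ((g (?x (Suc n)) - g 0) + (f 0 - f (?x (Suc n))))"
      unfolding distrib_left[symmetric] by (rule arg_cong[where f = "(*) h"]) linarith
    also have "(h * (\<Sum>i<n. ?F (?x i)) - integral {0..?x n} ?F) + (h * ?F (?x n) - integral {?x n..?x (Suc n)} ?F)
        = h * (\<Sum>i<Suc n. ?F (?x i)) - integral {0..?x (Suc n)} ?F"
      unfolding comb[symmetric] sum.lessThan_Suc distrib_left by linarith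
    finally show ?case .
  qed simp
  from this[of l] have "\<bar>h * (\<Sum>i<l. ?F (?x i)) - integral {0..?x l} ?F\<bar> \<le> h * ((g (?x l) - g 0) + (f 0 - f (?x l)))"
    by simp
  also have "\<dots> \<le> h * 2"
    using g(2)[of "?x l"] g(2)[of 0] f(2)[of "?x l"] f(2)[of 0] h by (intro mult_left_mono) auto
  finally show ?thesis by (simp add: mult.commute)
qed

lemma has_integral_scaled_Beta:
  assumes t: "t > 0" and c: "c \<ge> 0"
  shows "((\<lambda>s. sqrt (t - s) * s powr c) has_integral t powr (c + 3/2) * Beta (c + 1) (3/2)) {0..t}"
proof -
  have "((\<lambda>x. x powr c * (1 - x) powr (1/2)) has_integral Beta (c + 1) (3/2)) {0..1}"
    using has_integral_Beta_real[of "c + 1" "3/2"] c by simp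
  from has_integral_stretch_real[OF this, of "1 / t"] t
  have "((\<lambda>s. (s / t) powr c * (1 - s / t) powr (1/2)) has_integral t * Beta (c + 1) (3/2)) ((\<lambda>x. x * t) ` {0..1})"
    by simp
  moreover have "(\<lambda>x. x * t) ` {0..1} = {0..t}"
    using t image_mult_atLeastAtMost[of t 0 1] by (simp add: mult.commute)
  ultimately have "((\<lambda>s. (s / t) powr c * (1 - s / t) powr (1/2)) has_integral t * Beta (c + 1) (3/2)) {0..t}"
    by simp
  from has_integral_mult_right[OF this, of "t powr (c + 1/2)"]
  have "((\<lambda>s. t powr (c + 1/2) * ((s / t) powr c * (1 - s / t) powr (1/2))) has_integral
      t powr (c + 1/2) * (t * Beta (c + 1) (3/2))) {0..t}" .
  moreover have "t powr (c + 1/2) * ((s / t) powr c * (1 - s / t) powr (1/2)) = sqrt (t - s) * s powr c"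
    if "s \<in> {0..t}" for s
  proof -
    have "t powr c * (s / t) powr c = s powr c" using t that by (simp add: powr_divide)
    moreover have "t powr (1/2) * (1 - s / t) powr (1/2) = sqrt (t - s)"
    proof -
      have "t powr (1/2) * (1 - s / t) powr (1/2) = (t * (1 - s / t)) powr (1/2)"
        using t that by (simp add: powr_mult)
      also have "t * (1 - s / t) = t - s" using t by (simp add: field_simps)
      finally show ?thesis using that by (simp add: powr_half_sqrt)
    qed
    moreover have "t powr (c + 1/2) * ((s / t) powr c * (1 - s / t) powr (1/2))
        = (t powr c * (s / t) powr c) * (t powr (1/2) * (1 - s / t) powr (1/2))"
      by (simp add: powr_add)
    ultimately show ?thesis by (simp only: mult.commute)
  qed
  moreover have "t powr (c + 1/2) * (t * Beta (c + 1) (3/2)) = t powr (c + 3/2) * Beta (c + 1) (3/2)"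
  proof -
    have "t powr (c + 3/2) = t powr ((c + 1/2) + 1)" by (simp add: field_simps)
    also have "\<dots> = t powr (c + 1/2) * t" using t by (simp only: powr_add powr_one)
    finally show ?thesis by simp
  qed
  ultimately show ?thesis using has_integral_cong by (metis (no_types, lifting))
qed

section \<open>The iterated Riemann sums\<close>

text \<open>The Riemann sums, with mesh \<open>1 / m\<close>, of the iterated integral of
\<open>2\<^sup>k sqrt (l/m - s\<^sub>1) sqrt (s\<^sub>1 - s\<^sub>2) \<dots>\<close> over decreasing \<open>s\<close>, weighted with the function \<open>a\<close> at the last point.\<close>

fun iterated_sum :: "(nat \<Rightarrow> real) \<Rightarrow> nat \<Rightarrow> nat \<Rightarrow> nat \<Rightarrow> real" where
  "iterated_sum a m 0 l = a l"
| "iterated_sum a m (Suc k) l = (\<Sum>i=1..<l. (2 / real m) * sqrt ((real l - real i) / real m) * iterated_sum a m k i)"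

text \<open>The coefficient of \<open>t powr (3 k / 2 + \<alpha>)\<close> in the iterated integral whose innermost function is
\<open>t powr \<alpha>\<close>: each integration against \<open>2 sqrt (t - s)\<close> is a Beta integral.\<close>

primrec iterated_beta :: "real \<Rightarrow> nat \<Rightarrow> real" where
  "iterated_beta \<alpha> 0 = 1"
| "iterated_beta \<alpha> (Suc k) = 2 * iterated_beta \<alpha> k * Beta (3 / 2 * real k + \<alpha> + 1) (3 / 2)"

lemma Gamma_three_halves: "Gamma (3 / 2 :: real) = sqrt pi / 2"
proof -
  have "(1/2 :: real) \<notin> \<int>\<^sub>\<le>\<^sub>0"
    using nonpos_Ints_nonpos[of "1/2 :: real"] by auto
  from Gamma_plus1[OF this] show ?thesis by (simp add: Gamma_one_half_real)
qed

lemma iterated_beta_closed_form: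
  assumes "\<alpha> \<ge> 0"
  shows "iterated_beta \<alpha> k = pi powr (real k / 2) * Gamma (\<alpha> + 1) / Gamma (3 / 2 * real k + \<alpha> + 1)"
proof (induction k)
  case 0
  have "Gamma (\<alpha> + 1) > 0" using assms by (intro Gamma_real_pos) auto
  then show ?case by simp
next
  case (Suc k)
  let ?c = "3 / 2 * real k + \<alpha> + 1"
  have G: "Gamma ?c > 0" using assms by (intro Gamma_real_pos) auto
  have B: "Beta ?c (3 / 2) = Gamma ?c * (sqrt pi / 2) / Gamma (?c + 3 / 2)"
    by (simp only: Beta_def Gamma_three_halves)
  have p: "pi powr (real (Suc k) / 2) = pi powr (real k / 2) * sqrt pi"
    by (simp add: add_divide_distrib powr_add powr_half_sqrt mult.commute)
  have e: "?c + 3 / 2 = 3 / 2 * real (Suc k) + \<alpha> + 1" by (simp add: field_simps)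
  have "iterated_beta \<alpha> (Suc k) = 2 * (pi powr (real k / 2) * Gamma (\<alpha> + 1) / Gamma ?c) * (Gamma ?c * (sqrt pi / 2) / Gamma (?c + 3 / 2))"
    by (simp only: iterated_beta.simps Suc B)
  also have "\<dots> = (pi powr (real k / 2) * sqrt pi) * Gamma (\<alpha> + 1) / Gamma (?c + 3 / 2)"
    using G by (simp add: field_simps)
  finally show ?case by (simp only: p e)
qed

lemma iterated_beta_nonneg: "\<alpha> \<ge> 0 \<Longrightarrow> iterated_beta \<alpha> k \<ge> 0"
  unfolding iterated_beta_closed_form by (intro divide_nonneg_pos mult_nonneg_nonneg Gamma_real_pos) (auto intro: less_imp_le)

text \<open>Induction on \<open>k\<close>. The error of the previous step enters through a sum of at most \<open>m\<close> terms of size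
\<open>O(1 / m\<^sup>2)\<close>, and a new error arises from the Riemann sum of \<open>sqrt (t - s)\<close> (decreasing) times a power of
\<open>s\<close> (increasing).\<close>

lemma iterated_sum_error:
  assumes \<alpha>: "\<alpha> \<ge> 0"
  shows "\<exists>B\<ge>0. \<forall>m\<ge>1. \<forall>l. 1 \<le> l \<longrightarrow> l \<le> m \<longrightarrow>
    \<bar>iterated_sum (\<lambda>l. (real l / real m) powr \<alpha>) m k l - iterated_beta \<alpha> k * (real l / real m) powr (3 / 2 * real k + \<alpha>)\<bar> \<le> B / real m"
proof (induction k)
  case 0
  then show ?case by (intro exI[of _ 0]) auto
next
  case (Suc k)
  then obtain B where B: "B \<ge> 0" "\<And>m l. m \<ge> 1 \<Longrightarrow> 1 \<le> l \<Longrightarrow> l \<le> m \<Longrightarrow>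
    \<bar>iterated_sum (\<lambda>l. (real l / real m) powr \<alpha>) m k l - iterated_beta \<alpha> k * (real l / real m) powr (3 / 2 * real k + \<alpha>)\<bar> \<le> B / real m"
    by blast
  define C where "C = iterated_beta \<alpha> k"
  have C0: "C \<ge> 0" unfolding C_def by (rule iterated_beta_nonneg[OF \<alpha>])
  define c where "c = 3 / 2 * real k + \<alpha>"
  have c0: "c \<ge> 0" using \<alpha> by (simp add: c_def)
  show ?case
  proof (intro exI[of _ "2 * B + 4 * C"] conjI allI impI)
    show "0 \<le> 2 * B + 4 * C" using B(1) C0 by simp
    fix m l :: nat assume ml: "1 \<le> m" "1 \<le> l" "l \<le> m"
    define h where "h = 1 / real m"
    define t where "t = real l * h"
    have h: "h > 0" using ml by (simp add: h_def)
    have t: "0 < t" "t \<le> 1" using ml h by (auto simp: t_def h_def)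
    let ?r = "iterated_sum (\<lambda>l. (real l / real m) powr \<alpha>) m k"
    let ?f = "\<lambda>s. sqrt (t - s)" and ?g = "\<lambda>s::real. s powr c"
    have it: "(\<lambda>s. ?f s * ?g s) integrable_on {0..t}" and
      iv: "integral {0..t} (\<lambda>s. ?f s * ?g s) = t powr (c + 3/2) * Beta (c + 1) (3/2)"
      using has_integral_scaled_Beta[OF t(1) c0] by (auto simp: has_integral_integrable_integral)
    have R: "\<bar>h * (\<Sum>i<l. ?f (real i * h) * ?g (real i * h)) - integral {0..t} (\<lambda>s. ?f s * ?g s)\<bar> \<le> 2 * h"
      unfolding t_def
    proof (rule riemann_sum_monotone_product[OF h], unfold t_def[symmetric])
      fix x assume "0 \<le> x" "x \<le> t"
      then show "0 \<le> x powr c \<and> x powr c \<le> 1" using t c0 by (auto intro: powr_le1)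
    qed (use t c0 it in \<open>auto intro: powr_mono2 simp: real_sqrt_le_1_iff\<close>)
    \<comment> \<open>The term for \<open>i = 0\<close> vanishes, even for exponent zero, because \<open>0 powr c = 0\<close> for all \<open>c\<close>.\<close>
    have drop0: "(\<Sum>i<l. ?f (real i * h) * ?g (real i * h)) = (\<Sum>i=1..<l. ?f (real i * h) * ?g (real i * h))"
    proof -
      have "{..<l} = insert 0 {1..<l}" using ml by auto
      then show ?thesis by simp
    qed
    have fi: "?f (real i * h) = sqrt ((real l - real i) / real m)" for i
      by (simp add: t_def h_def diff_divide_distrib)
    have gi: "?g (real i * h) = (real i / real m) powr c" for i
      by (simp add: h_def)
    have s1: "sqrt ((real l - real i) / real m) \<le> 1" "0 \<le> sqrt ((real l - real i) / real m)" if "i \<in> {1..<l}" for i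
      using that ml by (auto simp: real_sqrt_le_1_iff)
    have "iterated_sum (\<lambda>l. (real l / real m) powr \<alpha>) m (Suc k) l - iterated_beta \<alpha> (Suc k) * (real l / real m) powr (3 / 2 * real (Suc k) + \<alpha>)
      = (\<Sum>i=1..<l. (2 * h) * sqrt ((real l - real i) / real m) * (?r i - C * (real i / real m) powr c))
        + 2 * C * (h * (\<Sum>i<l. ?f (real i * h) * ?g (real i * h)) - integral {0..t} (\<lambda>s. ?f s * ?g s))"
    proof -
      have "t powr (c + 3/2) = (real l / real m) powr (3 / 2 * real (Suc k) + \<alpha>)"
      proof -
        have "c + 3/2 = 3 / 2 * real (Suc k) + \<alpha>" by (simp add: c_def field_simps)
        moreover have "t = real l / real m" by (simp add: t_def h_def)
        ultimately show ?thesis by simp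
      qed
      moreover have "Beta (c + 1) (3/2) = Beta (3 / 2 * real k + \<alpha> + 1) (3 / 2)" by (simp add: c_def)
      ultimately show ?thesis
        unfolding iv drop0 unfolding fi gi
        by (simp add: C_def h_def sum_distrib_left sum_subtractf right_diff_distrib mult_ac)
    qed
    also have "\<bar>\<dots>\<bar> \<le> 2 * h * B + 2 * C * (2 * h)"
    proof (rule order_trans[OF abs_triangle_ineq add_mono])
      have "\<bar>\<Sum>i=1..<l. (2 * h) * sqrt ((real l - real i) / real m) * (?r i - C * (real i / real m) powr c)\<bar>
          \<le> (\<Sum>i=1..<l. 2 * h * (B * h))"
      proof (rule order_trans[OF sum_abs sum_mono])
        fix i assume i: "i \<in> {1..<l}"
        have "\<bar>?r i - C * (real i / real m) powr c\<bar> \<le> B * h"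
          using B(2)[of m i] i ml by (simp add: C_def c_def h_def)
        then have "((2 * h) * sqrt ((real l - real i) / real m)) * \<bar>?r i - C * (real i / real m) powr c\<bar> \<le> ((2 * h) * 1) * (B * h)"
          using s1[OF i] h by (intro mult_mono) auto
        then show "\<bar>(2 * h) * sqrt ((real l - real i) / real m) * (?r i - C * (real i / real m) powr c)\<bar> \<le> 2 * h * (B * h)"
          using s1[OF i] h by (simp add: abs_mult)
      qed
      also have "\<dots> = real (l - 1) * h * (2 * h * B)" by simp
      also have "\<dots> \<le> 1 * (2 * h * B)"
        using ml h B(1) by (intro mult_right_mono) (auto simp: h_def)
      finally show "\<bar>\<Sum>i=1..<l. (2 * h) * sqrt ((real l - real i) / real m) * (?r i - C * (real i / real m) powr c)\<bar> \<le> 2 * h * B"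
        by simp
      show "\<bar>2 * C * (h * (\<Sum>i<l. ?f (real i * h) * ?g (real i * h)) - integral {0..t} (\<lambda>s. ?f s * ?g s))\<bar> \<le> 2 * C * (2 * h)"
        unfolding abs_mult using C0 R by (intro mult_mono) auto
    qed
    also have "\<dots> = (2 * B + 4 * C) / real m" by (simp add: h_def add_divide_distrib)
    finally show "\<bar>iterated_sum (\<lambda>l. (real l / real m) powr \<alpha>) m (Suc k) l - iterated_beta \<alpha> (Suc k) * (real l / real m) powr (3 / 2 * real (Suc k) + \<alpha>)\<bar>
      \<le> (2 * B + 4 * C) / real m" .
  qed
qed

lemma iterated_sum_tendsto:
  assumes "\<alpha> \<ge> 0"
  shows "(\<lambda>n. iterated_sum (\<lambda>l. (real l / real (Suc n)) powr \<alpha>) (Suc n) k (Suc n)) \<longlonglongrightarrow> iterated_beta \<alpha> k"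
proof -
  obtain B where B: "\<And>m l. m \<ge> 1 \<Longrightarrow> 1 \<le> l \<Longrightarrow> l \<le> m \<Longrightarrow>
    \<bar>iterated_sum (\<lambda>l. (real l / real m) powr \<alpha>) m k l - iterated_beta \<alpha> k * (real l / real m) powr (3 / 2 * real k + \<alpha>)\<bar> \<le> B / real m"
    using iterated_sum_error[OF assms, of k] by blast
  have "norm (iterated_sum (\<lambda>l. (real l / real (Suc n)) powr \<alpha>) (Suc n) k (Suc n) - iterated_beta \<alpha> k) \<le> B * inverse (real (Suc n))" for n
  proof -
    have 1: "real (Suc n) / real (Suc n) = 1" by simp
    have "\<bar>iterated_sum (\<lambda>l. (real l / real (Suc n)) powr \<alpha>) (Suc n) k (Suc n)
        - iterated_beta \<alpha> k * (real (Suc n) / real (Suc n)) powr (3 / 2 * real k + \<alpha>)\<bar> \<le> B / real (Suc n)"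
      by (rule B) auto
    then show ?thesis unfolding 1 powr_one_eq_one mult_1_right real_norm_def divide_inverse[of B] .
  qed
  then have "\<forall>n. norm (iterated_sum (\<lambda>l. (real l / real (Suc n)) powr \<alpha>) (Suc n) k (Suc n) - iterated_beta \<alpha> k) \<le> B * inverse (real (Suc n))"
    by blast
  moreover have "(\<lambda>n. B * inverse (real (Suc n))) \<longlonglongrightarrow> 0"
    using tendsto_mult_left[OF LIMSEQ_inverse_real_of_nat, of B] by simp
  ultimately have "(\<lambda>n. iterated_sum (\<lambda>l. (real l / real (Suc n)) powr \<alpha>) (Suc n) k (Suc n) - iterated_beta \<alpha> k) \<longlonglongrightarrow> 0"
    by (rule Lim_null_comparison[OF always_eventually])
  then show ?thesis by (rule LIM_zero_cancel)
qed

section \<open>Zonotopes with self-similar generators\<close>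

fun chain_sum :: "real \<Rightarrow> (nat \<Rightarrow> nat \<Rightarrow> real) \<Rightarrow> nat \<Rightarrow> nat \<Rightarrow> real" where
  "chain_sum c \<rho> 0 l = 1"
| "chain_sum c \<rho> (Suc k) l = (\<Sum>i=1..<l. 2 * c * \<rho> i l * chain_sum c \<rho> k i)"

text \<open>If projecting \<open>G i l\<close> along \<open>G j l\<close> gives \<open>G i j\<close>, then the projected generators are again of the same
kind, with upper end point \<open>j\<close>, and the recursion for \<open>zono_vol\<close> becomes a one-dimensional recursion in
the end point. The generators are listed with decreasing \<open>i\<close>, so that those below the chosen one
are still to come.\<close>

lemma zono_vol_chain_sum:
  fixes G :: "nat \<Rightarrow> nat \<Rightarrow> 'a::real_inner"
  assumes c: "c > 0"
    and perp: "\<And>i j l. 1 \<le> i \<Longrightarrow> i < j \<Longrightarrow> j < l \<Longrightarrow> l \<le> m \<Longrightarrow> perp (G j l) (G i l) = G i j"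
    and norm: "\<And>j l. 1 \<le> j \<Longrightarrow> j < l \<Longrightarrow> l \<le> m \<Longrightarrow> norm (G j l) = \<rho> j l"
    and l: "l \<le> m"
  shows "zono_vol k (map (\<lambda>i. c *\<^sub>R G i l) (rev [1..<l])) = chain_sum c \<rho> k l"
  using l
proof (induction k arbitrary: l)
  case 0
  then show ?case by simp
next
  case (Suc k)
  have "zono_vol (Suc k) (map (\<lambda>i. c *\<^sub>R G i l) (rev [1..<j])) = (\<Sum>i=1..<j. 2 * c * \<rho> i l * chain_sum c \<rho> k i)"
    if "j \<le> l" for j
    using that
  proof (induction j)
    case 0
    then show ?case by simp
  next
    case (Suc j)
    show ?case
    proof (cases "j = 0")
      case False
      then have j: "1 \<le> j" "j < l" using Suc.prems by auto
      have r: "rev [1..<Suc j] = j # rev [1..<j]" using j by simp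
      have mp: "map (perp (c *\<^sub>R G j l)) (map (\<lambda>i. c *\<^sub>R G i l) (rev [1..<j])) = map (\<lambda>i. c *\<^sub>R G i j) (rev [1..<j])"
        using c j Suc.prems \<open>l \<le> m\<close> perp by (auto simp: perp_scale perp_scale_left)
      moreover have "zono_vol k (map (\<lambda>i. c *\<^sub>R G i j) (rev [1..<j])) = chain_sum c \<rho> k j"
        using Suc.prems \<open>l \<le> m\<close> by (intro \<open>\<And>l. l \<le> m \<Longrightarrow> zono_vol k (map (\<lambda>i. c *\<^sub>R G i l) (rev [1..<l])) = chain_sum c \<rho> k l\<close>) auto
      moreover have "norm (c *\<^sub>R G j l) = c * \<rho> j l" using c norm[OF j \<open>l \<le> m\<close>] by simp
      ultimately have "zono_vol (Suc k) (map (\<lambda>i. c *\<^sub>R G i l) (rev [1..<Suc j]))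
          = (\<Sum>i=1..<j. 2 * c * \<rho> i l * chain_sum c \<rho> k i) + 2 * (c * \<rho> j l) * chain_sum c \<rho> k j"
        unfolding r list.map zono_vol.simps mp using Suc.IH Suc.prems by simp
      then show ?thesis using j by simp
    qed simp
  qed
  from this[of l] show ?case by simp
qed

lemma chain_sum_eq_iterated_sum:
  assumes "m \<ge> 1" "l \<ge> 1"
  shows "chain_sum (1 / real m) (\<lambda>i l. sqrt ((real l - real i) / real m)) k l
    = iterated_sum (\<lambda>l. (real l / real m) powr 0) m k l"
  using assms(2)
proof (induction k arbitrary: l)
  case (Suc k)
  then show ?case by (auto intro!: sum.cong)
qed (use assms in simp)

text \<open>The lengths of the bridge generators contain the extra factor \<open>sqrt (i / l)\<close>, which telescopes along
a chain. Multiplying by \<open>sqrt (l / m)\<close> turns it into the weight \<open>sqrt (i / m)\<close> at the last point.\<close>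

lemma chain_sum_bridge_eq_iterated_sum:
  assumes m: "m \<ge> 1" and l: "l \<ge> 1"
  shows "sqrt (real l / real m) * chain_sum (1 / real m) (\<lambda>i l. sqrt ((real l - real i) * real i / (real l * real m))) k l
    = iterated_sum (\<lambda>l. (real l / real m) powr (1 / 2)) m k l"
  using l
proof (induction k arbitrary: l)
  case 0
  then show ?case by (simp add: powr_half_sqrt)
next
  case (Suc k)
  let ?\<rho> = "\<lambda>i l. sqrt ((real l - real i) * real i / (real l * real m))"
  show ?case
    unfolding chain_sum.simps iterated_sum.simps sum_distrib_left
  proof (intro sum.cong refl)
    fix i assume i: "i \<in> {1..<l}"
    have eq: "sqrt (real l / real m) * ?\<rho> i l = sqrt ((real l - real i) / real m) * sqrt (real i / real m)"
      unfolding real_sqrt_mult[symmetric] using m Suc.prems by (intro arg_cong[where f = sqrt]) (simp add: field_simps)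
    have IH: "sqrt (real i / real m) * chain_sum (1 / real m) ?\<rho> k i = iterated_sum (\<lambda>l. (real l / real m) powr (1 / 2)) m k i"
      using Suc.IH[of i] i by simp
    have "sqrt (real l / real m) * (2 * (1 / real m) * ?\<rho> i l * chain_sum (1 / real m) ?\<rho> k i)
        = (2 / real m) * (sqrt (real l / real m) * ?\<rho> i l) * chain_sum (1 / real m) ?\<rho> k i"
      by (simp only: mult_ac times_divide_eq_left times_divide_eq_right mult_1)
    also have "\<dots> = (2 / real m) * sqrt ((real l - real i) / real m) * iterated_sum (\<lambda>l. (real l / real m) powr (1 / 2)) m k i"
      unfolding eq IH[symmetric] by (simp only: mult.assoc)
    finally show "sqrt (real l / real m) * (2 * (1 / real m) * ?\<rho> i l * chain_sum (1 / real m) ?\<rho> k i)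
        = (2 / real m) * sqrt ((real l - real i) / real m) * iterated_sum (\<lambda>l. (real l / real m) powr (1 / 2)) m k i" .
  qed
qed

section \<open>Computing in \<open>L\<^sup>2[0,1]\<close>\<close>

lemma abs_L2_inner:
  assumes "square_integrable f" "square_integrable g"
  shows "abs_L2 f \<bullet> abs_L2 g = (\<integral>x. f x * g x \<partial>leb01)"
  using assms by (intro inner_L2.abs_eq) (auto simp: L2_rel_def)

lemma abs_L2_add:
  assumes "square_integrable f" "square_integrable g"
  shows "abs_L2 f + abs_L2 g = abs_L2 (\<lambda>x. f x + g x)"
  using assms by (intro plus_L2.abs_eq) (auto simp: L2_rel_def)

lemma abs_L2_scale:
  assumes "square_integrable f"
  shows "c *\<^sub>R abs_L2 f = abs_L2 (\<lambda>x. c * f x)"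
  using assms by (intro scaleR_L2.abs_eq) (auto simp: L2_rel_def)

lemma square_integrable_diff:
  assumes "square_integrable f" "square_integrable g"
  shows "square_integrable (\<lambda>x. f x - g x)"
  using square_integrable_add[OF assms(1) square_integrable_scale[OF assms(2), of "-1"]] by simp

lemma abs_L2_diff:
  assumes "square_integrable f" "square_integrable g"
  shows "abs_L2 f - abs_L2 g = abs_L2 (\<lambda>x. f x - g x)"
proof -
  have "abs_L2 f - abs_L2 g = abs_L2 f + (- 1) *\<^sub>R abs_L2 g" by simp
  also have "\<dots> = abs_L2 (\<lambda>x. f x + (- 1) * g x)"
    unfolding abs_L2_scale[OF assms(2)] by (rule abs_L2_add[OF assms(1) square_integrable_scale[OF assms(2)]])
  finally show ?thesis by simp
qed

lemma square_integrable_sum: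
  assumes "\<And>i. i \<in> I \<Longrightarrow> square_integrable (f i)"
  shows "square_integrable (\<lambda>x. \<Sum>i\<in>I. f i x)"
  using assms by (induction I rule: infinite_finite_induct) (auto intro: square_integrable_zero square_integrable_add)

lemma abs_L2_sum:
  assumes "finite I" "\<And>i. i \<in> I \<Longrightarrow> square_integrable (f i)"
  shows "(\<Sum>i\<in>I. abs_L2 (f i)) = abs_L2 (\<lambda>x. \<Sum>i\<in>I. f i x)"
  using assms
proof (induction I rule: finite_induct)
  case empty
  show ?case by (simp add: zero_L2.abs_eq)
next
  case (insert i I)
  then show ?case using abs_L2_add[OF _ square_integrable_sum[of I f]] by simp
qed

text \<open>Identities between step functions fail at the end points of the steps, which form a finite set.\<close>

lemma AE_leb01_not_in_finite:
  assumes "finite N" "\<And>x. x \<in> {0..1} \<Longrightarrow> x \<notin> N \<Longrightarrow> P x"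
  shows "AE x in leb01. P x"
proof -
  have "N \<in> null_sets lebesgue" using assms(1) by (simp add: negligible_finite flip: negligible_iff_null_sets)
  then have "AE x in lebesgue. x \<notin> N" by (rule AE_not_in)
  then have "AE x in lebesgue. x \<in> {0..1} \<longrightarrow> P x"
    by eventually_elim (use assms(2) in auto)
  then show ?thesis by (subst AE_restrict_space_iff) auto
qed

lemma abs_L2_eqI:
  assumes "square_integrable f" "square_integrable g" "finite N"
    "\<And>x. x \<in> {0..1} \<Longrightarrow> x \<notin> N \<Longrightarrow> f x = g x"
  shows "abs_L2 f = abs_L2 g"
  using AE_leb01_not_in_finite[OF assms(3,4)] assms(1,2)
  by (intro Quotient_rel_abs[OF Quotient_L2]) (simp add: L2_rel_def)

lemma norm_abs_L2_mono:
  assumes "square_integrable f" "square_integrable g" "finite N"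
    "\<And>x. x \<in> {0..1} \<Longrightarrow> x \<notin> N \<Longrightarrow> \<bar>f x\<bar> \<le> \<bar>g x\<bar>"
  shows "norm (abs_L2 f) \<le> norm (abs_L2 g)"
proof -
  have "AE x in leb01. f x * f x \<le> g x * g x"
  proof (rule AE_leb01_not_in_finite[OF assms(3)])
    fix x :: real assume "x \<in> {0..1}" "x \<notin> N"
    then have "\<bar>f x\<bar> * \<bar>f x\<bar> \<le> \<bar>g x\<bar> * \<bar>g x\<bar>" using assms(4) by (intro mult_mono) auto
    then show "f x * f x \<le> g x * g x" by simp
  qed
  then have "(\<integral>x. f x * f x \<partial>leb01) \<le> (\<integral>x. g x * g x \<partial>leb01)"
    using assms by (intro integral_mono_AE square_integrable_mult)
  then show ?thesis using assms by (simp add: norm_eq_sqrt_inner abs_L2_inner)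
qed

lemma square_integrable_indicator: "square_integrable (indicator {a..b::real})"
proof -
  have "(indicator {a..b} :: real \<Rightarrow> real) \<in> borel_measurable lebesgue"
    by (intro borel_measurable_indicator) auto
  then have m: "(indicator {a..b} :: real \<Rightarrow> real) \<in> borel_measurable leb01"
    by (rule measurable_restrict_space1)
  moreover have "integrable leb01 (\<lambda>x. (indicator {a..b} x)\<^sup>2 :: real)"
  proof (rule Bochner_Integration.integrable_bound[of _ "\<lambda>_. 1 :: real"])
    show "integrable leb01 (\<lambda>_. 1 :: real)"
      using square_integrable_continuous_on[of "\<lambda>_. 1"] by (simp add: square_integrable_def)
    show "(\<lambda>x. (indicator {a..b} x)\<^sup>2 :: real) \<in> borel_measurable leb01"
      using m by measurable
  qed (auto simp: indicator_def)
  ultimately show ?thesis by (simp add: square_integrable_def)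
qed

definition ind :: "real \<Rightarrow> real \<Rightarrow> L2" where
  "ind a b = abs_L2 (indicator {a..b})"

lemma inner_ind:
  assumes f: "square_integrable f" and ab: "0 \<le> a" "b \<le> 1"
  shows "abs_L2 f \<bullet> ind a b = integral {a..b} f"
proof -
  have "abs_L2 f \<bullet> ind a b = (\<integral>x. f x * indicator {a..b} x \<partial>leb01)"
    unfolding ind_def by (rule abs_L2_inner[OF f square_integrable_indicator])
  also have "\<dots> = integral {0..1} (\<lambda>x. f x * indicator {a..b} x)"
    by (rule lebesgue_integral_eq_integral) (auto intro: square_integrable_mult f square_integrable_indicator)
  also have "(\<lambda>x. f x * indicator {a..b} x) = (\<lambda>x. if x \<in> {a..b} then f x else 0)"
    by (auto simp: indicator_def)
  also have "integral {0..1} \<dots> = integral ({a..b} \<inter> {0..1}) f"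
    by (simp only: integral_restrict_Int Int_commute)
  also have "{a..b} \<inter> {0..1} = {a..b}" using ab by auto
  finally show ?thesis .
qed

lemma inner_ind_ind:
  assumes "0 \<le> a" "a \<le> c" "c \<le> d" "d \<le> b" "b \<le> 1"
  shows "ind a b \<bullet> ind c d = d - c"
proof -
  have "ind a b \<bullet> ind c d = integral {c..d} (indicator {a..b})"
    unfolding ind_def[of a b] using assms by (intro inner_ind square_integrable_indicator) auto
  also have "\<dots> = integral {c..d} (\<lambda>_. 1 :: real)"
    using assms by (intro Henstock_Kurzweil_Integration.integral_cong) (auto simp: indicator_def)
  finally show ?thesis using assms by simp
qed

lemma norm_ind: "0 \<le> a \<Longrightarrow> a \<le> b \<Longrightarrow> b \<le> 1 \<Longrightarrow> norm (ind a b) = sqrt (b - a)"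
  by (simp add: norm_eq_sqrt_inner inner_ind_ind)

lemma ind_split:
  assumes "a \<le> b" "b \<le> c"
  shows "ind a c = ind a b + ind b c"
  unfolding ind_def abs_L2_add[OF square_integrable_indicator square_integrable_indicator]
proof (rule abs_L2_eqI[of _ _ "{b}"])
  fix x :: real assume "x \<notin> {b}"
  then show "indicat_real {a..c} x = indicat_real {a..b} x + indicat_real {b..c} x"
    using assms by (auto simp: indicator_def)
qed (intro square_integrable_add square_integrable_indicator finite.intros)+

lemma ind_self: "ind a a = 0"
proof -
  have "ind a a = ind a a + ind a a" by (rule ind_split) auto
  then show ?thesis by simp
qed

lemma perp_ind:
  assumes "0 \<le> a" "a \<le> b" "b < c" "c \<le> 1"
  shows "perp (ind b c) (ind a c) = ind a b"
proof -
  have "perp (ind b c) (ind a c) = ind a c - ind b c"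
    using assms by (simp add: perp_def inner_ind_ind)
  then show ?thesis using ind_split[of a b c] assms by simp
qed

section \<open>Averaging over the cells of a partition\<close>

lemma lipschitz_square_integrable: "1-lipschitz_on {0..1} f \<Longrightarrow> square_integrable f"
  by (intro square_integrable_continuous_on lipschitz_on_continuous_on)

lemma lipschitz_1_iff:
  "1-lipschitz_on {0..1} (f :: real \<Rightarrow> real) \<longleftrightarrow> (\<forall>s\<in>{0..1}. \<forall>t\<in>{0..1}. s \<le> t \<longrightarrow> \<bar>f t - f s\<bar> \<le> t - s)"
proof
  assume "1-lipschitz_on {0..1} f"
  then show "\<forall>s\<in>{0..1}. \<forall>t\<in>{0..1}. s \<le> t \<longrightarrow> \<bar>f t - f s\<bar> \<le> t - s"
    using lipschitz_onD[of 1 "{0..1}" f] by (fastforce simp: dist_real_def)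
next
  assume h: "\<forall>s\<in>{0..1}. \<forall>t\<in>{0..1}. s \<le> t \<longrightarrow> \<bar>f t - f s\<bar> \<le> t - s"
  show "1-lipschitz_on {0..1} f"
  proof (rule lipschitz_onI)
    fix x y :: real assume "x \<in> {0..1}" "y \<in> {0..1}"
    then show "dist (f x) (f y) \<le> 1 * dist x y"
      using h[rule_format, of x y] h[rule_format, of y x]
      by (cases "x \<le> y") (auto simp: dist_real_def abs_minus_commute)
  qed simp
qed

lemma lipschitz_1D:
  assumes "1-lipschitz_on {0..1} (f :: real \<Rightarrow> real)" "s \<in> {0..1}" "t \<in> {0..1}" "\<bar>s - t\<bar> \<le> d"
  shows "\<bar>f s - f t\<bar> \<le> d"
  using lipschitz_onD[OF assms(1-3)] assms(4) by (simp add: dist_real_def)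

definition cell :: "nat \<Rightarrow> nat \<Rightarrow> L2" where
  "cell m j = ind (real j / real m) (real (Suc j) / real m)"

text \<open>The orthogonal projection onto the functions that are constant on the \<open>m\<close> cells. Unlike interpolation
at the grid points it is defined on classes modulo null sets and linear on all of \<open>L2\<close>.\<close>

definition averaging :: "nat \<Rightarrow> L2 \<Rightarrow> L2" where
  "averaging m x = (\<Sum>j<m. (real m * (x \<bullet> cell m j)) *\<^sub>R cell m j)"

lemma linear_averaging: "linear (averaging m)"
  unfolding averaging_def
  by (rule linearI) (simp_all add: inner_add_left distrib_left scaleR_add_left sum.distrib scaleR_sum_right mult.left_commute)

definition cell_mean :: "nat \<Rightarrow> (real \<Rightarrow> real) \<Rightarrow> nat \<Rightarrow> real" where
  "cell_mean m f j = real m * integral {real j / real m..real (Suc j) / real m} f"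

lemma cell_bounds:
  assumes "j < m"
  shows "0 \<le> real j / real m" "real j / real m \<le> real (Suc j) / real m" "real (Suc j) / real m \<le> 1"
    "real (Suc j) / real m - real j / real m = 1 / real m"
  using assms by (auto simp: field_simps)

lemma inner_cell:
  assumes "square_integrable f" "j < m"
  shows "real m * (abs_L2 f \<bullet> cell m j) = cell_mean m f j"
  unfolding cell_def cell_mean_def using cell_bounds[OF assms(2)] assms(1) by (simp add: inner_ind)

lemma cell_mean_bound:
  assumes j: "j < m" and g: "continuous_on {real j / real m..real (Suc j) / real m} g"
    and B: "\<And>s. s \<in> {real j / real m..real (Suc j) / real m} \<Longrightarrow> \<bar>g s\<bar> \<le> B"
  shows "\<bar>cell_mean m g j\<bar> \<le> B"
proof -
  have "norm (integral {real j / real m..real (Suc j) / real m} g) \<le> B * (real (Suc j) / real m - real j / real m)"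
    by (rule integral_bound[OF cell_bounds(2)[OF j] g]) (use B in auto)
  then have "real m * \<bar>integral {real j / real m..real (Suc j) / real m} g\<bar> \<le> real m * (B * (1 / real m))"
    unfolding cell_bounds(4)[OF j] by (intro mult_left_mono) auto
  then show ?thesis using j by (simp add: cell_mean_def abs_mult)
qed

lemma cell_mean_diff:
  assumes "continuous_on {real j / real m..real (Suc j) / real m} f" "continuous_on {real j / real m..real (Suc j) / real m} g"
  shows "cell_mean m f j - cell_mean m g j = cell_mean m (\<lambda>s. f s - g s) j"
  unfolding cell_mean_def
  using Henstock_Kurzweil_Integration.integral_diff[OF integrable_continuous_real[OF assms(1)] integrable_continuous_real[OF assms(2)]]
  by (simp add: right_diff_distrib)

lemma cell_mean_const: "j < m \<Longrightarrow> cell_mean m (\<lambda>_. c) j = c"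
  using cell_bounds(2,4)[of j m] by (simp add: cell_mean_def)

lemma cell_mean_close:
  assumes f: "1-lipschitz_on {0..1} f" and j: "j < m" and x: "x \<in> {real j / real m..real (Suc j) / real m}"
  shows "\<bar>f x - cell_mean m f j\<bar> \<le> 1 / real m"
proof -
  let ?I = "{real j / real m..real (Suc j) / real m}"
  have sub: "?I \<subseteq> {0..1}" using cell_bounds[OF j] by auto
  have c: "continuous_on ?I f"
    by (rule continuous_on_subset[OF lipschitz_on_continuous_on[OF f] sub])
  have "f x - cell_mean m f j = cell_mean m (\<lambda>s. f x - f s) j"
    using cell_mean_diff[OF continuous_on_const c, of "f x"] cell_mean_const[OF j, of "f x"] by simp
  also have "\<bar>\<dots>\<bar> \<le> 1 / real m"
  proof (rule cell_mean_bound[OF j])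
    fix s assume s: "s \<in> ?I"
    have "\<bar>x - s\<bar> \<le> 1 / real m"
      using x s cell_bounds(4)[OF j] unfolding atLeastAtMost_iff abs_le_iff by linarith
    moreover have "x \<in> {0..1}" "s \<in> {0..1}" using x s sub by blast+
    ultimately show "\<bar>f x - f s\<bar> \<le> 1 / real m" by (intro lipschitz_1D[OF f])
  qed (intro continuous_intros c)
  finally show ?thesis .
qed

text \<open>Neighbouring means differ by the mean of \<open>f (s + 1/m) - f s\<close>.\<close>

lemma cell_mean_increment:
  assumes f: "1-lipschitz_on {0..1} f" and j: "Suc j < m"
  shows "\<bar>cell_mean m f (Suc j) - cell_mean m f j\<bar> \<le> 1 / real m"
proof -
  let ?I = "{real j / real m..real (Suc j) / real m}"
  have j': "j < m" using j by simp
  have sub: "?I \<subseteq> {0..1}" using cell_bounds[OF j'] by auto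
  have up: "s + 1 / real m \<in> {0..1}" if "s \<in> ?I" for s
  proof -
    have "0 \<le> s" "s + 1 / real m \<le> 1"
      using that cell_bounds(3,4)[OF j] cell_bounds(1)[OF j'] unfolding atLeastAtMost_iff by linarith+
    then show ?thesis by simp
  qed
  have c: "continuous_on ?I f"
    by (rule continuous_on_subset[OF lipschitz_on_continuous_on[OF f] sub])
  have c': "continuous_on ?I (\<lambda>s. f (s + 1 / real m))"
    by (rule continuous_on_compose2[OF lipschitz_on_continuous_on[OF f]]) (use up in \<open>auto intro!: continuous_intros\<close>)
  have "integral ?I (f \<circ> (+) (1 / real m)) = integral {real (Suc j) / real m..real (Suc (Suc j)) / real m} f"
    unfolding integral_shift_Icc_real by (simp add: add_divide_distrib add.commute)
  then have "cell_mean m f (Suc j) = cell_mean m (\<lambda>s. f (s + 1 / real m)) j"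
    by (simp add: cell_mean_def comp_def add.commute)
  then have "cell_mean m f (Suc j) - cell_mean m f j = cell_mean m (\<lambda>s. f (s + 1 / real m) - f s) j"
    using cell_mean_diff[OF c' c] by simp
  also have "\<bar>\<dots>\<bar> \<le> 1 / real m"
  proof (rule cell_mean_bound[OF j'])
    fix s assume s: "s \<in> ?I"
    show "\<bar>f (s + 1 / real m) - f s\<bar> \<le> 1 / real m"
    proof (rule lipschitz_1D[OF f up[OF s]])
      show "s \<in> {0..1}" using s sub by blast
    qed simp
  qed (intro continuous_intros c c')
  finally show ?thesis .
qed

lemma averaging_abs_L2:
  assumes "square_integrable f"
  shows "averaging m (abs_L2 f) = (\<Sum>j<m. cell_mean m f j *\<^sub>R cell m j)"
  unfolding averaging_def using inner_cell[OF assms] by (intro sum.cong) auto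

text \<open>Away from the grid points exactly one cell contains a given point, and there the mean differs from the
value of \<open>f\<close> by at most the length of the cell.\<close>

lemma norm_averaging_error:
  assumes f: "1-lipschitz_on {0..1} f" and m: "m \<ge> 1"
  shows "norm (abs_L2 f - averaging m (abs_L2 f)) \<le> 1 / real m"
proof -
  let ?c = "\<lambda>j. {real j / real m..real (Suc j) / real m}"
  have fi: "square_integrable f" by (rule lipschitz_square_integrable[OF f])
  have gi: "square_integrable (\<lambda>x. \<Sum>j<m. cell_mean m f j * indicator (?c j) x)"
    by (intro square_integrable_sum square_integrable_scale square_integrable_indicator)
  have "averaging m (abs_L2 f) = (\<Sum>j<m. abs_L2 (\<lambda>x. cell_mean m f j * indicator (?c j) x))"
    unfolding averaging_abs_L2[OF fi] cell_def ind_def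
    by (intro sum.cong refl abs_L2_scale square_integrable_indicator)
  also have "\<dots> = abs_L2 (\<lambda>x. \<Sum>j<m. cell_mean m f j * indicator (?c j) x)"
    by (intro abs_L2_sum square_integrable_scale square_integrable_indicator) simp
  finally have "abs_L2 f - averaging m (abs_L2 f) = abs_L2 (\<lambda>x. f x - (\<Sum>j<m. cell_mean m f j * indicator (?c j) x))"
    using abs_L2_diff[OF fi gi] by simp
  also have "norm \<dots> \<le> norm (abs_L2 (\<lambda>x. (1 / real m) * indicator {0..1} x))"
  proof (rule norm_abs_L2_mono[of _ _ "(\<lambda>j. real j / real m) ` {..m}"])
    fix x :: real assume x: "x \<in> {0..1}" "x \<notin> (\<lambda>j. real j / real m) ` {..m}"
    define j where "j = nat \<lfloor>real m * x\<rfloor>"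
    have j1: "real j \<le> real m * x" "real m * x < real (Suc j)"
      using x m by (auto simp: j_def) linarith+
    have "x \<noteq> 1" using x(2) m by (auto intro!: image_eqI[of _ _ m])
    then have "x < 1" using x by simp
    then have "real m * x < real m" using m by simp
    then have jm: "j < m" using j1 by linarith
    have xj: "x \<in> ?c j" using j1 m by (auto simp: field_simps)
    have "(\<Sum>i<m. cell_mean m f i * indicator (?c i) x) = (\<Sum>i<m. if i = j then cell_mean m f j else 0)"
    proof (intro sum.cong refl)
      fix i assume i: "i \<in> {..<m}"
      have "x \<notin> ?c i" if "i \<noteq> j"
      proof
        assume "x \<in> ?c i"
        then have "real i \<le> real m * x" "real m * x \<le> real (Suc i)" using m by (auto simp: field_simps)
        then have "i \<le> j" "j \<le> Suc i" using j1 by linarith+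
        \<comment> \<open>Two closed cells only share a grid point, and these are excluded.\<close>
        then have "j = Suc i" using that by simp
        then have "real m * x = real j" using j1 \<open>real m * x \<le> real (Suc i)\<close> by simp
        then have "x = real j / real m" using m by (simp add: field_simps)
        then show False using x(2) jm by auto
      qed
      then show "cell_mean m f i * indicator (?c i) x = (if i = j then cell_mean m f j else 0)"
        using xj by (auto simp: indicator_def)
    qed
    then have "(\<Sum>i<m. cell_mean m f i * indicator (?c i) x) = cell_mean m f j" using jm by simp
    then show "\<bar>f x - (\<Sum>j<m. cell_mean m f j * indicator (?c j) x)\<bar> \<le> \<bar>(1 / real m) * indicator {0..1} x\<bar>"
      using cell_mean_close[OF f jm xj] x by simp
  qed (intro square_integrable_diff fi gi square_integrable_scale square_integrable_indicator finite_imageI finite_atMost)+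
  also have "abs_L2 (\<lambda>x. (1 / real m) * indicator {0..1} x) = (1 / real m) *\<^sub>R ind 0 1"
    unfolding ind_def by (rule abs_L2_scale[OF square_integrable_indicator, symmetric])
  finally show ?thesis by (simp add: norm_ind)
qed

lemma sum_by_parts:
  fixes a :: "nat \<Rightarrow> real" and v :: "nat \<Rightarrow> 'a::real_vector"
  shows "(\<Sum>j<Suc n. a j *\<^sub>R (v j - v (Suc j)))
    = a 0 *\<^sub>R v 0 + (\<Sum>i=1..<Suc n. (a i - a (i - 1)) *\<^sub>R v i) - a n *\<^sub>R v (Suc n)"
  by (induction n) (simp_all add: algebra_simps)

text \<open>The generators of the zonotope that discretises the zonoid \<open>\<integral> [-1_{(s,1]}, 1_{(s,1]}] ds\<close>. The order is
the one for which successive projections act by cutting intervals.\<close>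

definition steps :: "nat \<Rightarrow> L2 list" where
  "steps m = map (\<lambda>i. (1 / real m) *\<^sub>R ind (real i / real m) 1) (rev [1..<m])"

text \<open>Summation by parts writes the step function as a combination of indicators of \<open>[i/m, 1]\<close> whose
coefficients are the increments of the means. The first coefficient, the mean over the first cell, is
small only because \<open>f 0 = 0\<close>; it accounts for the additional generator.\<close>

lemma averaging_in_zono:
  assumes f: "1-lipschitz_on {0..1} f" "f 0 = 0" and m: "m \<ge> 1"
  shows "averaging m (abs_L2 f) \<in> zono ((1 / real m) *\<^sub>R ind 0 1 # steps m)"
proof -
  obtain n where n: "m = Suc n" using m by (cases m) auto
  let ?I = "\<lambda>i. ind (real i / real m) 1"
  let ?a = "cell_mean m f"
  have "averaging m (abs_L2 f) = (\<Sum>j<m. ?a j *\<^sub>R (?I j - ?I (Suc j)))"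
    unfolding averaging_abs_L2[OF lipschitz_square_integrable[OF f(1)]]
  proof (intro sum.cong refl)
    fix j assume "j \<in> {..<m}"
    then have "?I j = cell m j + ?I (Suc j)"
      unfolding cell_def using cell_bounds[of j m] by (intro ind_split) auto
    then show "?a j *\<^sub>R cell m j = ?a j *\<^sub>R (?I j - ?I (Suc j))" by simp
  qed
  also have "\<dots> = ?a 0 *\<^sub>R ?I 0 + (\<Sum>i=1..<m. (?a i - ?a (i - 1)) *\<^sub>R ?I i) - ?a n *\<^sub>R ?I m"
    unfolding n by (rule sum_by_parts)
  also have "?I m = 0" using m by (simp add: ind_self)
  also have "?a 0 *\<^sub>R ?I 0 + (\<Sum>i=1..<m. (?a i - ?a (i - 1)) *\<^sub>R ?I i) - ?a n *\<^sub>R 0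
      = ?a 0 *\<^sub>R ind 0 1 + (\<Sum>i\<leftarrow>rev [1..<m]. (?a i - ?a (i - 1)) *\<^sub>R ?I i)"
    by (simp add: sum_list_distinct_conv_sum_set)
  also have "\<dots> \<in> zono ((1 / real m) *\<^sub>R ind 0 1 # steps m)"
    unfolding zono.simps steps_def
  proof (intro set_plus_intro scaleR_in_seg sum_in_zono)
    have "\<bar>f 0 - ?a 0\<bar> \<le> 1 / real m"
      using m by (intro cell_mean_close[OF f(1)]) auto
    then show "\<bar>?a 0\<bar> \<le> 1 / real m" using f(2) by simp
    fix i assume "i \<in> set (rev [1..<m])"
    then have "1 \<le> i" "i < m" by auto
    then obtain j where "i = Suc j" "Suc j < m" by (cases i) auto
    then show "\<bar>?a i - ?a (i - 1)\<bar> \<le> 1 / real m" using cell_mean_increment[OF f(1), of j m] by simp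
  qed
  finally show ?thesis .
qed

section \<open>Zonotopes inside the Lipschitz ball\<close>

text \<open>The integral from \<open>0\<close> to \<open>t\<close> of the indicator of the cell that ends at \<open>i/m\<close>: a continuous replacement for
the step of height \<open>1/m\<close> at \<open>i/m\<close>.\<close>

definition ramp_fun :: "nat \<Rightarrow> nat \<Rightarrow> real \<Rightarrow> real" where
  "ramp_fun m i t = min t (real i / real m) - min t (real (i - 1) / real m)"

definition ramp :: "nat \<Rightarrow> nat \<Rightarrow> L2" where
  "ramp m i = abs_L2 (ramp_fun m i)"

lemma square_integrable_ramp: "square_integrable (ramp_fun m i)"
  unfolding ramp_fun_def[abs_def] by (intro square_integrable_continuous_on continuous_intros)

lemma ramp_fun_bounds:
  assumes "1 \<le> i" "i \<le> m" "0 \<le> t"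
  shows "0 \<le> ramp_fun m i t" "ramp_fun m i t \<le> 1 / real m"
proof -
  have "real i / real m = real (i - 1) / real m + 1 / real m"
    using assms by (simp add: of_nat_diff diff_divide_distrib)
  moreover have "0 \<le> 1 / real m" by simp
  ultimately show "0 \<le> ramp_fun m i t" "ramp_fun m i t \<le> 1 / real m"
    unfolding ramp_fun_def by linarith+
qed

lemma norm_ramp_le:
  assumes "1 \<le> i" "i \<le> m"
  shows "norm (ramp m i) \<le> 1 / real m"
proof -
  have "norm (ramp m i) \<le> norm (abs_L2 (\<lambda>x. (1 / real m) * indicator {0..1} x))"
    unfolding ramp_def
  proof (rule norm_abs_L2_mono[of _ _ "{}"])
    fix x :: real assume "x \<in> {0..1}"
    then show "\<bar>ramp_fun m i x\<bar> \<le> \<bar>(1 / real m) * indicator {0..1} x\<bar>"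
      using ramp_fun_bounds[OF assms, of x] by simp
  qed (intro square_integrable_ramp square_integrable_scale square_integrable_indicator finite.emptyI)+
  also have "abs_L2 (\<lambda>x. (1 / real m) * indicator {0..1} x) = (1 / real m) *\<^sub>R ind 0 1"
    unfolding ind_def by (rule abs_L2_scale[OF square_integrable_indicator, symmetric])
  finally show ?thesis by (simp add: norm_ind)
qed

lemma norm_step_minus_ramp_le:
  assumes "1 \<le> i" "i \<le> m"
  shows "norm ((1 / real m) *\<^sub>R ind (real i / real m) 1 - ramp m i) \<le> (1 / real m) * sqrt (1 / real m)"
proof -
  let ?a = "real (i - 1) / real m" and ?b = "real i / real m"
  have ab: "?b = ?a + 1 / real m"
    using assms by (simp add: of_nat_diff diff_divide_distrib)
  have m0: "0 \<le> 1 / real m" by simp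
  have b1: "?b \<le> 1" using assms by simp
  have si: "square_integrable (\<lambda>x. (1 / real m) * indicator {u..v} x)" for u v
    by (intro square_integrable_scale square_integrable_indicator)
  have "(1 / real m) *\<^sub>R ind ?b 1 - ramp m i = abs_L2 (\<lambda>x. (1 / real m) * indicator {?b..1} x - ramp_fun m i x)"
    unfolding ind_def ramp_def abs_L2_scale[OF square_integrable_indicator]
    by (rule abs_L2_diff[OF si square_integrable_ramp])
  also have "norm \<dots> \<le> norm (abs_L2 (\<lambda>x. (1 / real m) * indicator {?a..?b} x))"
  proof (rule norm_abs_L2_mono[of _ _ "{}"])
    fix x :: real assume x: "x \<in> {0..1}"
    consider "x < ?a" | "?a \<le> x" "x < ?b" | "?b \<le> x" by linarith
    then show "\<bar>(1 / real m) * indicator {?b..1} x - ramp_fun m i x\<bar> \<le> \<bar>(1 / real m) * indicator {?a..?b} x\<bar>"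
    proof cases
      case 1
      then have "ramp_fun m i x = 0" using ab m0 unfolding ramp_fun_def by linarith
      moreover have "x < ?b" using 1 ab m0 by linarith
      then have "x \<notin> {?b..1}" by simp
      ultimately show ?thesis by simp
    next
      case 2
      then have "x \<in> {?a..?b}" "x \<notin> {?b..1}" by auto
      then show ?thesis using ramp_fun_bounds[OF assms, of x] x by simp
    next
      case 3
      then have "ramp_fun m i x = 1 / real m" using ab m0 unfolding ramp_fun_def by linarith
      moreover have "x \<in> {?b..1}" using 3 x by auto
      ultimately show ?thesis by simp
    qed
  qed (intro square_integrable_diff si square_integrable_ramp finite.emptyI)+
  also have "abs_L2 (\<lambda>x. (1 / real m) * indicator {?a..?b} x) = (1 / real m) *\<^sub>R ind ?a ?b"
    unfolding ind_def by (rule abs_L2_scale[OF square_integrable_indicator, symmetric])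
  also have "norm \<dots> = (1 / real m) * sqrt (1 / real m)"
    using ab b1 m0 by (simp add: norm_ind)
  finally show ?thesis .
qed

lemma zono_map_elements:
  assumes "distinct is" "y \<in> zono (map v is)"
  shows "\<exists>a. (\<forall>i. \<bar>a i\<bar> \<le> 1) \<and> y = (\<Sum>i\<in>set is. a i *\<^sub>R v i)"
  using assms
proof (induction "is" arbitrary: y)
  case Nil
  then show ?case by (intro exI[of _ "\<lambda>_. 0"]) simp
next
  case (Cons j js)
  from Cons.prems(2) obtain s x where sx: "s \<in> seg (v j)" "x \<in> zono (map v js)" "y = s + x"
    by (auto elim: set_plus_elim)
  then have "\<exists>t. s = t *\<^sub>R v j \<and> \<bar>t\<bar> \<le> 1" by (auto simp: seg_def abs_le_iff)
  then obtain t where t: "s = t *\<^sub>R v j" "\<bar>t\<bar> \<le> 1" by blast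
  obtain a where a: "\<forall>i. \<bar>a i\<bar> \<le> 1" "x = (\<Sum>i\<in>set js. a i *\<^sub>R v i)"
    using Cons sx(2) by auto
  have "(\<Sum>i\<in>set js. (a(j := t)) i *\<^sub>R v i) = x"
    unfolding a(2) using Cons.prems(1) by (intro sum.cong) auto
  then have "y = (\<Sum>i\<in>set (j # js). (a(j := t)) i *\<^sub>R v i)"
    using sx t Cons.prems(1) by simp
  moreover have "\<forall>i. \<bar>(a(j := t)) i\<bar> \<le> 1" using a t by simp
  ultimately show ?case by blast
qed

text \<open>The ramps are increasing, and they add up to a function that never grows faster than the identity;
coefficients in \<open>[-1, 1]\<close> then give Lipschitz constant \<open>1\<close>.\<close>

lemma zono_ramps_subset_K_BM: "zono (map (ramp m) (rev [1..<m])) \<subseteq> K_BM"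
proof
  fix y assume "y \<in> zono (map (ramp m) (rev [1..<m]))"
  then obtain a where a: "\<forall>i. \<bar>a i\<bar> \<le> 1" "y = (\<Sum>i\<in>{1..<m}. a i *\<^sub>R ramp m i)"
    using zono_map_elements[of "rev [1..<m]" y "ramp m"] by auto
  define f where "f t = (\<Sum>i\<in>{1..<m}. a i * ramp_fun m i t)" for t
  have "y = (\<Sum>i\<in>{1..<m}. abs_L2 (\<lambda>t. a i * ramp_fun m i t))"
    unfolding a(2) ramp_def by (intro sum.cong refl abs_L2_scale square_integrable_ramp)
  also have "\<dots> = abs_L2 f"
    unfolding f_def by (intro abs_L2_sum square_integrable_scale square_integrable_ramp) simp
  finally have "y = abs_L2 f" .
  moreover have "f 0 = 0" by (simp add: f_def ramp_fun_def)
  moreover have "1-lipschitz_on {0..1} f"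
    unfolding lipschitz_1_iff
  proof (intro ballI impI)
    fix s t :: real assume st: "s \<in> {0..1}" "t \<in> {0..1}" "s \<le> t"
    have mono: "ramp_fun m i s \<le> ramp_fun m i t" if "i \<ge> 1" for i
    proof -
      have "real (i - 1) / real m \<le> real i / real m" by (intro divide_right_mono) auto
      then show ?thesis using st(3) unfolding ramp_fun_def by linarith
    qed
    have tel: "(\<Sum>i\<in>{1..<Suc n}. ramp_fun m i u) = min u (real n / real m) - min u 0" for n u
      by (induction n) (simp_all add: ramp_fun_def)
    have "\<bar>f t - f s\<bar> = \<bar>\<Sum>i\<in>{1..<m}. a i * (ramp_fun m i t - ramp_fun m i s)\<bar>"
      by (simp add: f_def sum_subtractf right_diff_distrib)
    also have "\<dots> \<le> (\<Sum>i\<in>{1..<m}. ramp_fun m i t - ramp_fun m i s)"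
    proof (rule order_trans[OF sum_abs sum_mono])
      fix i assume "i \<in> {1..<m}"
      then have d: "0 \<le> ramp_fun m i t - ramp_fun m i s" using mono by simp
      have "\<bar>a i\<bar> * (ramp_fun m i t - ramp_fun m i s) \<le> 1 * (ramp_fun m i t - ramp_fun m i s)"
        using a(1) d by (intro mult_right_mono) auto
      then show "\<bar>a i * (ramp_fun m i t - ramp_fun m i s)\<bar> \<le> ramp_fun m i t - ramp_fun m i s"
        using d by (simp add: abs_mult)
    qed
    also have "\<dots> \<le> t - s"
    proof (cases m)
      case (Suc n)
      have "(\<Sum>i\<in>{1..<m}. ramp_fun m i t - ramp_fun m i s)
          = (min t (real n / real m) - min t 0) - (min s (real n / real m) - min s 0)"
        unfolding sum_subtractf using tel[of t n] tel[of s n] by (simp only: Suc)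
      also have "\<dots> \<le> t - s" using st by auto
      finally show ?thesis .
    qed (use st in simp)
    finally show "\<bar>f t - f s\<bar> \<le> t - s" .
  qed
  ultimately show "y \<in> K_BM" by (auto simp: K_BM_def)
qed

lemma zono_map_add_subset:
  "zono (map (\<lambda>i. a i + b i) is) \<subseteq> zono (map a is @ map b is)"
  unfolding zono_append
proof (induction "is")
  case (Cons i js)
  have "seg (a i + b i) \<subseteq> seg (a i) + seg (b i)"
    unfolding seg_def by (auto simp: scaleR_add_right intro!: set_plus_intro)
  from set_plus_mono2[OF this Cons] show ?case by (simp add: ac_simps)
qed simp

section \<open>Intrinsic volumes of images of the Lipschitz ball\<close>

lemma sum_list_norm_le:
  assumes "\<And>x. x \<in> set xs \<Longrightarrow> norm (x :: 'a::real_normed_vector) \<le> c" "real (length xs) * c \<le> d"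
  shows "(\<Sum>x\<leftarrow>xs. norm x) \<le> d"
proof -
  have "(\<Sum>x\<leftarrow>xs. norm x) \<le> real (length xs) * c"
    using assms(1) by (induction xs) (auto simp: algebra_simps intro: add_mono)
  then show ?thesis using assms(2) by simp
qed

text \<open>One argument covers both Lipschitz classes: \<open>Q\<close> is the identity for the first and the projection
along the constant functions for the second. The zonotopes generated by the steps bound the set from
outside; those generated by the ramps lie inside it and differ by generators of total length at most
\<open>sqrt (1 / m)\<close>.\<close>

lemma intrinsic_volume_linear_image_K_BM:
  fixes Q :: "L2 \<Rightarrow> L2"
  assumes Q: "linear Q" "\<And>x. norm (Q x) \<le> norm x"
    and QJ: "\<And>m x. m \<ge> 1 \<Longrightarrow> Q (averaging m (Q x)) = Q (averaging m x)"
    and k: "k \<ge> 1" and s: "s > 0"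
    and L: "(\<lambda>n. zono_vol k (map Q (steps (Suc n)))) \<longlonglongrightarrow> L"
  shows "intrinsic_volume k ((\<lambda>x. c + s *\<^sub>R x) ` Q ` K_BM) = ennreal (s ^ k * L)"
proof -
  obtain k' where k': "k = Suc k'" using k by (cases k) auto
  define h where "h n = inverse (real (Suc n))" for n
  have h: "h n > 0" "h n \<le> 1" for n by (auto simp: h_def field_simps)
  have hm: "1 / real (Suc n) = h n" for n by (simp add: h_def inverse_eq_divide)
  have h0: "h \<longlonglongrightarrow> 0" unfolding h_def by (rule LIMSEQ_inverse_real_of_nat)
  have sh0: "(\<lambda>n. sqrt (h n)) \<longlonglongrightarrow> 0" using tendsto_real_sqrt[OF h0] by simp
  have Q0: "Q 0 = 0" using Q(1) by (rule linear_0)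
  define W where "W n = map Q (steps (Suc n))" for n
  define ws where "ws n = [Q (h n *\<^sub>R ind 0 1)] @ W n" for n
  define vs where "vs n = map (\<lambda>i. Q (ramp (Suc n) i)) (rev [1..<Suc n])" for n
  define rs where "rs n = map (\<lambda>i. Q (h n *\<^sub>R ind (real i / real (Suc n)) 1 - ramp (Suc n) i)) (rev [1..<Suc n])" for n
  have i01: "norm (ind 0 1) = 1" by (simp add: norm_ind)
  have hd: "norm (Q (h n *\<^sub>R ind 0 1)) \<le> h n" for n
    using Q(2)[of "h n *\<^sub>R ind 0 1"] h[of n] i01 by simp
  have Wn: "(\<Sum>w\<leftarrow>W n. norm w) \<le> 1" for n
  proof (rule sum_list_norm_le[of _ "h n"])
    fix x assume "x \<in> set (W n)"
    then obtain i where i: "1 \<le> i" "i < Suc n" "x = Q (h n *\<^sub>R ind (real i / real (Suc n)) 1)"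
      by (auto simp: W_def steps_def hm simp del: of_nat_Suc)
    have "norm x \<le> norm (h n *\<^sub>R ind (real i / real (Suc n)) 1)" unfolding i(3) by (rule Q(2))
    also have "\<dots> = h n * sqrt (1 - real i / real (Suc n))"
      using i h[of n] by (subst norm_scaleR, subst norm_ind) auto
    also have "\<dots> \<le> h n * 1"
      using h[of n] i by (intro mult_left_mono) (auto simp: real_sqrt_le_1_iff)
    finally show "norm x \<le> h n" by simp
  next
    show "real (length (W n)) * h n \<le> 1" by (simp add: W_def steps_def h_def field_simps)
  qed
  have vsn: "(\<Sum>w\<leftarrow>vs n. norm w) \<le> 1" for n
  proof (rule sum_list_norm_le[of _ "h n"])
    fix x assume "x \<in> set (vs n)"
    then obtain i where i: "1 \<le> i" "i \<le> Suc n" "x = Q (ramp (Suc n) i)" by (auto simp: vs_def)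
    then show "norm x \<le> h n" using Q(2) norm_ramp_le[OF i(1,2)] hm[of n] order_trans by metis
  next
    show "real (length (vs n)) * h n \<le> 1" by (simp add: vs_def h_def field_simps)
  qed
  have rsn: "(\<Sum>w\<leftarrow>rs n. norm w) \<le> sqrt (h n)" for n
  proof (rule sum_list_norm_le[of _ "h n * sqrt (h n)"])
    fix x assume "x \<in> set (rs n)"
    then obtain i where i: "1 \<le> i" "i \<le> Suc n" "x = Q (h n *\<^sub>R ind (real i / real (Suc n)) 1 - ramp (Suc n) i)"
      by (auto simp: rs_def)
    then show "norm x \<le> h n * sqrt (h n)"
      using Q(2) norm_step_minus_ramp_le[OF i(1,2)] hm[of n] order_trans by metis
  next
    have "(real n * h n) * sqrt (h n) \<le> 1 * sqrt (h n)"
      using h[of n] by (intro mult_right_mono) (auto simp: h_def field_simps)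
    then show "real (length (rs n)) * (h n * sqrt (h n)) \<le> sqrt (h n)"
      by (simp only: rs_def length_map length_rev length_upt mult.assoc mult_1 diff_Suc_1)
  qed
  define u where "u n = zono_vol k (W n) + 2 * h n * (2 * (h n + 1)) ^ k'" for n
  define l where "l n = zono_vol k (W n) - 2 * sqrt (h n) * (2 * (sqrt (h n) + 1)) ^ k'" for n
  show ?thesis
  proof (rule intrinsic_volume_of_approximable[OF k s, where J = "\<lambda>n x. Q (averaging (Suc n) x)" and ws = ws and
      \<epsilon> = h and S = 2 and u = u and vs = vs and l = l])
    show "linear (\<lambda>x. Q (averaging (Suc m) x))" for m
      using linear_compose[OF linear_averaging[of "Suc m"] Q(1)] by (simp add: comp_def)
    fix m x
    assume "x \<in> Q ` K_BM"
    then obtain f where f: "1-lipschitz_on {0..1} f" "f 0 = 0" "x = Q (abs_L2 f)" by (auto simp: K_BM_def)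
    have eq: "Q (averaging (Suc m) x) = Q (averaging (Suc m) (abs_L2 f))"
      unfolding f(3) by (rule QJ) simp
    have "averaging (Suc m) (abs_L2 f) \<in> zono (h m *\<^sub>R ind 0 1 # steps (Suc m))"
      using averaging_in_zono[OF f(1,2), of "Suc m"] by (simp only: hm)
    then have "Q (averaging (Suc m) (abs_L2 f)) \<in> Q ` zono (h m *\<^sub>R ind 0 1 # steps (Suc m))" by (rule imageI)
    then show "Q (averaging (Suc m) x) \<in> zono (ws m)"
      unfolding eq linear_image_zono[OF Q(1)] by (simp add: ws_def W_def)
    have "x - Q (averaging (Suc m) x) = Q (abs_L2 f - averaging (Suc m) (abs_L2 f))"
      unfolding eq by (simp add: f(3) linear_diff[OF Q(1)])
    then show "norm (x - Q (averaging (Suc m) x)) \<le> h m"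
      using Q(2) norm_averaging_error[OF f(1), of "Suc m"] hm[of m] order_trans by (metis One_nat_def Suc_le_mono le0)
  next
    show "h \<longlonglongrightarrow> 0" by (rule h0)
    show "(\<Sum>w\<leftarrow>ws m. norm w) \<le> 2" for m
      using hd[of m] h(2)[of m] Wn[of m] by (simp add: ws_def)
    show "zono_vol k (ws m) \<le> u m" for m
    proof -
      let ?b = "\<Sum>z\<leftarrow>[Q (h m *\<^sub>R ind 0 1)]. norm z"
      have b: "0 \<le> ?b" "?b \<le> h m" using hd[of m] by simp_all
      have W0: "0 \<le> (\<Sum>z\<leftarrow>W m. norm z)" by (intro sum_list_nonneg) auto
      have "zono_vol k (ws m) \<le> zono_vol k (W m) + 2 * ?b * (2 * (?b + (\<Sum>z\<leftarrow>W m. norm z))) ^ k'"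
        unfolding ws_def k' by (rule zono_vol_append_le)
      also have "\<dots> \<le> u m"
        unfolding u_def using b Wn[of m] W0 h(1)[of m]
        by (intro add_left_mono mult_mono power_mono mult_left_mono add_mono) auto
      finally show ?thesis .
    qed
    show "u \<longlonglongrightarrow> L"
    proof -
      have "u \<longlonglongrightarrow> L + 2 * 0 * (2 * (0 + 1)) ^ k'"
        unfolding u_def W_def by (intro tendsto_intros L h0)
      then show ?thesis by simp
    qed
    show "zono (vs m) \<subseteq> Q ` K_BM" for m
    proof -
      have "zono (vs m) = Q ` zono (map (ramp (Suc m)) (rev [1..<Suc m]))"
        unfolding linear_image_zono[OF Q(1)] by (simp add: vs_def comp_def)
      then show ?thesis using zono_ramps_subset_K_BM[of "Suc m"] by blast
    qed
    show "l m \<le> zono_vol k (vs m)" for m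
    proof -
      \<comment> \<open>Each step is the sum of a ramp and a short remainder.\<close>
      have eqW: "W m = map (\<lambda>i. Q (h m *\<^sub>R ind (real i / real (Suc m)) 1 - ramp (Suc m) i) + Q (ramp (Suc m) i)) (rev [1..<Suc m])"
        unfolding W_def steps_def hm by (simp add: linear_diff[OF Q(1)])
      have "zono (W m) \<subseteq> zono (rs m @ vs m)"
        unfolding eqW rs_def vs_def by (rule zono_map_add_subset)
      then have "zono_vol k (W m) \<le> zono_vol k (rs m @ vs m)" by (rule zono_vol_mono)
      also have "\<dots> \<le> zono_vol k (vs m) + 2 * (\<Sum>z\<leftarrow>rs m. norm z) * (2 * ((\<Sum>z\<leftarrow>rs m. norm z) + (\<Sum>z\<leftarrow>vs m. norm z))) ^ k'"
        unfolding k' by (rule zono_vol_append_le)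
      also have "\<dots> \<le> zono_vol k (vs m) + 2 * sqrt (h m) * (2 * (sqrt (h m) + 1)) ^ k'"
      proof -
        have "0 \<le> (\<Sum>z\<leftarrow>rs m. norm z)" "0 \<le> (\<Sum>z\<leftarrow>vs m. norm z)" by (intro sum_list_nonneg; auto)+
        then show ?thesis using rsn[of m] vsn[of m] h[of m]
          by (intro add_left_mono mult_mono power_mono mult_left_mono add_mono) auto
      qed
      finally show ?thesis by (simp add: l_def)
    qed
    show "l \<longlonglongrightarrow> L"
    proof -
      have "l \<longlonglongrightarrow> L - 2 * 0 * (2 * (0 + 1)) ^ k'"
        unfolding l_def W_def by (intro tendsto_intros L sh0)
      then show ?thesis by simp
    qed
  qed
qed

section \<open>The limits of the zonotope volumes\<close>

text \<open>Projecting the indicator of \<open>[a, c]\<close> along that of \<open>[b, c]\<close> leaves the indicator of \<open>[a, b]\<close>, so the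
generators are self-similar.\<close>

lemma zono_vol_steps:
  assumes m: "m \<ge> 1"
  shows "zono_vol k (steps m) = iterated_sum (\<lambda>l. (real l / real m) powr 0) m k m"
proof -
  let ?G = "\<lambda>i l. ind (real i / real m) (real l / real m)"
  have le: "real i / real m \<le> real j / real m" if "i \<le> j" for i j
    using that by (intro divide_right_mono) auto
  have lt: "real i / real m < real j / real m" if "i < j" for i j
    using that m by (intro divide_strict_right_mono) auto
  have le1: "real l / real m \<le> 1" if "l \<le> m" for l using le[OF that] m by simp
  have "zono_vol k (map (\<lambda>i. (1 / real m) *\<^sub>R ?G i m) (rev [1..<m]))
      = chain_sum (1 / real m) (\<lambda>i l. sqrt ((real l - real i) / real m)) k m"
  proof (rule zono_vol_chain_sum[where m = m and G = ?G])
    fix i j l :: nat assume "1 \<le> i" "i < j" "j < l" "l \<le> m"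
    then show "perp (?G j l) (?G i l) = ?G i j" by (intro perp_ind le1 lt le) auto
  next
    fix j l :: nat assume "1 \<le> j" "j < l" "l \<le> m"
    then have "norm (?G j l) = sqrt (real l / real m - real j / real m)" by (intro norm_ind le le1) auto
    then show "norm (?G j l) = sqrt ((real l - real j) / real m)" by (simp add: diff_divide_distrib)
  qed (use m in auto)
  then show ?thesis using m by (simp add: steps_def chain_sum_eq_iterated_sum)
qed

text \<open>The generators are the indicators of \<open>[i/m, l/m]\<close> minus their means over \<open>[0, l/m]\<close>. What remains of such
a function after projecting along another one with the same \<open>l\<close> is of the same form: it is the
component orthogonal to the indicators of \<open>[0, j/m]\<close> and \<open>[j/m, l/m]\<close>.\<close>

lemma zono_vol_bridge_steps:
  assumes m: "m \<ge> 1"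
  shows "zono_vol k (map (perp (ind 0 1)) (steps m)) = iterated_sum (\<lambda>l. (real l / real m) powr (1 / 2)) m k m"
proof -
  let ?G = "\<lambda>i l. ind (real i / real m) (real l / real m)"
  define U where "U i l = ?G i l - ((real l - real i) / real l) *\<^sub>R ?G 0 l" for i l
  have le: "real i / real m \<le> real j / real m" if "i \<le> j" for i j
    using that by (intro divide_right_mono) auto
  have le1: "real l / real m \<le> 1" if "l \<le> m" for l using le[OF that] m by simp
  have GG: "?G i l \<bullet> ?G j l = (real l - real j) / real m" if "i \<le> j" "j \<le> l" "l \<le> m" for i j l
  proof -
    have "?G i l \<bullet> ?G j l = real l / real m - real j / real m"
      using that by (intro inner_ind_ind le le1) auto
    then show ?thesis by (simp add: diff_divide_distrib)
  qed
  have UU: "U i l \<bullet> U j l = (real l - real j) * real i / (real l * real m)" if "i \<le> j" "j < l" "l \<le> m" for i j l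
  proof -
    have "U i l \<bullet> U j l = ?G i l \<bullet> ?G j l - ((real l - real j) / real l) * (?G 0 l \<bullet> ?G i l)
        - ((real l - real i) / real l) * (?G 0 l \<bullet> ?G j l)
        + ((real l - real i) / real l) * (((real l - real j) / real l) * (?G 0 l \<bullet> ?G 0 l))"
    proof -
      have "(x - \<alpha> *\<^sub>R z) \<bullet> (y - \<beta> *\<^sub>R z) = x \<bullet> y - \<beta> * (z \<bullet> x) - \<alpha> * (z \<bullet> y) + \<alpha> * (\<beta> * (z \<bullet> z))"
        for x y z :: L2 and \<alpha> \<beta>
        by (simp add: inner_diff_left inner_diff_right inner_commute[of x z] right_diff_distrib)
      then show ?thesis unfolding U_def .
    qed
    also have "\<dots> = (real l - real j) / real m - ((real l - real j) / real l) * ((real l - real i) / real m)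
        - ((real l - real i) / real l) * ((real l - real j) / real m)
        + ((real l - real i) / real l) * (((real l - real j) / real l) * (real l / real m))"
      using GG[of i j l] GG[of 0 i l] GG[of 0 j l] GG[of 0 0 l] that by simp
    also have "\<dots> = (real l - real j) * real i / (real l * real m)"
      using that m by (simp add: field_simps)
    finally show ?thesis .
  qed
  have "zono_vol k (map (\<lambda>i. (1 / real m) *\<^sub>R U i m) (rev [1..<m]))
      = chain_sum (1 / real m) (\<lambda>i l. sqrt ((real l - real i) * real i / (real l * real m))) k m"
  proof (rule zono_vol_chain_sum[where m = m and G = U])
    fix i j l :: nat assume ijl: "1 \<le> i" "i < j" "j < l" "l \<le> m"
    have s1: "?G i l = ?G i j + ?G j l" and s0: "?G 0 l = ?G 0 j + ?G j l"
      using ijl by (intro ind_split le; simp)+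
    have "(U i l \<bullet> U j l) / (U j l \<bullet> U j l) = real i / real j"
    proof -
      have e: "U i l \<bullet> U j l = (real l - real j) * real i / (real l * real m)"
        "U j l \<bullet> U j l = (real l - real j) * real j / (real l * real m)"
        using ijl by (intro UU; simp)+
      show ?thesis unfolding e using ijl m by simp
    qed
    then have "perp (U j l) (U i l) = U i l - (real i / real j) *\<^sub>R U j l" by (simp add: perp_def)
    also have "\<dots> = ?G i j + (1 - real i / real j - ((real l - real i) / real l - (real i / real j) * ((real l - real j) / real l))) *\<^sub>R ?G j l
        - ((real l - real i) / real l - (real i / real j) * ((real l - real j) / real l)) *\<^sub>R ?G 0 j"
      unfolding U_def s1 s0 by (simp add: algebra_simps)
    also have "(real l - real i) / real l - (real i / real j) * ((real l - real j) / real l) = (real j - real i) / real j"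
      using ijl by (simp add: field_simps)
    also have "1 - real i / real j - (real j - real i) / real j = 0"
      using ijl by (simp add: field_simps)
    finally show "perp (U j l) (U i l) = U i j" by (simp add: U_def)
  next
    fix j l :: nat assume "1 \<le> j" "j < l" "l \<le> m"
    then show "norm (U j l) = sqrt ((real l - real j) * real j / (real l * real m))"
      using UU[of j j l] by (simp add: norm_eq_sqrt_inner)
  qed (use m in auto)
  moreover have "map (perp (ind 0 1)) (steps m) = map (\<lambda>i. (1 / real m) *\<^sub>R U i m) (rev [1..<m])"
  proof -
    have "perp (ind 0 1) (ind (real i / real m) 1) = U i m" if "i < m" for i
    proof -
      have "ind (real i / real m) 1 \<bullet> ind 0 1 = (real m - real i) / real m" "ind 0 1 \<bullet> ind 0 1 = 1"
        using GG[of 0 i m] GG[of 0 0 m] that m by (simp_all add: inner_commute)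
      then show ?thesis using m by (simp add: perp_def U_def)
    qed
    then show ?thesis by (auto simp: steps_def perp_scale)
  qed
  ultimately show ?thesis
    using chain_sum_bridge_eq_iterated_sum[OF m m, of k] m by simp
qed

section \<open>The four function classes\<close>

lemma ind_unit_interval: "ind 0 1 = abs_L2 (\<lambda>_. 1)"
  unfolding ind_def
  by (rule abs_L2_eqI[of _ _ "{}"]) (auto intro: square_integrable_indicator square_integrable_continuous_on)

lemma perp_const_eq_centering:
  assumes "square_integrable f"
  shows "perp (ind 0 1) (abs_L2 f) = abs_L2 (\<lambda>t. f t - integral {0..1} f)"
proof -
  have c: "square_integrable (\<lambda>_. c)" for c by (intro square_integrable_continuous_on continuous_intros)
  have "perp (ind 0 1) (abs_L2 f) = abs_L2 f - integral {0..1} f *\<^sub>R ind 0 1"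
    using inner_ind[OF assms, of 0 1] by (simp add: perp_def inner_ind_ind)
  also have "integral {0..1} f *\<^sub>R ind 0 1 = abs_L2 (\<lambda>_. integral {0..1} f)"
    unfolding ind_unit_interval abs_L2_scale[OF c] by simp
  finally show ?thesis using abs_L2_diff[OF assms c] by simp
qed

lemma lipschitz_diff_const:
  fixes f :: "real \<Rightarrow> real"
  shows "1-lipschitz_on {0..1} f \<Longrightarrow> 1-lipschitz_on {0..1} (\<lambda>t. f t - c)"
  unfolding lipschitz_1_iff by simp

lemma integral_minus_mean:
  assumes "1-lipschitz_on {0..1} (f :: real \<Rightarrow> real)"
  shows "integral {0..1} (\<lambda>t. f t - c) = integral {0..1} f - c"
  using Henstock_Kurzweil_Integration.integral_diff[OF integrable_continuous_real[OF lipschitz_on_continuous_on[OF assms]] integrable_const_ivl, of c]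
  by simp

lemma K_BB_eq: "K_BB = perp (ind 0 1) ` K_BM"
proof (intro equalityI subsetI)
  fix x assume "x \<in> K_BB"
  then obtain f where f: "1-lipschitz_on {0..1} f" "integral {0..1} f = 0" "x = abs_L2 f" by (auto simp: K_BB_def)
  let ?g = "\<lambda>t. f t - f 0"
  have g: "1-lipschitz_on {0..1} ?g" by (rule lipschitz_diff_const[OF f(1)])
  have "perp (ind 0 1) (abs_L2 ?g) = abs_L2 (\<lambda>t. ?g t - integral {0..1} ?g)"
    by (rule perp_const_eq_centering[OF lipschitz_square_integrable[OF g]])
  also have "\<dots> = x" using integral_minus_mean[OF f(1), of "f 0"] f by simp
  finally show "x \<in> perp (ind 0 1) ` K_BM" using g by (force simp: K_BM_def)
next
  fix x assume "x \<in> perp (ind 0 1) ` K_BM"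
  then obtain f where f: "1-lipschitz_on {0..1} f" "x = perp (ind 0 1) (abs_L2 f)" by (auto simp: K_BM_def)
  then have "x = abs_L2 (\<lambda>t. f t - integral {0..1} f)" by (simp add: perp_const_eq_centering lipschitz_square_integrable)
  moreover have "1-lipschitz_on {0..1} (\<lambda>t. f t - integral {0..1} f)" by (rule lipschitz_diff_const[OF f(1)])
  moreover have "integral {0..1} (\<lambda>t. f t - integral {0..1} f) = 0" using integral_minus_mean[OF f(1)] by simp
  ultimately show "x \<in> K_BB" by (auto simp: K_BB_def)
qed

lemma averaging_one: "m \<ge> 1 \<Longrightarrow> averaging m (ind 0 1) = ind 0 1"
proof -
  assume m: "m \<ge> 1"
  have c: "real m * (ind 0 1 \<bullet> cell m j) = 1" if "j < m" for j
    unfolding cell_def using cell_bounds[OF that] m by (subst inner_ind_ind) auto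
  have s: "(\<Sum>j<n. cell m j) = ind 0 (real n / real m)" if "n \<le> m" for n
    using that
  proof (induction n)
    case (Suc n)
    then have "ind 0 (real (Suc n) / real m) = ind 0 (real n / real m) + cell m n"
      unfolding cell_def using cell_bounds[of n m] by (intro ind_split) auto
    then show ?case using Suc by simp
  qed (simp add: ind_self)
  have "averaging m (ind 0 1) = (\<Sum>j<m. cell m j)"
    unfolding averaging_def using c by (intro sum.cong) auto
  then show ?thesis using s[of m] m by simp
qed

text \<open>An increment of \<open>f\<close> lies between \<open>0\<close> and \<open>t - s\<close> iff the corresponding increment of \<open>2 f - id\<close> lies between
\<open>- (t - s)\<close> and \<open>t - s\<close>. Therefore the monotone classes are translates of the Lipschitz classes scaled
by \<open>1 / 2\<close>.\<close>

lemma monotone_lipschitz_iff: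
  fixes f :: "real \<Rightarrow> real"
  shows "1-lipschitz_on {0..1} f \<and> mono_on {0..1} f \<longleftrightarrow> 1-lipschitz_on {0..1} (\<lambda>t. 2 * f t - t)"
proof -
  have "(\<bar>f t - f s\<bar> \<le> t - s \<and> f s \<le> f t) \<longleftrightarrow> \<bar>(2 * f t - t) - (2 * f s - s)\<bar> \<le> t - s" for s t
    by linarith
  then show ?thesis unfolding lipschitz_1_iff mono_on_def by blast
qed

lemma midpoint_with_linear:
  fixes a :: real
  assumes f: "1-lipschitz_on {0..1} f"
  shows "(1 / 2) *\<^sub>R abs_L2 (\<lambda>t. t - a) + (1 / 2) *\<^sub>R abs_L2 f = abs_L2 (\<lambda>t. ((t - a) + f t) / 2)"
proof -
  have i: "square_integrable (\<lambda>t. t - a)" by (intro square_integrable_continuous_on continuous_intros)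
  have fi: "square_integrable f" by (rule lipschitz_square_integrable[OF f])
  have "(1 / 2) *\<^sub>R abs_L2 (\<lambda>t. t - a) + (1 / 2) *\<^sub>R abs_L2 f = abs_L2 (\<lambda>t. (1 / 2) * (t - a) + (1 / 2) * f t)"
    unfolding abs_L2_scale[OF i] abs_L2_scale[OF fi]
    by (rule abs_L2_add[OF square_integrable_scale[OF i] square_integrable_scale[OF fi]])
  then show ?thesis by (simp add: add_divide_distrib)
qed

lemma L_BM_eq: "L_BM = (\<lambda>x. (1 / 2) *\<^sub>R abs_L2 (\<lambda>t. t) + (1 / 2) *\<^sub>R x) ` K_BM"
proof (intro equalityI subsetI)
  fix x assume "x \<in> L_BM"
  then obtain f where f: "1-lipschitz_on {0..1} f" "mono_on {0..1} f" "f 0 = 0" "x = abs_L2 f" by (auto simp: L_BM_def)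
  let ?g = "\<lambda>t. 2 * f t - t"
  have g: "1-lipschitz_on {0..1} ?g" using f monotone_lipschitz_iff by blast
  have "x = (1 / 2) *\<^sub>R abs_L2 (\<lambda>t. t) + (1 / 2) *\<^sub>R abs_L2 ?g"
    using midpoint_with_linear[OF g, of 0] f(4) by simp
  then show "x \<in> (\<lambda>x. (1 / 2) *\<^sub>R abs_L2 (\<lambda>t. t) + (1 / 2) *\<^sub>R x) ` K_BM"
    using g f(3) by (auto simp: K_BM_def)
next
  fix x assume "x \<in> (\<lambda>x. (1 / 2) *\<^sub>R abs_L2 (\<lambda>t. t) + (1 / 2) *\<^sub>R x) ` K_BM"
  then obtain g where g: "1-lipschitz_on {0..1} g" "g 0 = 0" "x = (1 / 2) *\<^sub>R abs_L2 (\<lambda>t. t) + (1 / 2) *\<^sub>R abs_L2 g"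
    by (auto simp: K_BM_def)
  let ?f = "\<lambda>t. (t + g t) / 2"
  have eq: "(\<lambda>t. 2 * ?f t - t) = g" by (rule ext) (simp add: field_simps)
  have "1-lipschitz_on {0..1} ?f \<and> mono_on {0..1} ?f" unfolding monotone_lipschitz_iff eq by (rule g(1))
  moreover have "x = abs_L2 ?f" using midpoint_with_linear[OF g(1), of 0] g(3) by simp
  ultimately show "x \<in> L_BM" using g(2) by (auto simp: L_BM_def)
qed

lemma L_BB_eq: "L_BB = (\<lambda>x. (1 / 2) *\<^sub>R abs_L2 (\<lambda>t. t - 1 / 2) + (1 / 2) *\<^sub>R x) ` K_BB"
proof -
  have "((\<lambda>t::real. t) has_integral (1\<^sup>2 / 2 - 0\<^sup>2 / 2)) {0..1}"
    by (rule fundamental_theorem_of_calculus)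
      (auto intro!: derivative_eq_intros simp flip: has_real_derivative_iff_has_vector_derivative)
  then have id0: "integral {0..1} (\<lambda>t::real. t) = 1 / 2" by (simp add: integral_unique)
  have idi: "(\<lambda>t::real. t) integrable_on {0..1}" by (intro integrable_continuous_real continuous_intros)
  show ?thesis
  proof (intro equalityI subsetI)
    fix x assume "x \<in> L_BB"
    then obtain f where f: "1-lipschitz_on {0..1} f" "mono_on {0..1} f" "integral {0..1} f = 0" "x = abs_L2 f"
      by (auto simp: L_BB_def)
    let ?h = "\<lambda>t. 2 * f t - t" and ?g = "\<lambda>t. 2 * f t - t + 1 / 2"
    have h: "1-lipschitz_on {0..1} ?h" using f monotone_lipschitz_iff by blast
    have g: "1-lipschitz_on {0..1} ?g" using lipschitz_diff_const[OF h, of "- (1 / 2)"] by simp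
    have fi: "f integrable_on {0..1}" by (intro integrable_continuous_real lipschitz_on_continuous_on[OF f(1)])
    have "integral {0..1} ?h = 2 * integral {0..1} f - 1 / 2"
      using Henstock_Kurzweil_Integration.integral_diff[OF integrable_on_cmult_left[OF fi, of 2] idi] id0 by simp
    then have "integral {0..1} ?g = 0" using integral_minus_mean[OF h, of "- (1 / 2)"] f(3) by simp
    moreover have "x = (1 / 2) *\<^sub>R abs_L2 (\<lambda>t. t - 1 / 2) + (1 / 2) *\<^sub>R abs_L2 ?g"
      using midpoint_with_linear[OF g, of "1 / 2"] f(4) by simp
    ultimately show "x \<in> (\<lambda>x. (1 / 2) *\<^sub>R abs_L2 (\<lambda>t. t - 1 / 2) + (1 / 2) *\<^sub>R x) ` K_BB"
      using g by (auto simp: K_BB_def)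
  next
    fix x assume "x \<in> (\<lambda>x. (1 / 2) *\<^sub>R abs_L2 (\<lambda>t. t - 1 / 2) + (1 / 2) *\<^sub>R x) ` K_BB"
    then obtain g where g: "1-lipschitz_on {0..1} g" "integral {0..1} g = 0"
      "x = (1 / 2) *\<^sub>R abs_L2 (\<lambda>t. t - 1 / 2) + (1 / 2) *\<^sub>R abs_L2 g"
      by (auto simp: K_BB_def)
    let ?f = "\<lambda>t. ((t - 1 / 2) + g t) / 2"
    have eq: "(\<lambda>t. 2 * ?f t - t) = (\<lambda>t. g t - 1 / 2)" by (auto simp: field_simps)
    have fl: "1-lipschitz_on {0..1} ?f \<and> mono_on {0..1} ?f"
      unfolding monotone_lipschitz_iff eq by (rule lipschitz_diff_const[OF g(1)])
    have gi: "g integrable_on {0..1}" by (intro integrable_continuous_real lipschitz_on_continuous_on[OF g(1)])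
    have i1: "((\<lambda>t::real. t) has_integral 1 / 2) {0..1}" using integrable_integral[OF idi] id0 by simp
    have i2: "((\<lambda>_. 1 / 2) has_integral (1 / 2 :: real)) {0..1::real}"
      using has_integral_const_real[of "1 / 2 :: real" 0 1] by simp
    have i3: "(g has_integral 0) {0..1}" using integrable_integral[OF gi] g(2) by simp
    have "((\<lambda>t. ((t - 1 / 2) + g t) / 2) has_integral ((1 / 2 - 1 / 2) + 0) / 2) {0..1}"
      by (intro has_integral_divide has_integral_add has_integral_diff i1 i2 i3)
    from integral_unique[OF this] have "integral {0..1} ?f = 0" by (simp only: diff_self add_0 div_0)
    moreover have "x = abs_L2 ?f" using midpoint_with_linear[OF g(1), of "1 / 2"] g(3) by simp
    ultimately show "x \<in> L_BB" using fl by (auto simp: L_BB_def)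
  qed
qed

lemma intrinsic_volume_affine_K_BM:
  assumes "k \<ge> 1" "s > 0"
  shows "intrinsic_volume k ((\<lambda>x. c + s *\<^sub>R x) ` K_BM) = ennreal (s ^ k * (pi powr (real k / 2) / Gamma (3 / 2 * real k + 1)))"
proof -
  have "iterated_beta 0 k = pi powr (real k / 2) / Gamma (3 / 2 * real k + 1)"
    by (simp add: iterated_beta_closed_form)
  moreover have "(\<lambda>n. zono_vol k (map (\<lambda>x. x) (steps (Suc n)))) \<longlonglongrightarrow> iterated_beta 0 k"
    using iterated_sum_tendsto[of 0 k] by (simp add: zono_vol_steps)
  ultimately show ?thesis
    using intrinsic_volume_linear_image_K_BM[of "\<lambda>x. x" k s "iterated_beta 0 k" c] assms by (simp add: linear_id[unfolded id_def])
qed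

lemma intrinsic_volume_affine_K_BB:
  assumes "k \<ge> 1" "s > 0"
  shows "intrinsic_volume k ((\<lambda>x. c + s *\<^sub>R x) ` K_BB)
    = ennreal (s ^ k * (pi powr ((real k + 1) / 2) / (2 * Gamma (3 / 2 * real k + 3 / 2))))"
proof -
  have G: "Gamma (1 / 2 + 1 :: real) = sqrt pi / 2"
    using Gamma_three_halves by simp
  have p: "pi powr ((real k + 1) / 2) = pi powr (real k / 2) * sqrt pi"
    by (simp add: add_divide_distrib powr_add powr_half_sqrt)
  have "iterated_beta (1 / 2) k = pi powr (real k / 2) * (sqrt pi / 2) / Gamma (3 / 2 * real k + 1 / 2 + 1)"
    unfolding G[symmetric] by (rule iterated_beta_closed_form) simp
  also have "3 / 2 * real k + 1 / 2 + 1 = 3 / 2 * real k + 3 / 2" by simp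
  finally have L: "iterated_beta (1 / 2) k = pi powr ((real k + 1) / 2) / (2 * Gamma (3 / 2 * real k + 3 / 2))"
    unfolding p by simp
  have "(\<lambda>n. zono_vol k (map (perp (ind 0 1)) (steps (Suc n)))) \<longlonglongrightarrow> iterated_beta (1 / 2) k"
    using iterated_sum_tendsto[of "1 / 2" k] by (simp add: zono_vol_bridge_steps)
  \<comment> \<open>Averaging reproduces constants, which the projection annihilates.\<close>
  moreover have "perp (ind 0 1) (averaging m (perp (ind 0 1) x)) = perp (ind 0 1) (averaging m x)" if "m \<ge> 1" for m x
  proof -
    define a where "a = (x \<bullet> ind 0 1) / (ind 0 1 \<bullet> ind 0 1)"
    have "averaging m (perp (ind 0 1) x) = averaging m x - a *\<^sub>R ind 0 1"
      unfolding perp_def a_def[symmetric]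
      by (simp add: linear_diff[OF linear_averaging] linear_scale[OF linear_averaging] averaging_one[OF that])
    then show ?thesis by (simp add: linear_diff[OF linear_perp] linear_scale[OF linear_perp])
  qed
  ultimately show ?thesis
    using intrinsic_volume_linear_image_K_BM[of "perp (ind 0 1)" k s "iterated_beta (1 / 2) k" c] assms
    unfolding K_BB_eq L[symmetric] by (simp add: linear_perp norm_perp_le)
qed

theorem theorem1p4:
  fixes k :: nat
  assumes "k \<ge> 1"
  shows "intrinsic_volume k K_BM = ennreal (pi powr (real k / 2) / Gamma (3 / 2 * real k + 1)) \<and>
         intrinsic_volume k K_BB =
           ennreal (pi powr ((real k + 1) / 2) / (2 * Gamma (3 / 2 * real k + 3 / 2))) \<and>
         intrinsic_volume k L_BM = intrinsic_volume k K_BM / 2 ^ k \<and>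
         intrinsic_volume k L_BB = intrinsic_volume k K_BB / 2 ^ k"
proof -
  have half: "ennreal ((1 / 2) ^ k * x) = ennreal x / 2 ^ k" if "x \<ge> 0" for x
  proof -
    have "(2::ennreal) ^ k = ennreal (2 ^ k)" by (simp flip: ennreal_power)
    then show ?thesis using that by (simp add: divide_ennreal power_one_over)
  qed
  have BM: "intrinsic_volume k K_BM = ennreal (pi powr (real k / 2) / Gamma (3 / 2 * real k + 1))"
    using intrinsic_volume_affine_K_BM[OF assms, of 1 0] by simp
  have BB: "intrinsic_volume k K_BB = ennreal (pi powr ((real k + 1) / 2) / (2 * Gamma (3 / 2 * real k + 3 / 2)))"
    using intrinsic_volume_affine_K_BB[OF assms, of 1 0] by simp
  have "0 < Gamma (3 / 2 * real k + 1)" "0 < Gamma (3 / 2 * real k + 3 / 2)"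
    by (intro Gamma_real_pos; simp)+
  then have nonneg: "0 \<le> pi powr (real k / 2) / Gamma (3 / 2 * real k + 1)"
    "0 \<le> pi powr ((real k + 1) / 2) / (2 * Gamma (3 / 2 * real k + 3 / 2))"
    by (simp_all only: divide_nonneg_pos powr_ge_zero zero_less_mult_iff) simp_all
  have "intrinsic_volume k L_BM = intrinsic_volume k K_BM / 2 ^ k"
    unfolding L_BM_eq BM half[OF nonneg(1), symmetric]
    by (rule intrinsic_volume_affine_K_BM[OF assms]) simp
  moreover have "intrinsic_volume k L_BB = intrinsic_volume k K_BB / 2 ^ k"
    unfolding L_BB_eq BB half[OF nonneg(2), symmetric]
    by (rule intrinsic_volume_affine_K_BB[OF assms]) simp
  ultimately show ?thesis using BM BB by blast
qed

end
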